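(* Let $d=3$ and $\sigma\ge0$. Let $p\in(\frac32,2]$, $s\in(\frac3p-\frac12,\frac32]$, and $H=s-\frac32\in(\frac3p-2,0]$. Let $\mathcal D\subset\mathbb R^3$ be a bounded domain and let $f$ be a real-valued centered Gaussian random field with compact support contained in $\mathcal D$ whose covariance operator $Q_f$ is a classical pseudo-differential operator with principal symbol $\mu(x)|\xi|^{-2s}$, where $0\le\mu\in C_0^\infty(\mathcal D)$. Assume that $f\in L^2(\Omega,W^{H-\epsilon,p}(\mathbb R^3))$ for any $\epsilon>0$. Let $\mathcal U\subset\mathbb R^3$ be a bounded domain with $\mathrm{dist}(\mathcal U,\mathcal D)=r_0>0$. For $k>0$ let $$u(x;k)=-\frac1{4\pi}\int_{\mathbb R^3}\frac{e^{\mathrm i\kappa|x-y|}}{|x-y|}f(y)\,dy$$ be the solution of $\Delta u+(k^2+\mathrm i k\sigma)u=f$ in $\mathbb R^3$. Then for any $x\in\mathcal U$, $$\lim_{k\to\infty}k^{2s}\,\mathbb E|u(x;k)|^2=\frac1{2^4\pi^2}\int_{\mathbb R^3}\frac{e^{-\sigma|x-y|}}{|x-y|^2}\mu(y)\,dy .$$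
   Context: $(\Omega,\mathcal F,\mathbb P)$ is a complete probability space. A real-valued centered Gaussian random field is a measurable map $f:\Omega\to\mathcal S'(\mathbb R^3)$ with real values such that $\langle f,\phi\rangle$ is a centered Gaussian random variable for each real $\phi\in C_0^\infty$. Its covariance operator $Q_f:C_0^\infty\to\mathcal S'$ is given by $\langle\varphi,Q_f\psi\rangle=\mathbb E[\langle f,\varphi\rangle\langle f,\psi\rangle]$. That $Q_f$ is a classical pseudo-differential operator with principal symbol $\mu(x)|\xi|^{-2s}$ means $(Q_f\psi)(x)=\frac1{(2\pi)^3}\int_{\mathbb R^3}e^{\mathrm i x\cdot\xi}c(x,\xi)\hat\psi(\xi)\,d\xi$ for $\psi\in C_0^\infty$, with $\hat\psi(\xi)=\int e^{-\mathrm i x\cdot\xi}\psi(x)\,dx$, where $c$ is a classical symbol of order $-2s$ with leading term $\mu(x)|\xi|^{-2s}$. $\kappa$ is the square root of $k^2+\mathrm i k\sigma$ with $\Re\kappa>0$, $\Im\kappa\ge0$. For $x\in\mathcal U$ the integral defining $u(x;k)$ is the pairing of $f$ with a function of $y$ which is smooth near the support of $f$. $W^{t,p}(\mathbb R^3)$ is the Sobolev (Bessel potential) space. *)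

theory Defs
  imports "HOL-Probability.Probability"
begin

section \<open>Smooth functions, test functions, Schwartz functions\<close>

definition dir_deriv ::
  "'a::euclidean_space \<Rightarrow> ('a \<Rightarrow> 'b::real_normed_vector) \<Rightarrow> 'a \<Rightarrow> 'b" where
  "dir_deriv b f = (\<lambda>x. frechet_derivative f (at x) b)"

definition partials ::
  "'a::euclidean_space list \<Rightarrow> ('a \<Rightarrow> 'b::real_normed_vector) \<Rightarrow> 'a \<Rightarrow> 'b" where
  "partials bs f = foldr dir_deriv bs f"

text \<open>The sets \<open>S\<close> below are always open.\<close>

primrec Ck_on :: "nat \<Rightarrow> 'a::euclidean_space set \<Rightarrow> ('a \<Rightarrow> 'b::real_normed_vector) \<Rightarrow> bool" where
  "Ck_on 0 S f \<longleftrightarrow> continuous_on S f"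
| "Ck_on (Suc n) S f \<longleftrightarrow> f differentiable_on S \<and> (\<forall>b\<in>Basis. Ck_on n S (dir_deriv b f))"

definition smooth_on :: "'a::euclidean_space set \<Rightarrow> ('a \<Rightarrow> 'b::real_normed_vector) \<Rightarrow> bool" where
  "smooth_on S f \<longleftrightarrow> (\<forall>n. Ck_on n S f)"

definition test_function ::
  "'a::euclidean_space set \<Rightarrow> ('a \<Rightarrow> 'b::real_normed_vector) \<Rightarrow> bool" where
  "test_function V \<phi> \<longleftrightarrow>
     smooth_on UNIV \<phi> \<and> compact (closure {x. \<phi> x \<noteq> 0}) \<and> closure {x. \<phi> x \<noteq> 0} \<subseteq> V"

definition schwartz :: "('a::euclidean_space \<Rightarrow> complex) \<Rightarrow> bool" where
  "schwartz \<phi> \<longleftrightarrow> smooth_on UNIV \<phi> \<and>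
     (\<forall>N bs. set bs \<subseteq> Basis \<longrightarrow> bounded (range (\<lambda>x. (1 + norm x) ^ N *\<^sub>R partials bs \<phi> x)))"

definition schwartz_seminorm :: "nat \<Rightarrow> ('a::euclidean_space \<Rightarrow> complex) \<Rightarrow> real" where
  "schwartz_seminorm N \<phi> =
     (SUP (bs, x) \<in> {bs. set bs \<subseteq> Basis \<and> length bs \<le> N} \<times> UNIV.
        (1 + norm x) ^ N * norm (partials bs \<phi> x))"

section \<open>Tempered distributions\<close>

text \<open>
  A distribution is a functional on complex-valued functions of which only the values at
  Schwartz functions matter. The pairing is bilinear (no complex conjugation).
\<close>

type_synonym 'a distribution = "('a \<Rightarrow> complex) \<Rightarrow> complex"

definition tempered :: "'a::euclidean_space distribution \<Rightarrow> bool" where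
  "tempered T \<longleftrightarrow>
     (\<forall>\<phi> \<psi> a b. schwartz \<phi> \<longrightarrow> schwartz \<psi> \<longrightarrow>
        T (\<lambda>x. a * \<phi> x + b * \<psi> x) = a * T \<phi> + b * T \<psi>) \<and>
     (\<exists>C N. \<forall>\<phi>. schwartz \<phi> \<longrightarrow> norm (T \<phi>) \<le> C * schwartz_seminorm N \<phi>)"

definition real_distribution :: "'a::euclidean_space distribution \<Rightarrow> bool" where
  "real_distribution T \<longleftrightarrow>
     (\<forall>\<phi>::'a \<Rightarrow> real. schwartz (\<lambda>x. complex_of_real (\<phi> x)) \<longrightarrow>
        T (\<lambda>x. complex_of_real (\<phi> x)) \<in> \<real>)"

definition dist_support :: "'a::euclidean_space distribution \<Rightarrow> 'a set" where
  "dist_support T = - \<Union>{V. open V \<and> (\<forall>\<phi>. test_function V \<phi> \<longrightarrow> T \<phi> = 0)}"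

text \<open>
  Pairing of a compactly supported distribution with a function \<open>g\<close> that need only be smooth near
  the support: the common value of \<open>T (\<eta> g)\<close> over all cutoffs \<open>\<eta>\<close> that equal 1 near the support
  of \<open>T\<close> and for which \<open>\<eta> g\<close> is a test function.
\<close>

definition cutoff_near :: "'a::euclidean_space set \<Rightarrow> ('a \<Rightarrow> complex) \<Rightarrow> bool" where
  "cutoff_near K \<eta> \<longleftrightarrow>
     test_function UNIV \<eta> \<and> (\<exists>W. open W \<and> K \<subseteq> W \<and> (\<forall>y\<in>W. \<eta> y = 1))"

definition dist_pairing :: "'a::euclidean_space distribution \<Rightarrow> ('a \<Rightarrow> complex) \<Rightarrow> complex" where
  "dist_pairing T g =
     (THE c. \<forall>\<eta>. cutoff_near (dist_support T) \<eta> \<longrightarrow>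
        test_function UNIV (\<lambda>y. \<eta> y * g y) \<longrightarrow> T (\<lambda>y. \<eta> y * g y) = c)"

section \<open>Fourier transform and Bessel potential spaces\<close>

definition fourier :: "('a::euclidean_space \<Rightarrow> complex) \<Rightarrow> 'a \<Rightarrow> complex" where
  "fourier \<phi> = (\<lambda>\<xi>. LINT x|lborel. exp (- \<i> * complex_of_real (x \<bullet> \<xi>)) * \<phi> x)"

definition inv_fourier :: "('a::euclidean_space \<Rightarrow> complex) \<Rightarrow> 'a \<Rightarrow> complex" where
  "inv_fourier \<phi> = (\<lambda>x. complex_of_real (1 / (2 * pi) ^ DIM('a)) *
     (LINT \<xi>|lborel. exp (\<i> * complex_of_real (x \<bullet> \<xi>)) * \<phi> \<xi>))"

definition dist_fourier :: "'a::euclidean_space distribution \<Rightarrow> 'a distribution" where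
  "dist_fourier T = (\<lambda>\<phi>. T (fourier \<phi>))"

definition dist_inv_fourier :: "'a::euclidean_space distribution \<Rightarrow> 'a distribution" where
  "dist_inv_fourier T = (\<lambda>\<phi>. T (inv_fourier \<phi>))"

definition dist_mult ::
  "('a::euclidean_space \<Rightarrow> complex) \<Rightarrow> 'a distribution \<Rightarrow> 'a distribution" where
  "dist_mult m T = (\<lambda>\<phi>. T (\<lambda>x. m x * \<phi> x))"

definition bessel_potential ::
  "real \<Rightarrow> 'a::euclidean_space distribution \<Rightarrow> 'a distribution" where
  "bessel_potential t T = dist_inv_fourier
     (dist_mult (\<lambda>\<xi>. complex_of_real ((1 + (norm \<xi>)\<^sup>2) powr (t / 2))) (dist_fourier T))"

definition Lp_function :: "real \<Rightarrow> ('a::euclidean_space \<Rightarrow> complex) \<Rightarrow> bool" where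
  "Lp_function p g \<longleftrightarrow>
     g \<in> borel_measurable lborel \<and> integrable lborel (\<lambda>x. norm (g x) powr p)"

definition Lp_norm :: "real \<Rightarrow> ('a::euclidean_space \<Rightarrow> complex) \<Rightarrow> real" where
  "Lp_norm p g = (LINT x|lborel. norm (g x) powr p) powr (1 / p)"

definition represents ::
  "('a::euclidean_space \<Rightarrow> complex) \<Rightarrow> 'a distribution \<Rightarrow> bool" where
  "represents g T \<longleftrightarrow> (\<forall>\<phi>. schwartz \<phi> \<longrightarrow> T \<phi> = (LINT x|lborel. g x * \<phi> x))"

definition sobolev_space :: "real \<Rightarrow> real \<Rightarrow> 'a::euclidean_space distribution set" where
  "sobolev_space t p =
     {T. tempered T \<and> (\<exists>g. Lp_function p g \<and> represents g (bessel_potential t T))}"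

text \<open>The representing function is unique up to null sets, so the choice is immaterial.\<close>

definition sobolev_norm :: "real \<Rightarrow> real \<Rightarrow> 'a::euclidean_space distribution \<Rightarrow> real" where
  "sobolev_norm t p T =
     Lp_norm p (SOME g. Lp_function p g \<and> represents g (bessel_potential t T))"

section \<open>Gaussian random fields\<close>

text \<open>
  The space of tempered distributions with the sigma-algebra generated by the evaluation maps.
\<close>

definition tempered_algebra :: "'a::euclidean_space distribution measure" where
  "tempered_algebra =
     sigma {T. tempered T} {{T. tempered T \<and> T \<phi> \<in> A} | \<phi> A. schwartz \<phi> \<and> A \<in> sets borel}"

text \<open>The degenerate Gaussian (variance 0) is included.\<close>

definition centered_gaussian :: "'w measure \<Rightarrow> ('w \<Rightarrow> real) \<Rightarrow> bool" where
  "centered_gaussian M X \<longleftrightarrow>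
     (\<exists>v>0. distributed M lborel X (normal_density 0 v)) \<or>
     (X \<in> borel_measurable M \<and> (AE \<omega> in M. X \<omega> = 0))"

definition gaussian_random_field ::
  "'w measure \<Rightarrow> ('w \<Rightarrow> 'a::euclidean_space distribution) \<Rightarrow> bool" where
  "gaussian_random_field M f \<longleftrightarrow>
     f \<in> measurable M tempered_algebra \<and>
     (\<forall>\<omega>\<in>space M. real_distribution (f \<omega>)) \<and>
     (\<forall>\<phi>::'a \<Rightarrow> real. test_function UNIV \<phi> \<longrightarrow>
        centered_gaussian M (\<lambda>\<omega>. Re (f \<omega> (\<lambda>x. complex_of_real (\<phi> x)))))"

text \<open>
  Pathwise formulation; by the zero-one law for Gaussian fields one compact subset of \<open>D\<close> then
  serves for almost all \<open>\<omega>\<close>.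
\<close>

definition compactly_supported_in ::
  "'w measure \<Rightarrow> ('w \<Rightarrow> 'a::euclidean_space distribution) \<Rightarrow> 'a set \<Rightarrow> bool" where
  "compactly_supported_in M f D \<longleftrightarrow>
     (AE \<omega> in M. compact (dist_support (f \<omega>)) \<and> dist_support (f \<omega>) \<subseteq> D)"

text \<open>
  Since the Bessel potential spaces with \<open>1 < p < \<infinity>\<close> are separable, strong measurability of \<open>f\<close>
  into them follows from its measurability as a random tempered distribution.
\<close>

definition L2_sobolev ::
  "'w measure \<Rightarrow> real \<Rightarrow> real \<Rightarrow> ('w \<Rightarrow> 'a::euclidean_space distribution) \<Rightarrow> bool" where
  "L2_sobolev M t p f \<longleftrightarrow>
     (AE \<omega> in M. f \<omega> \<in> sobolev_space t p) \<and>
     integrable M (\<lambda>\<omega>. (sobolev_norm t p (f \<omega>))\<^sup>2)"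

definition covariance_operator ::
  "'w measure \<Rightarrow> ('w \<Rightarrow> 'a::euclidean_space distribution) \<Rightarrow> ('a \<Rightarrow> complex) \<Rightarrow> 'a distribution"
  where
  "covariance_operator M f \<psi> = (\<lambda>\<phi>. LINT \<omega>|M. f \<omega> \<phi> * f \<omega> \<psi>)"

section \<open>Classical pseudo-differential operators\<close>

text \<open>
  Symbols of type (1,0), with bounds locally uniform in \<open>x\<close>; this includes all symbols whose
  bounds hold uniformly on the whole space.
\<close>

definition symbol_class :: "real \<Rightarrow> ('a::euclidean_space \<times> 'a \<Rightarrow> complex) \<Rightarrow> bool" where
  "symbol_class m a \<longleftrightarrow> smooth_on UNIV a \<and>
     (\<forall>K bs cs. compact K \<longrightarrow> set bs \<subseteq> Basis \<longrightarrow> set cs \<subseteq> Basis \<longrightarrow>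
        (\<exists>C. \<forall>x\<in>K. \<forall>\<xi>.
           norm (partials (map (\<lambda>b. (b, 0)) bs @ map (\<lambda>b. (0, b)) cs) a (x, \<xi>))
             \<le> C * (1 + norm \<xi>) powr (m - real (length cs))))"

definition excision :: "('a::euclidean_space \<Rightarrow> real) \<Rightarrow> bool" where
  "excision \<theta> \<longleftrightarrow> smooth_on UNIV \<theta> \<and>
     (\<exists>r>0. \<forall>\<xi>. norm \<xi> < r \<longrightarrow> \<theta> \<xi> = 0) \<and> (\<forall>\<xi>. norm \<xi> \<ge> 1 \<longrightarrow> \<theta> \<xi> = 1)"

text \<open>
  \<open>c\<close> has an asymptotic expansion into terms \<open>a j\<close> positively homogeneous in \<open>\<xi>\<close> of degree
  \<open>m - j\<close>, the leading one being \<open>c0\<close>. The case \<open>N = 0\<close> says that \<open>c\<close> is a symbol of order \<open>m\<close>.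
\<close>

definition classical_symbol ::
  "real \<Rightarrow> ('a::euclidean_space \<Rightarrow> 'a \<Rightarrow> complex) \<Rightarrow> ('a \<times> 'a \<Rightarrow> complex) \<Rightarrow> bool" where
  "classical_symbol m c0 c \<longleftrightarrow>
     (\<exists>(a::nat \<Rightarrow> 'a \<times> 'a \<Rightarrow> complex) \<theta>. excision \<theta> \<and>
        (\<forall>j. smooth_on {(x, \<xi>). \<xi> \<noteq> 0} (a j)) \<and>
        (\<forall>j x \<xi> r. \<xi> \<noteq> 0 \<longrightarrow> r > 0 \<longrightarrow>
           a j (x, r *\<^sub>R \<xi>) = complex_of_real (r powr (m - real j)) * a j (x, \<xi>)) \<and>
        (\<forall>x \<xi>. \<xi> \<noteq> 0 \<longrightarrow> a 0 (x, \<xi>) = c0 x \<xi>) \<and>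
        (\<forall>N. symbol_class (m - real N)
           (\<lambda>(x, \<xi>). c (x, \<xi>) - (\<Sum>j<N. complex_of_real (\<theta> \<xi>) * a j (x, \<xi>)))))"

definition pdo ::
  "('a::euclidean_space \<times> 'a \<Rightarrow> complex) \<Rightarrow> ('a \<Rightarrow> complex) \<Rightarrow> 'a \<Rightarrow> complex" where
  "pdo c \<psi> = (\<lambda>x. complex_of_real (1 / (2 * pi) ^ DIM('a)) *
     (LINT \<xi>|lborel. exp (\<i> * complex_of_real (x \<bullet> \<xi>)) * c (x, \<xi>) * fourier \<psi> \<xi>))"

text \<open>
  \<open>Q \<psi>\<close> is the function \<open>pdo c \<psi>\<close>, as an identity of distributions.
\<close>

definition classical_pdo ::
  "real \<Rightarrow> ('a::euclidean_space \<Rightarrow> 'a \<Rightarrow> complex) \<Rightarrow> (('a \<Rightarrow> complex) \<Rightarrow> 'a distribution) \<Rightarrow> bool"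
  where
  "classical_pdo m c0 Q \<longleftrightarrow>
     (\<exists>c. classical_symbol m c0 c \<and>
        (\<forall>\<psi> \<phi>. test_function UNIV \<psi> \<longrightarrow> test_function UNIV \<phi> \<longrightarrow>
           Q \<psi> \<phi> = (LINT x|lborel. pdo c \<psi> x * \<phi> x)))"

section \<open>The wave field\<close>

definition bounded_domain :: "'a::euclidean_space set \<Rightarrow> bool" where
  "bounded_domain D \<longleftrightarrow> open D \<and> connected D \<and> D \<noteq> {} \<and> bounded D"

definition wave_number :: "real \<Rightarrow> real \<Rightarrow> complex" where
  "wave_number \<sigma> k =
     (THE \<kappa>. \<kappa>\<^sup>2 = complex_of_real (k\<^sup>2) + \<i> * complex_of_real (k * \<sigma>) \<and> Re \<kappa> > 0 \<and> Im \<kappa> \<ge> 0)"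

text \<open>The volume potential, for \<open>x\<close> off the support of the source \<open>T\<close>.\<close>

definition wave_field ::
  "real \<Rightarrow> real \<Rightarrow> (real^3) distribution \<Rightarrow> real^3 \<Rightarrow> complex" where
  "wave_field \<sigma> k T x = - complex_of_real (1 / (4 * pi)) *
     dist_pairing T (\<lambda>y. exp (\<i> * wave_number \<sigma> k * complex_of_real (norm (x - y))) /
                         complex_of_real (norm (x - y)))"

end

theory Submission
  imports Defs
begin

text \<open>
  Since \<open>f\<close> is real, \<open>16 \<pi>\<^sup>2 E \<bar>u(x; k)\<bar>\<^sup>2\<close> is the quadratic form of \<open>Q\<close> at \<open>\<phi> = \<zeta> e\<^sup>i\<^sup>\<kappa>\<^sup>\<rho>\<close>, where \<open>\<rho>\<close>
  is the distance to \<open>x\<close> and \<open>\<zeta>\<close> a cutoff of \<open>1/\<rho>\<close>. As \<open>\<bar>\<nabla>\<rho>\<bar> = 1\<close>, multiplying the Fourier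
  transform of \<open>\<phi>\<close> by \<open>\<bar>\<xi>\<bar>\<^sup>2 - \<kappa>\<^sup>2\<close> costs only one power of \<open>\<kappa>\<close>, so \<open>\<phi>\<close> concentrates in \<open>L\<^sup>2\<close> on the
  sphere \<open>\<bar>\<xi>\<bar> = k\<close>, with rapid decay in \<open>k\<close> on \<open>\<bar>\<xi>\<bar> \<le> k/2\<close>. Hence the leading symbol
  \<open>\<mu>(z) \<bar>\<xi>\<bar>\<^sup>-\<^sup>2\<^sup>s\<close> may be replaced by \<open>\<mu>(z) k\<^sup>-\<^sup>2\<^sup>s\<close>, and Parseval's identity turns the form into
  \<open>k\<^sup>-\<^sup>2\<^sup>s \<integral> \<mu> \<bar>\<phi>\<bar>\<^sup>2\<close>. The remaining symbol has order \<open>- 2 s - 1\<close>; written as an integral over \<open>w\<close>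
  of indicator functions of \<open>{z. w \<le> z}\<close> with weights \<open>\<partial>\<^sub>1 \<partial>\<^sub>2 \<partial>\<^sub>3\<close> of the symbol, it is controlled by
  Plancherel's inequality and contributes \<open>O(k\<^sup>-\<^sup>2\<^sup>s\<^sup>-\<^sup>1)\<close>. Finally \<open>2 Im \<kappa> \<rightarrow> \<sigma>\<close>.
\<close>

section \<open>Smooth functions\<close>

text \<open>No stationary phase is used and the transform of \<open>\<phi>\<close> is never
  computed; all that enters are L^2 bounds uniform in \<open>k\<close>. They are uniform because
  \<open>Im \<kappa> \<ge> 0\<close> keeps the modulus of the spherical wave at most 1. The
  transform times (|\<xi>| - k) is bounded in L^2, so freezing the multiplier at |\<xi>| = k costs a
  relative error O(1/k). The obstacle is the remainder symbol r: the integral over z of \<phi>(z)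
  e^(i z.\<xi>) r(z,\<xi>) is not the transform of one fixed function, so Plancherel's theorem does
  not apply to it directly, and the symbol bounds are only local in z. The decomposition into
  indicator functions separates the variables: \<xi> stays in the weights, z in truncations of
  \<phi>. Its price is one derivative in each coordinate, compact support in z (obtained by moving
  the cutoff \<open>\<zeta>\<close> into the symbol), and a Plancherel inequality that admits
  discontinuous functions. Since x lies at positive distance from D, the singularity of 1/\<rho> can
  be cut away without changing the pairing. Hence \<phi> is a genuine test function, to which the
  covariance hypothesis applies.\<close>

lemma dir_deriv_eq:
  assumes "(f has_derivative f') (at x)" shows "dir_deriv b f x = f' b"
  unfolding dir_deriv_def using frechet_derivative_at[OF assms] by simp

text \<open>\<open>frechet_derivative\<close> is a choice among all derivatives. Functions that
  agree near \<open>x\<close> have the same derivatives there, so the choices coincide even if there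
  are none.\<close>

lemma frechet_derivative_cong_open:
  assumes "open S" "x \<in> S" "\<And>y. y \<in> S \<Longrightarrow> f y = g y"
  shows "frechet_derivative f (at x) = frechet_derivative g (at x)"
proof -
  have "(f has_derivative f') (at x) \<longleftrightarrow> (g has_derivative f') (at x)" for f'
    using assms has_derivative_transform_within_open[of f f' x UNIV S g]
      has_derivative_transform_within_open[of g f' x UNIV S f] by auto
  then show ?thesis unfolding frechet_derivative_def by simp
qed

lemma dir_deriv_cong_open:
  assumes "open S" "x \<in> S" "\<And>y. y \<in> S \<Longrightarrow> f y = g y"
  shows "dir_deriv b f x = dir_deriv b g x"
  unfolding dir_deriv_def using frechet_derivative_cong_open[OF assms] by simp

lemma Ck_on_cong:
  assumes "open S" "\<And>y. y \<in> S \<Longrightarrow> f y = g y" "Ck_on n S f"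
  shows "Ck_on n S g"
  using assms(2,3)
proof (induction n arbitrary: f g)
  case 0 then show ?case by (auto cong: continuous_on_cong)
next
  case (Suc n)
  have "g differentiable_on S"
    using Suc.prems assms(1) unfolding Ck_on.simps differentiable_on_eq_differentiable_at[OF assms(1)]
      differentiable_def by (meson has_derivative_transform_within_open)
  moreover have "Ck_on n S (dir_deriv b g)" if "b \<in> Basis" for b
    using Suc.IH[of "dir_deriv b f" "dir_deriv b g"] Suc.prems that
      dir_deriv_cong_open[OF assms(1), of _ f g] by auto
  ultimately show ?case by simp
qed

text \<open>\<open>Ck_on\<close> speaks of the chosen derivative. This rule accepts any explicit
  derivative \<open>f'\<close> instead and drives the inductions below.\<close>

lemma Ck_on_SucI:
  assumes "open S" "\<And>x. x \<in> S \<Longrightarrow> (f has_derivative f' x) (at x)"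
    "\<And>b. b \<in> Basis \<Longrightarrow> Ck_on n S (\<lambda>x. f' x b)"
  shows "Ck_on (Suc n) S f"
proof -
  have "f differentiable_on S"
    using assms(2) unfolding differentiable_on_eq_differentiable_at[OF assms(1)] differentiable_def by blast
  moreover have "Ck_on n S (dir_deriv b f)" if "b \<in> Basis" for b
    using Ck_on_cong[OF assms(1) _ assms(3)[OF that], of "dir_deriv b f"] dir_deriv_eq[OF assms(2)] by simp
  ultimately show ?thesis by simp
qed

lemma Ck_on_SucD:
  assumes "Ck_on (Suc n) S f" "open S" "x \<in> S"
  shows "(f has_derivative frechet_derivative f (at x)) (at x)"
  using assms by (simp add: differentiable_on_eq_differentiable_at frechet_derivative_works)

lemma Ck_on_SucD_dir:
  assumes "Ck_on (Suc n) S f" "b \<in> Basis"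
  shows "Ck_on n S (\<lambda>x. frechet_derivative f (at x) b)"
  using assms by (simp add: dir_deriv_def)

lemma Ck_on_Suc_imp: "Ck_on (Suc n) S f \<Longrightarrow> Ck_on n S f"
proof (induction n arbitrary: f)
  case 0 then show ?case by (auto intro: differentiable_imp_continuous_on)
next
  case (Suc n) then show ?case by (auto)
qed

lemma Ck_on_subset:
  assumes "Ck_on n S f" "T \<subseteq> S" shows "Ck_on n T f"
  using assms(1)
proof (induction n arbitrary: f)
  case 0 then show ?case using assms(2) continuous_on_subset by auto
next
  case (Suc n) then show ?case using assms(2) differentiable_on_subset by auto
qed

text \<open>On open sets differentiability is a pointwise, hence local, condition. The use is to
  glue a function to its extension by zero.\<close>

lemma Ck_on_Un:
  assumes "open S" "open T" "Ck_on n S f" "Ck_on n T f"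
  shows "Ck_on n (S \<union> T) f"
  using assms(3,4)
proof (induction n arbitrary: f)
  case 0 then show ?case using assms continuous_on_open_Un by auto
next
  case (Suc n) then show ?case using assms(1,2)
    by (auto simp: differentiable_on_eq_differentiable_at open_Un)
qed

lemma Ck_on_const: "Ck_on n S (\<lambda>x. c)"
proof (induction n arbitrary: c)
  case (Suc n)
  have "dir_deriv b (\<lambda>x::'a. c) = (\<lambda>x. 0)" for b
    by (auto simp: dir_deriv_def)
  then show ?case using Suc by simp
qed auto

lemma Ck_on_bounded_linear:
  assumes "bounded_linear L" "open S" shows "Ck_on n S L"
proof (cases n)
  case 0 then show ?thesis by (simp add: linear_continuous_on assms)
next
  case (Suc m)
  show ?thesis unfolding Suc
    by (rule Ck_on_SucI[OF assms(2) bounded_linear_imp_has_derivative[OF assms(1)]]) (rule Ck_on_const)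
qed

lemma Ck_on_add:
  assumes S: "open S" and "Ck_on n S f" "Ck_on n S g"
  shows "Ck_on n S (\<lambda>x. f x + g x)"
  using assms(2,3)
proof (induction n arbitrary: f g)
  case 0 then show ?case by (auto intro: continuous_on_add)
next
  case (Suc n)
  show ?case
    by (rule Ck_on_SucI[OF S has_derivative_add[OF Ck_on_SucD[OF Suc.prems(1) S] Ck_on_SucD[OF Suc.prems(2) S]]])
      (use Suc.IH Ck_on_SucD_dir[OF Suc.prems(1)] Ck_on_SucD_dir[OF Suc.prems(2)] in auto)
qed

text \<open>The product rule writes the derivative as a sum of two bilinear terms in functions of
  class \<open>n\<close>, so the induction closes. One lemma thus covers multiplication, scaling and
  inner products.\<close>

lemma Ck_on_bilinear:
  assumes B: "bounded_bilinear op2" and S: "open S" and "Ck_on n S f" "Ck_on n S g"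
  shows "Ck_on n S (\<lambda>x. op2 (f x) (g x))"
  using assms(3,4)
proof (induction n arbitrary: f g)
  case 0 then show ?case by (auto intro: bounded_bilinear.continuous_on[OF B])
next
  case (Suc n)
  show ?case
    by (rule Ck_on_SucI[OF S bounded_bilinear.FDERIV[OF B Ck_on_SucD[OF Suc.prems(1) S] Ck_on_SucD[OF Suc.prems(2) S]]])
      (use Suc.IH Ck_on_SucD_dir[OF Suc.prems(1)] Ck_on_SucD_dir[OF Suc.prems(2)] Ck_on_Suc_imp[OF Suc.prems(1)]
          Ck_on_Suc_imp[OF Suc.prems(2)] in \<open>auto intro!: Ck_on_add[OF S]\<close>)
qed

lemma Ck_on_linear_comp:
  assumes L: "bounded_linear L" and S: "open S" and "Ck_on n S f"
  shows "Ck_on n S (\<lambda>x. L (f x))"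
  using assms(3)
proof (induction n arbitrary: f)
  case 0 then show ?case by (auto intro: bounded_linear.continuous_on[OF L])
next
  case (Suc n)
  show ?case
    by (rule Ck_on_SucI[OF S bounded_linear.has_derivative[OF L Ck_on_SucD[OF Suc.prems(1) S]]])
      (use Suc.IH Ck_on_SucD_dir[OF Suc.prems(1)] in auto)
qed

text \<open>With a real intermediate variable the chain rule has a single scalar factor, so
  \<open>Ck_on_bilinear\<close> finishes the induction. The cutoff functions need no more than
  this.\<close>

lemma Ck_on_compose_real:
  fixes h :: "real \<Rightarrow> 'c::real_normed_vector"
  assumes S: "open S" and T: "open T" and fT: "\<And>x. x \<in> S \<Longrightarrow> f x \<in> T"
    and "Ck_on n T h" "Ck_on n S f"
  shows "Ck_on n S (\<lambda>x. h (f x))"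
  using assms(4,5)
proof (induction n arbitrary: h)
  case 0 then show ?case using fT by (auto intro!: continuous_on_compose2[of T h S f])
next
  case (Suc n)
  have d: "((\<lambda>x. h (f x)) has_derivative
      (\<lambda>v. frechet_derivative f (at x) v *\<^sub>R dir_deriv 1 h (f x))) (at x)" if "x \<in> S" for x
  proof -
    let ?h = "frechet_derivative h (at (f x))"
    have h: "(h has_derivative ?h) (at (f x))"
      using Ck_on_SucD[OF Suc.prems(1) T fT[OF that]] .
    have "?h r = r *\<^sub>R dir_deriv 1 h (f x)" for r
      using linear_scale[OF bounded_linear.linear[OF has_derivative_bounded_linear[OF h]], of r 1]
      by (simp add: dir_deriv_def)
    then show ?thesis
      using has_derivative_compose[OF Ck_on_SucD[OF Suc.prems(2) S that] h] by simp
  qed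
  show ?case
    by (rule Ck_on_SucI[OF S d]) (assumption, intro Ck_on_bilinear[OF bounded_bilinear_scaleR S],
      use Suc.IH[of "dir_deriv 1 h"] Ck_on_SucD_dir[OF Suc.prems(2)] Ck_on_Suc_imp[OF Suc.prems(2)] Suc.prems in auto)
qed

text \<open>\<open>Ck_on\<close> only controls derivatives along basis vectors. If \<open>L\<close>
  sends these to basis vectors or to 0, a basis derivative of the composite is a basis derivative of
  \<open>f\<close> composed with \<open>L\<close>, or 0. The case of interest is
  \<open>fst\<close>.\<close>

lemma Ck_on_compose_basis:
  fixes L :: "'a::euclidean_space \<Rightarrow> 'b::euclidean_space"
  assumes L: "bounded_linear L" and B: "\<And>b. b \<in> Basis \<Longrightarrow> L b \<in> insert 0 Basis"
    and "Ck_on n UNIV f"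
  shows "Ck_on n UNIV (\<lambda>x. f (L x))"
  using assms(3)
proof (induction n arbitrary: f)
  case 0 then show ?case
    using continuous_on_compose2[of UNIV f UNIV L] linear_continuous_on[OF L] by auto
next
  case (Suc n)
  show ?case
  proof (rule Ck_on_SucI[OF open_UNIV])
    fix x
    show "((\<lambda>x. f (L x)) has_derivative (\<lambda>v. frechet_derivative f (at (L x)) (L v))) (at x)"
      using has_derivative_compose[OF bounded_linear_imp_has_derivative[OF L]
          Ck_on_SucD[OF Suc.prems open_UNIV, of "L x"]] by simp
  next
    fix b :: 'a assume b: "b \<in> Basis"
    show "Ck_on n UNIV (\<lambda>x. frechet_derivative f (at (L x)) (L b))"
    proof (cases "L b = 0")
      case True
      have "frechet_derivative f (at (L x)) 0 = 0" for x
        using has_derivative_bounded_linear[OF Ck_on_SucD[OF Suc.prems open_UNIV, of "L x"]]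
          linear_0 bounded_linear.linear by blast
      then show ?thesis using True by (simp add: Ck_on_const)
    next
      case False
      then show ?thesis using B[OF b] Ck_on_SucD_dir[OF Suc.prems] Suc.IH by auto
    qed
  qed
qed

lemma Ck_on_exp:
  fixes f :: "'a::euclidean_space \<Rightarrow> complex"
  assumes S: "open S" and "Ck_on n S f"
  shows "Ck_on n S (\<lambda>x. exp (f x))"
  using assms(2)
proof (induction n)
  case 0 then show ?case by (auto intro: continuous_intros)
next
  case (Suc n)
  have d: "((\<lambda>x. exp (f x)) has_derivative (\<lambda>v. exp (f x) * frechet_derivative f (at x) v)) (at x)"
    if "x \<in> S" for x
    using has_derivative_compose[OF Ck_on_SucD[OF Suc.prems S that], of exp "\<lambda>v. exp (f x) * v"]
      DERIV_exp[of "f x"] by (simp add: has_field_derivative_def)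
  show ?case
    by (rule Ck_on_SucI[OF S d]) (use Suc Ck_on_SucD_dir[OF Suc.prems] Ck_on_Suc_imp[OF Suc.prems] in
      \<open>auto intro!: Ck_on_bilinear[OF bounded_bilinear_mult S]\<close>)
qed

text \<open>Differentiation lowers the exponent by one, which is why the induction is over all
  \<open>a\<close>.\<close>

lemma Ck_on_powr:
  fixes f :: "'a::euclidean_space \<Rightarrow> real"
  assumes S: "open S" and pos: "\<And>x. x \<in> S \<Longrightarrow> f x > 0" and "Ck_on n S f"
  shows "Ck_on n S (\<lambda>x. f x powr a)"
  using assms(3)
proof (induction n arbitrary: a)
  case 0 then show ?case using pos by (auto intro!: continuous_intros) (metis less_irrefl)
next
  case (Suc n)
  have d: "((\<lambda>x. f x powr a) has_derivative (\<lambda>v. (a * f x powr (a - 1)) * frechet_derivative f (at x) v)) (at x)"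
    if "x \<in> S" for x
    using has_derivative_compose[OF Ck_on_SucD[OF Suc.prems S that], of "\<lambda>t. t powr a" "\<lambda>v. a * f x powr (a - 1) * v"]
      has_real_derivative_powr[OF pos[OF that], of a] by (simp add: has_field_derivative_def)
  show ?case
    by (rule Ck_on_SucI[OF S d]) (use Suc Ck_on_SucD_dir[OF Suc.prems] Ck_on_Suc_imp[OF Suc.prems] in
      \<open>auto intro!: Ck_on_bilinear[OF bounded_bilinear_mult S] Ck_on_const\<close>)
qed

lemma smooth_on_cong':
  "open S \<Longrightarrow> (\<And>y. y \<in> S \<Longrightarrow> f y = g y) \<Longrightarrow> smooth_on S f \<Longrightarrow> smooth_on S g"
  unfolding smooth_on_def using Ck_on_cong by blast

lemma smooth_on_subset: "smooth_on S f \<Longrightarrow> T \<subseteq> S \<Longrightarrow> smooth_on T f"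
  unfolding smooth_on_def using Ck_on_subset by blast

lemma smooth_on_Un: "open S \<Longrightarrow> open T \<Longrightarrow> smooth_on S f \<Longrightarrow> smooth_on T f \<Longrightarrow> smooth_on (S \<union> T) f"
  unfolding smooth_on_def using Ck_on_Un by blast

lemma smooth_on_const: "smooth_on S (\<lambda>x. c)"
  unfolding smooth_on_def using Ck_on_const by blast

lemma smooth_on_bounded_linear: "bounded_linear L \<Longrightarrow> open S \<Longrightarrow> smooth_on S L"
  unfolding smooth_on_def using Ck_on_bounded_linear by blast

lemma smooth_on_add: "open S \<Longrightarrow> smooth_on S f \<Longrightarrow> smooth_on S g \<Longrightarrow> smooth_on S (\<lambda>x. f x + g x)"
  unfolding smooth_on_def using Ck_on_add by blast

lemma smooth_on_bilinear:
  "bounded_bilinear op2 \<Longrightarrow> open S \<Longrightarrow> smooth_on S f \<Longrightarrow> smooth_on S g \<Longrightarrow> smooth_on S (\<lambda>x. op2 (f x) (g x))"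
  unfolding smooth_on_def using Ck_on_bilinear by blast

lemmas smooth_on_mult = smooth_on_bilinear[OF bounded_bilinear_mult]

lemma smooth_on_linear_comp:
  "bounded_linear L \<Longrightarrow> open S \<Longrightarrow> smooth_on S f \<Longrightarrow> smooth_on S (\<lambda>x. L (f x))"
  unfolding smooth_on_def using Ck_on_linear_comp by blast

lemmas smooth_on_of_real = smooth_on_linear_comp[OF bounded_linear_of_real]

lemma smooth_on_uminus: "open S \<Longrightarrow> smooth_on S f \<Longrightarrow> smooth_on S (\<lambda>x. - f x)"
  using smooth_on_linear_comp[OF bounded_linear_minus[OF bounded_linear_ident]] .

lemma smooth_on_diff: "open S \<Longrightarrow> smooth_on S f \<Longrightarrow> smooth_on S g \<Longrightarrow> smooth_on S (\<lambda>x. f x - g x)"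
  using smooth_on_add[of S f "\<lambda>x. - g x"] smooth_on_uminus by auto

lemma smooth_on_compose_real:
  fixes h :: "real \<Rightarrow> 'c::real_normed_vector"
  shows "open S \<Longrightarrow> open T \<Longrightarrow> (\<And>x. x \<in> S \<Longrightarrow> f x \<in> T) \<Longrightarrow> smooth_on T h \<Longrightarrow> smooth_on S f \<Longrightarrow>
    smooth_on S (\<lambda>x. h (f x))"
  unfolding smooth_on_def using Ck_on_compose_real by blast

lemma smooth_on_compose_basis:
  "bounded_linear L \<Longrightarrow> (\<And>b. b \<in> Basis \<Longrightarrow> L b \<in> insert 0 Basis) \<Longrightarrow> smooth_on UNIV f \<Longrightarrow>
    smooth_on UNIV (\<lambda>x. f (L x))"
  unfolding smooth_on_def using Ck_on_compose_basis by blast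

lemma smooth_on_exp:
  fixes f :: "'a::euclidean_space \<Rightarrow> complex"
  shows "open S \<Longrightarrow> smooth_on S f \<Longrightarrow> smooth_on S (\<lambda>x. exp (f x))"
  unfolding smooth_on_def using Ck_on_exp by blast

lemma smooth_on_powr:
  fixes f :: "'a::euclidean_space \<Rightarrow> real"
  shows "open S \<Longrightarrow> (\<And>x. x \<in> S \<Longrightarrow> f x > 0) \<Longrightarrow> smooth_on S f \<Longrightarrow> smooth_on S (\<lambda>x. f x powr a)"
  unfolding smooth_on_def using Ck_on_powr by blast

lemma smooth_on_prod:
  fixes f :: "'i \<Rightarrow> 'a::euclidean_space \<Rightarrow> 'b::{real_normed_algebra,comm_monoid_mult}"
  shows "open S \<Longrightarrow> (\<And>i. i \<in> I \<Longrightarrow> smooth_on S (f i)) \<Longrightarrow> smooth_on S (\<lambda>x. \<Prod>i\<in>I. f i x)"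
  by (induction I rule: infinite_finite_induct) (auto intro!: smooth_on_const smooth_on_mult)

lemma smooth_on_dir_deriv: "smooth_on S f \<Longrightarrow> b \<in> Basis \<Longrightarrow> smooth_on S (dir_deriv b f)"
  unfolding smooth_on_def using Ck_on.simps(2) by blast

lemma smooth_on_partials: "smooth_on S f \<Longrightarrow> set bs \<subseteq> Basis \<Longrightarrow> smooth_on S (partials bs f)"
  by (induction bs) (auto simp: partials_def smooth_on_dir_deriv)

lemma smooth_on_continuous: "smooth_on S f \<Longrightarrow> continuous_on S f"
  unfolding smooth_on_def using Ck_on.simps(1) by blast

lemma smooth_on_has_derivative:
  "smooth_on S f \<Longrightarrow> open S \<Longrightarrow> x \<in> S \<Longrightarrow> (f has_derivative (\<lambda>v. dir_deriv v f x)) (at x)"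
  unfolding smooth_on_def dir_deriv_def using Ck_on_SucD by blast

lemma smooth_on_dist_powr:
  fixes x :: "'a::euclidean_space"
  shows "smooth_on (- {x}) (\<lambda>y. norm (x - y) powr a)"
proof -
  have l: "smooth_on (-{x}) (\<lambda>y. x - y)"
    by (intro smooth_on_diff smooth_on_const smooth_on_bounded_linear bounded_linear_ident) auto
  have "smooth_on (-{x}) (\<lambda>y. ((x - y) \<bullet> (x - y)) powr (a/2))"
    by (rule smooth_on_powr[OF _ _ smooth_on_bilinear[OF bounded_bilinear_inner _ l l]]) auto
  then show ?thesis
  proof (rule smooth_on_cong'[rotated 2])
    fix y assume "y \<in> - {x}"
    then have "(norm (x - y))\<^sup>2 = norm (x - y) powr 2" by simp
    then show "((x - y) \<bullet> (x - y)) powr (a/2) = norm (x - y) powr a"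
      by (simp only: dot_square_norm powr_powr) simp
  qed auto
qed

lemma smooth_on_dist:
  fixes x :: "'a::euclidean_space"
  shows "smooth_on (- {x}) (\<lambda>y. norm (x - y))"
  by (rule smooth_on_cong'[OF _ _ smooth_on_dist_powr[of x 1]]) auto

section \<open>Test functions and their stability properties\<close>

lemma test_functionI:
  assumes "smooth_on UNIV \<phi>" "compact K" "K \<subseteq> V" "\<And>x. x \<notin> K \<Longrightarrow> \<phi> x = 0"
  shows "test_function V \<phi>"
proof -
  have "closure {x. \<phi> x \<noteq> 0} \<subseteq> K"
    by (rule closure_minimal) (use assms compact_imp_closed in auto)
  then show ?thesis unfolding test_function_def
    using assms closed_Int_compact[of "closure {x. \<phi> x \<noteq> 0}" K] by (auto simp: Int_absorb2)
qed

lemma test_function_smooth: "test_function V \<phi> \<Longrightarrow> smooth_on UNIV \<phi>"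
  by (simp add: test_function_def)

lemma test_functionE:
  assumes "test_function V \<phi>"
  obtains K where "compact K" "K \<subseteq> V" "\<And>x. x \<notin> K \<Longrightarrow> \<phi> x = 0"
proof (rule that[of "closure {x. \<phi> x \<noteq> 0}"])
  show "\<phi> x = 0" if "x \<notin> closure {x. \<phi> x \<noteq> 0}" for x
    using that closure_subset[of "{x. \<phi> x \<noteq> 0}"] by auto
qed (use assms in \<open>auto simp: test_function_def\<close>)

lemma test_function_mono: "test_function V \<phi> \<Longrightarrow> V \<subseteq> W \<Longrightarrow> test_function W \<phi>"
  unfolding test_function_def by auto

text \<open>The factor \<open>m\<close> may be singular outside \<open>S\<close>. The product is
  smooth on \<open>S\<close> and identically 0 off the compact support of \<open>\<zeta>\<close>,
  and these two open sets cover the space.\<close>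

lemma test_function_mult_smooth_on:
  fixes m \<zeta> :: "'a::euclidean_space \<Rightarrow> 'b::real_normed_algebra"
  assumes "open S" "smooth_on S m" "test_function S \<zeta>"
  shows "test_function S (\<lambda>y. m y * \<zeta> y)"
proof -
  obtain K where K: "compact K" "K \<subseteq> S" "\<And>x. x \<notin> K \<Longrightarrow> \<zeta> x = 0" using assms(3) by (rule test_functionE) blast
  have "open (-K)" using K compact_imp_closed by blast
  moreover have "smooth_on (-K) (\<lambda>y. m y * \<zeta> y)"
    by (rule smooth_on_cong'[OF \<open>open (-K)\<close> _ smooth_on_const[of _ 0]]) (use K in auto)
  moreover have "smooth_on S (\<lambda>y. m y * \<zeta> y)"
    using assms smooth_on_mult smooth_on_subset test_function_smooth by (metis subset_UNIV)
  ultimately have "smooth_on (S \<union> -K) (\<lambda>y. m y * \<zeta> y)" using smooth_on_Un assms by blast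
  moreover have "S \<union> -K = UNIV" using K by auto
  ultimately show ?thesis using K by (intro test_functionI[where K=K]) auto
qed

lemma test_function_mult:
  fixes m \<zeta> :: "'a::euclidean_space \<Rightarrow> 'b::real_normed_algebra"
  assumes "smooth_on UNIV m" "test_function S \<zeta>"
  shows "test_function S (\<lambda>y. m y * \<zeta> y)"
proof -
  obtain K where K: "compact K" "K \<subseteq> S" "\<And>x. x \<notin> K \<Longrightarrow> \<zeta> x = 0" using assms(2) by (rule test_functionE) blast
  then show ?thesis using assms test_function_smooth
    by (intro test_functionI[where K=K] smooth_on_mult) auto
qed

lemma test_function_add:
  assumes "test_function V f" "test_function V g" shows "test_function V (\<lambda>x. f x + g x)"
proof -
  obtain K where K: "compact K" "K \<subseteq> V" "\<And>x. x \<notin> K \<Longrightarrow> f x = 0" using assms(1) by (rule test_functionE) blast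
  obtain L where L: "compact L" "L \<subseteq> V" "\<And>x. x \<notin> L \<Longrightarrow> g x = 0" using assms(2) by (rule test_functionE) blast
  show ?thesis using K L assms[THEN test_function_smooth]
    by (intro test_functionI[where K="K \<union> L"] smooth_on_add) auto
qed

lemma test_function_zero: "test_function V (\<lambda>x. 0)"
  by (rule test_functionI[where K="{}"]) (auto simp: smooth_on_const)

lemma test_function_sum:
  "(\<And>i. i \<in> I \<Longrightarrow> test_function V (f i)) \<Longrightarrow> test_function V (\<lambda>x. \<Sum>i\<in>I. f i x)"
  by (induction I rule: infinite_finite_induct) (auto intro!: test_function_zero test_function_add)

lemma test_function_linear:
  assumes "bounded_linear L" "test_function V f" shows "test_function V (\<lambda>x. L (f x))"
proof -
  obtain K where K: "compact K" "K \<subseteq> V" "\<And>x. x \<notin> K \<Longrightarrow> f x = 0" using assms(2) by (rule test_functionE) blast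
  show ?thesis using K linear_0[OF bounded_linear.linear[OF assms(1)]]
    by (intro test_functionI[OF smooth_on_linear_comp[OF assms(1) open_UNIV test_function_smooth[OF assms(2)]], where K=K]) auto
qed

lemma dir_deriv_zero_outside:
  assumes "compact K" "\<And>x. x \<notin> K \<Longrightarrow> f x = 0" "x \<notin> K" shows "dir_deriv b f x = 0"
proof -
  have "dir_deriv b f x = dir_deriv b (\<lambda>x. 0) x"
    by (rule dir_deriv_cong_open[of "-K"]) (use assms compact_imp_closed in auto)
  then show ?thesis by (simp add: dir_deriv_def)
qed

lemma test_function_dir_deriv:
  assumes "test_function V f" "b \<in> Basis" shows "test_function V (dir_deriv b f)"
proof -
  obtain K where K: "compact K" "K \<subseteq> V" "\<And>x. x \<notin> K \<Longrightarrow> f x = 0" using assms(1) by (rule test_functionE) blast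
  show ?thesis using K assms test_function_smooth[OF assms(1)] dir_deriv_zero_outside[OF K(1,3)]
    by (intro test_functionI[where K=K] smooth_on_dir_deriv) auto
qed

lemma test_function_partials:
  "test_function V f \<Longrightarrow> set bs \<subseteq> Basis \<Longrightarrow> test_function V (partials bs f)"
  by (induction bs) (auto simp: partials_def test_function_dir_deriv)

lemma test_function_continuous: "test_function V f \<Longrightarrow> continuous_on UNIV f"
  by (simp add: smooth_on_continuous test_function_smooth)

lemma test_function_schwartz:
  assumes "test_function V f" shows "schwartz f"
  unfolding schwartz_def
proof (intro conjI allI impI)
  show "smooth_on UNIV f" using assms test_function_smooth by blast
  fix N bs assume bs: "set (bs::'a list) \<subseteq> Basis"
  have t: "test_function V (partials bs f)" using assms bs test_function_partials by blast
  obtain K where K: "compact K" "K \<subseteq> V" "\<And>x. x \<notin> K \<Longrightarrow> partials bs f x = 0"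
    using t by (rule test_functionE) blast
  have "continuous_on K (\<lambda>x. (1 + norm x) ^ N *\<^sub>R partials bs f x)"
    using test_function_continuous[OF t] by (intro continuous_intros) (auto intro: continuous_on_subset)
  then have "bounded ((\<lambda>x. (1 + norm x) ^ N *\<^sub>R partials bs f x) ` K)"
    using K compact_continuous_image compact_imp_bounded by blast
  moreover have "range (\<lambda>x. (1 + norm x) ^ N *\<^sub>R partials bs f x) \<subseteq>
      insert 0 ((\<lambda>x. (1 + norm x) ^ N *\<^sub>R partials bs f x) ` K)"
  proof (clarify, goal_cases)
    case (1 _ x) then show ?case by (cases "x \<in> K") (use K(3) in auto)
  qed
  ultimately show "bounded (range (\<lambda>x. (1 + norm x) ^ N *\<^sub>R partials bs f x))"
    using bounded_subset bounded_insert by blast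
qed

section \<open>Cutoff functions\<close>

text \<open>The classical flat function exp(-1/t), extended by 0. The extra powers of 1/t make the
  family closed under differentiation, so that smoothness follows by one induction.\<close>

definition flat :: "nat \<Rightarrow> real \<Rightarrow> real" where
  "flat n t = (if t \<le> 0 then 0 else exp (- (1 / t)) / t ^ n)"

text \<open>Keep only the term of index \<open>n + 2\<close> in the exponential series at 1/t. A
  quadratic bound is what makes the difference quotient at 0 tend to 0.\<close>

lemma flat_bound: "\<bar>flat n t\<bar> \<le> fact (n + 2) * t\<^sup>2"
proof (cases "t \<le> 0")
  case False
  have "(\<Sum>k\<in>{n+2}. inverse (fact k) * (1/t) ^ k) \<le> (\<Sum>k. inverse (fact k) * (1/t) ^ k)"
    by (rule sum_le_suminf[OF summable_exp]) (use False in auto)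
  then have "(1/t) ^ (n+2) / fact (n+2) \<le> exp (1/t)"
    by (simp add: exp_def divide_inverse mult.commute)
  then have "exp (- (1/t)) * (1/t) ^ (n+2) \<le> fact (n+2)"
    unfolding pos_divide_le_eq[OF fact_gt_zero] exp_minus inverse_eq_divide[of "exp _"] times_divide_eq_left
    by (simp only: pos_divide_le_eq[OF exp_gt_zero] mult_1 mult.commute)
  then have "exp (- (1/t)) * (1/t) ^ (n+2) * t\<^sup>2 \<le> fact (n+2) * t\<^sup>2" by (rule mult_right_mono) auto
  moreover have "exp (- (1/t)) * (1/t) ^ (n+2) * t\<^sup>2 = flat n t"
    using False by (simp add: flat_def power_add power_divide power2_eq_square)
  moreover have "flat n t \<ge> 0" using False by (simp add: flat_def)
  ultimately show ?thesis by simp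
qed (simp add: flat_def)

lemma flat_has_derivative: "(flat n has_real_derivative flat (n+2) t - n * flat (n+1) t) (at t)"
proof -
  consider "t < 0" | "t = 0" | "t > 0" by linarith
  then show ?thesis
  proof cases
    case 1
    have "((\<lambda>t. 0) has_real_derivative 0) (at t)" by simp
    then have "(flat n has_real_derivative 0) (at t)"
      by (rule has_field_derivative_transform_within_open[of _ _ _ "{..<0}"]) (use 1 in \<open>auto simp: flat_def\<close>)
    then show ?thesis using 1 by (simp add: flat_def)
  next
    case 2
    have "(\<lambda>h. fact (n + 2) * \<bar>h\<bar>) \<midarrow>0\<rightarrow> fact (n + 2) * \<bar>0::real\<bar>" by (intro tendsto_intros)
    then have "(\<lambda>h. fact (n + 2) * \<bar>h\<bar>) \<midarrow>0\<rightarrow> (0::real)" by simp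
    then have "(\<lambda>h. flat n h / h) \<midarrow>0\<rightarrow> 0"
    proof (rule Lim_null_comparison[rotated])
      have "norm (flat n h / h) \<le> fact (n + 2) * \<bar>h\<bar>" if "h \<noteq> 0" for h
        using flat_bound[of n h] that by (simp add: abs_divide field_simps power2_eq_square del: fact_Suc)
      then show "\<forall>\<^sub>F h in at 0. norm (flat n h / h) \<le> fact (n + 2) * \<bar>h\<bar>"
        by (auto simp: eventually_at intro: exI[of _ 1])
    qed
    then show ?thesis using 2 by (simp add: DERIV_def) (simp add: flat_def)
  next
    case 3
    have "((\<lambda>t. exp (- (1 / t)) / t ^ n) has_real_derivative
       exp (- (1/t)) / t ^ (n+2) - n * (exp (- (1/t)) / t ^ (n+1))) (at t)"
      using 3 by (auto intro!: derivative_eq_intros simp: field_simps power2_eq_square)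
       (cases n; simp add: field_simps)
    then have "(flat n has_real_derivative exp (- (1/t)) / t ^ (n+2) - n * (exp (- (1/t)) / t ^ (n+1))) (at t)"
      by (rule has_field_derivative_transform_within_open[of _ _ _ "{0<..}"]) (use 3 in \<open>auto simp: flat_def\<close>)
    then show ?thesis using 3 by (simp add: flat_def)
  qed
qed

lemma smooth_on_flat: "smooth_on UNIV (flat n)"
  unfolding smooth_on_def
proof
  fix k show "Ck_on k UNIV (flat n)"
  proof (induction k arbitrary: n)
    case 0 show ?case using flat_has_derivative by (auto intro!: DERIV_continuous_on)
  next
    case (Suc k)
    show ?case
    proof (rule Ck_on_SucI[OF open_UNIV])
      fix t show "(flat n has_derivative (\<lambda>v. (flat (n+2) t + (- n) * flat (n+1) t) * v)) (at t)"
        using flat_has_derivative[of n t] by (simp add: has_field_derivative_def)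
    next
      fix b :: real
      note mult = Ck_on_bilinear[OF bounded_bilinear_mult open_UNIV]
      show "Ck_on k UNIV (\<lambda>t. (flat (n+2) t + (- n) * flat (n+1) t) * b)"
        by (rule mult[OF Ck_on_add[OF open_UNIV Suc.IH mult[OF Ck_on_const Suc.IH]] Ck_on_const])
    qed
  qed
qed

text \<open>A smooth descent from 1 to 0 between 1 and 2. The base of the power is positive
  everywhere because \<open>2 - t\<close> and \<open>t - 1\<close> are never both nonpositive; the
  reciprocal is a \<open>powr\<close> so that \<open>smooth_on_powr\<close> applies.\<close>

definition smooth_step :: "real \<Rightarrow> real" where
  "smooth_step t = flat 0 (2 - t) * (flat 0 (2 - t) + flat 0 (t - 1)) powr (-1)"

lemma smooth_on_smooth_step: "smooth_on UNIV smooth_step"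
proof -
  have 1: "smooth_on UNIV (\<lambda>t. flat 0 (2 - t))"
    by (rule smooth_on_compose_real[OF _ _ _ smooth_on_flat
          smooth_on_diff[OF _ smooth_on_const smooth_on_bounded_linear[OF bounded_linear_ident]]]) auto
  have 2: "smooth_on UNIV (\<lambda>t. flat 0 (t - 1))"
    by (rule smooth_on_compose_real[OF _ _ _ smooth_on_flat
          smooth_on_diff[OF _ smooth_on_bounded_linear[OF bounded_linear_ident] smooth_on_const]]) auto
  show ?thesis unfolding smooth_step_def[abs_def]
    by (intro smooth_on_mult smooth_on_powr smooth_on_add 1 2) (auto simp: flat_def intro: add_pos_pos)
qed

lemma smooth_step_eq: "t \<le> 1 \<Longrightarrow> smooth_step t = 1" "t \<ge> 2 \<Longrightarrow> smooth_step t = 0"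
  by (auto simp: smooth_step_def flat_def powr_minus exp_minus field_simps)

lemma bump_exists:
  fixes z :: "'a::euclidean_space"
  assumes "r > 0"
  obtains \<beta> :: "'a \<Rightarrow> real" where "smooth_on UNIV \<beta>" "\<And>y. y \<in> ball z r \<Longrightarrow> \<beta> y = 1"
    "\<And>y. y \<notin> cball z (2 * r) \<Longrightarrow> \<beta> y = 0"
proof
  \<comment> \<open>The squared distance is smooth at the centre too. It stays below 1 in the small
    ball and is at least 4 outside the large one, so \<open>smooth_step\<close> is constant on
    both.\<close>
  let ?q = "\<lambda>y. ((y - z) \<bullet> (y - z)) * (1 / r\<^sup>2)"
  have l: "smooth_on UNIV (\<lambda>y. y - z)"
    by (rule smooth_on_diff[OF _ smooth_on_bounded_linear[OF bounded_linear_ident] smooth_on_const]) auto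
  have "smooth_on UNIV ?q"
    by (rule smooth_on_mult[OF _ smooth_on_bilinear[OF bounded_bilinear_inner _ l l] smooth_on_const]) auto
  then show "smooth_on UNIV (\<lambda>y. smooth_step (?q y))"
    by (rule smooth_on_compose_real[OF _ _ _ smooth_on_smooth_step, rotated 3]) auto
  have q: "?q y = (dist z y / r)\<^sup>2" for y
    by (simp add: dot_square_norm dist_norm norm_minus_commute power_divide)
  show "smooth_step (?q y) = 1" if "y \<in> ball z r" for y
    using that assms unfolding q by (intro smooth_step_eq) (simp add: power_le_one)
  show "smooth_step (?q y) = 0" if "y \<notin> cball z (2 * r)" for y
  proof -
    have "2 \<le> dist z y / r" using that assms by (simp add: field_simps)
    then have "2\<^sup>2 \<le> (dist z y / r)\<^sup>2" by (rule power_mono) auto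
    then show ?thesis unfolding q by (intro smooth_step_eq) simp
  qed
qed

lemma cball_in_open:
  fixes z :: "'a::euclidean_space"
  assumes "open V" "z \<in> V" obtains r where "r > 0" "cball z (2 * r) \<subseteq> V"
proof -
  obtain e where "e > 0" "cball z e \<subseteq> V" using assms open_contains_cball by blast
  then show ?thesis using that[of "e/2"] by simp
qed

lemma cutoff_exists:
  fixes K V :: "'a::euclidean_space set"
  assumes "compact K" "open V" "K \<subseteq> V"
  obtains \<eta> :: "'a \<Rightarrow> real" and W where "test_function V \<eta>" "open W" "K \<subseteq> W" "\<And>y. y \<in> W \<Longrightarrow> \<eta> y = 1"
proof -
  define Q where "Q z r \<beta> \<longleftrightarrow> r > 0 \<and> cball z (2 * r) \<subseteq> V \<and> smooth_on UNIV \<beta> \<and>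
    (\<forall>y\<in>ball z r. \<beta> y = (1::real)) \<and> (\<forall>y. y \<notin> cball z (2 * r) \<longrightarrow> \<beta> y = 0)" for z r \<beta>
  have "\<exists>r \<beta>. Q z r \<beta>" if z: "z \<in> K" for z
  proof -
    obtain r where r: "r > 0" "cball z (2 * r) \<subseteq> V"
      using cball_in_open[OF assms(2) subsetD[OF assms(3) z]] by blast
    obtain \<beta> where "smooth_on UNIV \<beta>" "\<And>y. y \<in> ball z r \<Longrightarrow> \<beta> y = (1::real)"
      "\<And>y. y \<notin> cball z (2 * r) \<Longrightarrow> \<beta> y = 0" using bump_exists[OF r(1), of z] by metis
    then show ?thesis using r unfolding Q_def by blast
  qed
  then obtain r \<beta> where Q: "\<And>z. z \<in> K \<Longrightarrow> Q z (r z) (\<beta> z)" by metis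
  have r: "\<And>z. z \<in> K \<Longrightarrow> r z > 0" "\<And>z. z \<in> K \<Longrightarrow> cball z (2 * r z) \<subseteq> V"
    and b: "\<And>z. z \<in> K \<Longrightarrow> smooth_on UNIV (\<beta> z)" "\<And>z y. z \<in> K \<Longrightarrow> y \<in> ball z (r z) \<Longrightarrow> \<beta> z y = (1::real)"
      "\<And>z y. z \<in> K \<Longrightarrow> y \<notin> cball z (2 * r z) \<Longrightarrow> \<beta> z y = 0"
    using Q unfolding Q_def by blast+
  have cov: "K \<subseteq> (\<Union>z\<in>K. ball z (r z))" using r(1) by force
  obtain F where F: "F \<subseteq> K" "finite F" "K \<subseteq> (\<Union>z\<in>F. ball z (r z))"
    using compactE_image[OF assms(1), of K "\<lambda>z. ball z (r z)"] cov by (metis open_ball)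
  \<comment> \<open>One bump equal to 1 already annihilates the product, and far from all bumps the
    product is 1; no normalisation of a sum is required.\<close>
  let ?\<eta> = "\<lambda>y. 1 - (\<Prod>z\<in>F. 1 - \<beta> z y)"
  show ?thesis
  proof
    show "test_function V ?\<eta>"
    proof (rule test_functionI[where K="\<Union>z\<in>F. cball z (2 * r z)"])
      show "smooth_on UNIV ?\<eta>"
        using b(1) F(1) by (intro smooth_on_diff smooth_on_const smooth_on_prod) auto
      show "?\<eta> y = 0" if "y \<notin> (\<Union>z\<in>F. cball z (2 * r z))" for y
        using that b(3) F(1) by (subst prod.neutral) auto
      show "(\<Union>z\<in>F. cball z (2 * r z)) \<subseteq> V" using F(1) r(2) by blast
    qed (use F in auto)
    show "?\<eta> y = 1" if "y \<in> (\<Union>z\<in>F. ball z (r z))" for y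
    proof -
      obtain z where "z \<in> F" "y \<in> ball z (r z)" using \<open>y \<in> _\<close> by blast
      then show ?thesis using b(2) F prod_zero[OF F(2), of "\<lambda>z. 1 - \<beta> z y"] by force
    qed
  qed (use F in auto)
qed

section \<open>Locality of distributions\<close>

lemma tempered_add_scale:
  "tempered T \<Longrightarrow> schwartz \<phi> \<Longrightarrow> schwartz \<psi> \<Longrightarrow> T (\<lambda>x. a * \<phi> x + b * \<psi> x) = a * T \<phi> + b * T \<psi>"
  unfolding tempered_def by blast

lemma tempered_zero: "tempered T \<Longrightarrow> T (\<lambda>x. 0) = 0"
  using tempered_add_scale[of T "\<lambda>x. 0" "\<lambda>x. 0" 0 0] test_function_schwartz[OF test_function_zero] by simp

lemma tempered_diff:
  assumes "tempered T" "test_function UNIV \<phi>" "test_function UNIV \<psi>"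
  shows "T (\<lambda>x. \<phi> x - \<psi> x) = T \<phi> - T \<psi>"
  using tempered_add_scale[OF assms(1) assms(2,3)[THEN test_function_schwartz], of 1 "-1"] by simp

text \<open>
  Multiplying \<open>\<phi>\<close> by \<open>1 - \<beta>\<close>, where \<open>\<beta>\<close> is a bump supported where \<open>T\<close> vanishes, does not change \<open>T \<phi>\<close>;
  finitely many such factors annihilate \<open>\<phi>\<close>. This avoids partitions of unity.
\<close>

lemma tempered_vanishes_off_support:
  assumes T: "tempered T" and \<phi>: "test_function (- dist_support T) \<phi>"
  shows "T \<phi> = 0"
proof -
  obtain K where K: "compact K" "K \<subseteq> - dist_support T" "\<And>x. x \<notin> K \<Longrightarrow> \<phi> x = 0"
    using \<phi> by (rule test_functionE) blast
  have \<phi>1: "smooth_on UNIV \<phi>" using \<phi> test_function_smooth by blast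
  \<comment> \<open>The vanishing is recorded for every smooth \<open>\<psi>\<close> supported in
    \<open>K\<close>, since in the induction each bump multiplies a partial product and not
    \<open>\<phi>\<close> itself.\<close>
  define Q where "Q z r \<beta> \<longleftrightarrow> r > 0 \<and> smooth_on UNIV \<beta> \<and> (\<forall>y\<in>ball z r. \<beta> y = (1::real)) \<and>
    (\<forall>\<psi>. smooth_on UNIV \<psi> \<longrightarrow> (\<forall>x. x \<notin> K \<longrightarrow> \<psi> x = 0) \<longrightarrow> T (\<lambda>y. of_real (\<beta> y) * \<psi> y) = 0)" for z r \<beta>
  have "\<exists>r \<beta>. Q z r \<beta>" if z: "z \<in> K" for z
  proof -
    obtain V where V: "open V" "z \<in> V" "\<And>\<phi>. test_function V \<phi> \<Longrightarrow> T \<phi> = 0"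
      using K(2) z unfolding dist_support_def by auto
    obtain r where r: "r > 0" "cball z (2 * r) \<subseteq> V" using cball_in_open V(1,2) by metis
    obtain \<beta> where \<beta>: "smooth_on UNIV \<beta>" "\<And>y. y \<in> ball z r \<Longrightarrow> \<beta> y = (1::real)"
      "\<And>y. y \<notin> cball z (2 * r) \<Longrightarrow> \<beta> y = 0" using bump_exists[OF r(1)] by metis
    have "T (\<lambda>y. of_real (\<beta> y) * \<psi> y) = 0" if "smooth_on UNIV \<psi>" for \<psi>
    proof (rule V(3), rule test_functionI[where K="cball z (2*r)"])
      show "smooth_on UNIV (\<lambda>y. complex_of_real (\<beta> y) * \<psi> y)"
        by (intro smooth_on_mult smooth_on_of_real \<beta> that open_UNIV)
    qed (use r \<beta> in auto)
    then show ?thesis using r \<beta> unfolding Q_def by blast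
  qed
  then obtain r \<beta> where Q: "\<And>z. z \<in> K \<Longrightarrow> Q z (r z) (\<beta> z)" by metis
  have r: "\<And>z. z \<in> K \<Longrightarrow> r z > 0"
    and b: "\<And>z. z \<in> K \<Longrightarrow> smooth_on UNIV (\<beta> z)" "\<And>z y. z \<in> K \<Longrightarrow> y \<in> ball z (r z) \<Longrightarrow> \<beta> z y = (1::real)"
      "\<And>z \<psi>. z \<in> K \<Longrightarrow> smooth_on UNIV \<psi> \<Longrightarrow> (\<forall>x. x \<notin> K \<longrightarrow> \<psi> x = 0) \<Longrightarrow> T (\<lambda>y. of_real (\<beta> z y) * \<psi> y) = 0"
    using Q unfolding Q_def by blast+
  have cov: "K \<subseteq> (\<Union>z\<in>K. ball z (r z))" using r(1) by force
  obtain F where F: "F \<subseteq> K" "finite F" "K \<subseteq> (\<Union>z\<in>F. ball z (r z))"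
    using compactE_image[OF K(1), of K "\<lambda>z. ball z (r z)"] cov by (metis open_ball)
  define P where "P G y = (\<Prod>z\<in>G. complex_of_real (1 - \<beta> z y)) * \<phi> y" for G y
  have P: "smooth_on UNIV (P G)" "\<And>x. x \<notin> K \<Longrightarrow> P G x = 0" if "G \<subseteq> K" for G
  proof -
    show "smooth_on UNIV (P G)" unfolding P_def[abs_def]
      using that b(1) \<phi>1 by (intro smooth_on_mult smooth_on_prod smooth_on_of_real smooth_on_diff smooth_on_const) auto
  qed (simp add: P_def K)
  have "T (P F) = T \<phi>" using F(2,1)
  proof (induction F rule: finite_induct)
    case empty then show ?case by (simp add: P_def[abs_def])
  next
    case (insert z G)
    have tP: "test_function UNIV (P G)" using P[of G] insert.prems K by (intro test_functionI[where K=K]) auto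
    have tb: "test_function UNIV (\<lambda>y. of_real (\<beta> z y) * P G y)"
      using insert.prems b(1) by (intro test_function_mult tP smooth_on_of_real) auto
    have "P (insert z G) = (\<lambda>y. P G y - of_real (\<beta> z y) * P G y)"
      using insert.hyps by (auto simp: P_def algebra_simps)
    then have "T (P (insert z G)) = T (P G) - T (\<lambda>y. of_real (\<beta> z y) * P G y)"
      using tempered_diff[OF T tP tb] by simp
    then show ?case using insert b(3)[of z "P G"] P[of G] by simp
  qed
  moreover have "P F y = 0" for y
  proof (cases "y \<in> K")
    case True
    then obtain z where "z \<in> F" "y \<in> ball z (r z)" using F(3) by blast
    then have "(\<Prod>z\<in>F. complex_of_real (1 - \<beta> z y)) = 0"
      using F b(2)[of z y] by (intro prod_zero) force+
    then show ?thesis by (simp add: P_def)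
  qed (simp add: P_def K)
  then have "P F = (\<lambda>y. 0)" by auto
  ultimately show ?thesis using tempered_zero[OF T] by simp
qed

text \<open>Two admissible cutoffs agree on an open neighbourhood of the support of
  \<open>T\<close>, so the difference of the two products has its closed support off
  \<open>dist_support T\<close> and \<open>T\<close> annihilates it. Hence the definite description
  in \<open>dist_pairing\<close> denotes, and any cutoff computes it.\<close>

lemma dist_pairing_eq:
  assumes T: "tempered T" and S: "open S" "smooth_on S g" and W: "open W" "dist_support T \<subseteq> W"
    and \<eta>: "test_function S \<eta>" "\<And>y. y \<in> W \<Longrightarrow> \<eta> y = 1"
  shows "dist_pairing T g = T (\<lambda>y. \<eta> y * g y)"
proof -
  have t: "test_function UNIV (\<lambda>y. \<eta> y * g y)"
    using test_function_mult_smooth_on[OF S \<eta>(1)] test_function_mono by (fastforce simp: mult.commute)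
  have c: "cutoff_near (dist_support T) \<eta>"
    using \<eta> W test_function_mono[OF \<eta>(1)] unfolding cutoff_near_def by blast
  have eq: "T (\<lambda>y. \<eta>' y * g y) = T (\<lambda>y. \<eta> y * g y)"
    if c': "cutoff_near (dist_support T) \<eta>'" and t': "test_function UNIV (\<lambda>y. \<eta>' y * g y)" for \<eta>'
  proof -
    obtain W' where W': "open W'" "dist_support T \<subseteq> W'" "\<And>y. y \<in> W' \<Longrightarrow> \<eta>' y = 1"
      using c' unfolding cutoff_near_def by blast
    let ?d = "\<lambda>y. \<eta>' y * g y + (-1) * (\<eta> y * g y)"
    have d: "test_function UNIV ?d"
      by (rule test_function_add[OF t' test_function_mult[OF smooth_on_const t]])
    have "closure {x. ?d x \<noteq> 0} \<subseteq> - (W \<inter> W')"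
      by (rule closure_minimal) (use W W' \<eta> in auto)
    then have "test_function (- dist_support T) ?d"
      using d W W' unfolding test_function_def by blast
    then have "T ?d = 0" by (rule tempered_vanishes_off_support[OF T])
    then show ?thesis using tempered_diff[OF T t' t] by simp
  qed
  show ?thesis unfolding dist_pairing_def
    by (rule the_equality) (use eq c t in blast)+
qed

section \<open>Gaussian regularisation and Plancherel's theorem\<close>

text \<open>\<open>lborel\<close> is by definition the image of a product of one-dimensional
  measures. This reduces Gaussians, and later the weights \<open>inverse (1 + t\<^sup>2)\<close>, to
  the line.\<close>

lemma lborel_integrable_prod:
  fixes f :: "'a::euclidean_space \<Rightarrow> real \<Rightarrow> 'b::{real_normed_field,banach,second_countable_topology}"
  assumes "\<And>b. b \<in> Basis \<Longrightarrow> integrable lborel (f b)"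
  shows "integrable lborel (\<lambda>x::'a. \<Prod>b\<in>Basis. f b (x \<bullet> b))"
    and "(LINT x|lborel. (\<Prod>b\<in>Basis. f b (x \<bullet> b))) = (\<Prod>b\<in>Basis. (LINT t|lborel. f b t))"
proof -
  interpret product_sigma_finite "\<lambda>_::'a. lborel :: real measure" by standard
  let ?T = "\<lambda>f. \<Sum>b\<in>Basis. f b *\<^sub>R b :: 'a"
  have l: "(lborel :: 'a measure) = distr (\<Pi>\<^sub>M b\<in>Basis. lborel) borel ?T"
    by (subst lborel_def) (simp add: lborel_eq_real)
  have [measurable]: "\<And>b. b \<in> Basis \<Longrightarrow> f b \<in> borel_measurable borel"
    using assms[THEN borel_measurable_integrable] by auto
  have T[measurable]: "?T \<in> measurable (\<Pi>\<^sub>M b\<in>Basis. lborel) borel" by measurable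
  have m: "(\<lambda>x::'a. \<Prod>b\<in>Basis. f b (x \<bullet> b)) \<in> borel_measurable borel" by measurable
  have eq: "(\<Prod>b\<in>Basis. f b (?T g \<bullet> b)) = (\<Prod>b\<in>Basis. f b (g b))" for g
    by (intro prod.cong) auto
  show "integrable lborel (\<lambda>x::'a. \<Prod>b\<in>Basis. f b (x \<bullet> b))"
    using product_integrable_prod[OF finite_Basis assms]
    by (subst l, subst integrable_distr_eq[OF T m]) (simp add: eq)
  show "(LINT x|lborel. (\<Prod>b\<in>Basis. f b (x \<bullet> b))) = (\<Prod>b\<in>Basis. (LINT t|lborel. f b t))"
    using product_integral_prod[OF finite_Basis assms]
    by (subst l, subst integral_distr[OF T m]) (simp add: eq)
qed

text \<open>Normalised to the value 1 at the origin rather than to mass 1: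
  \<open>gauss (\<epsilon> *\<^sub>R \<xi>)\<close> serves as a frequency cutoff that tends to 1 as
  \<open>\<epsilon>\<close> tends to 0.\<close>

definition gauss :: "'a::euclidean_space \<Rightarrow> real" where
  "gauss w = exp (- (norm w)\<^sup>2 / 2)"

lemma gauss_measurable[measurable]: "gauss \<in> borel_measurable borel"
  unfolding gauss_def[abs_def] by measurable

lemma gauss_pos: "gauss w > 0" and gauss_le_1: "gauss w \<le> 1"
  by (auto simp: gauss_def)

lemma gauss_prod: "gauss (w::'a::euclidean_space) = (\<Prod>b\<in>Basis. exp (- (w \<bullet> b)\<^sup>2 / 2))"
proof -
  have "(norm w)\<^sup>2 = (\<Sum>b\<in>Basis. (w \<bullet> b)\<^sup>2)"
    by (simp add: norm_eq_sqrt_inner sum_nonneg power2_eq_square euclidean_inner[of w w])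
  then show ?thesis by (simp add: gauss_def exp_sum[symmetric] sum_negf sum_divide_distrib)
qed

definition phase :: "'a::euclidean_space \<Rightarrow> 'a \<Rightarrow> complex" where
  "phase z \<xi> = exp (\<i> * complex_of_real (z \<bullet> \<xi>))"

lemma phase_measurable[measurable]: "case_prod phase \<in> borel_measurable (borel \<Otimes>\<^sub>M borel)"
  unfolding phase_def by measurable

lemma norm_phase[simp]: "norm (phase z \<xi>) = 1"
  by (simp add: phase_def norm_exp_i_times)

lemma phase_add: "phase (x + y) \<xi> = phase x \<xi> * phase y \<xi>"
  by (simp add: phase_def inner_add_left distrib_left exp_add)

lemma phase_minus: "phase (- x) \<xi> = cnj (phase x \<xi>)"
  by (simp add: phase_def exp_cnj)

text \<open>This is the characteristic function of the standard normal distribution, up to the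
  factor \<open>sqrt (2 * pi)\<close> of the density.\<close>

lemma gauss_1_fourier:
  fixes t :: real
  shows "integrable lborel (\<lambda>x. exp (\<i> * complex_of_real (t * x)) * complex_of_real (exp (- x\<^sup>2 / 2)))"
    and "(LINT x|lborel. exp (\<i> * complex_of_real (t * x)) * complex_of_real (exp (- x\<^sup>2 / 2))) =
      complex_of_real (sqrt (2 * pi) * exp (- t\<^sup>2 / 2))"
proof -
  have e: "exp (\<i> * complex_of_real (t * x)) * complex_of_real (exp (- x\<^sup>2 / 2)) =
     complex_of_real (sqrt (2 * pi)) * (std_normal_density x *\<^sub>R exp (\<i> * complex_of_real (t * x)))" for x
    by (simp add: std_normal_density_def scaleR_conv_of_real)
  have i: "integrable lborel (\<lambda>x. std_normal_density x *\<^sub>R exp (\<i> * complex_of_real (t * x)))"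
    by (rule Bochner_Integration.integrable_bound[OF integrable_normal_density[of 1 0]])
      (auto simp: norm_exp_i_times norm_mult)
  then show "integrable lborel (\<lambda>x. exp (\<i> * complex_of_real (t * x)) * complex_of_real (exp (- x\<^sup>2 / 2)))"
    unfolding e by (intro integrable_mult_right)
  have "(LINT x|lborel. std_normal_density x *\<^sub>R exp (\<i> * complex_of_real (t * x))) = char std_normal_distribution t"
    unfolding char_def by (subst integral_density) (auto)
  then show "(LINT x|lborel. exp (\<i> * complex_of_real (t * x)) * complex_of_real (exp (- x\<^sup>2 / 2))) =
      complex_of_real (sqrt (2 * pi) * exp (- t\<^sup>2 / 2))"
    unfolding e by (subst integral_mult_right_zero) (simp add: char_std_normal_distribution)
qed

lemma phase_gauss:
  fixes x :: "'a::euclidean_space"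
  shows "integrable lborel (\<lambda>w. phase x w * complex_of_real (gauss w))"
    and "(LINT w|lborel. phase x w * complex_of_real (gauss w)) =
      complex_of_real (sqrt (2 * pi) ^ DIM('a) * gauss x)"
proof -
  let ?f = "\<lambda>b t. exp (\<i> * complex_of_real ((x \<bullet> b) * t)) * complex_of_real (exp (- t\<^sup>2 / 2))"
  have e: "phase x w * complex_of_real (gauss w) = (\<Prod>b\<in>Basis. ?f b (w \<bullet> b))" for w
  proof -
    have "phase x w = (\<Prod>b\<in>Basis. exp (\<i> * complex_of_real ((x \<bullet> b) * (w \<bullet> b))))"
      unfolding phase_def by (subst euclidean_inner) (simp add: sum_distrib_left exp_sum[symmetric])
    then show ?thesis unfolding gauss_prod by (simp add: prod.distrib)
  qed
  show "integrable lborel (\<lambda>w. phase x w * complex_of_real (gauss w))"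
    unfolding e by (intro lborel_integrable_prod gauss_1_fourier)
  show "(LINT w|lborel. phase x w * complex_of_real (gauss w)) =
      complex_of_real (sqrt (2 * pi) ^ DIM('a) * gauss x)"
    unfolding e lborel_integrable_prod(2)[OF gauss_1_fourier(1)] gauss_1_fourier(2) gauss_prod[of x]
    by (simp add: prod.distrib)
qed

lemma gauss_integrable: "integrable lborel (gauss :: 'a::euclidean_space \<Rightarrow> real)"
  and gauss_integral: "(LINT w::'a|lborel. gauss w) = sqrt (2 * pi) ^ DIM('a)"
proof -
  have "phase 0 w * complex_of_real (gauss w) = complex_of_real (gauss (w::'a))" for w
    by (simp add: phase_def)
  note g = phase_gauss[of "0::'a", unfolded this]
  show "integrable lborel (gauss :: 'a \<Rightarrow> real)" using g(1) by (simp add: complex_of_real_integrable_eq)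
  show "(LINT w::'a|lborel. gauss w) = sqrt (2 * pi) ^ DIM('a)"
    using g(2) unfolding integral_complex_of_real of_real_eq_iff by (simp add: gauss_def[of 0])
qed

lemma lborel_integral_affine:
  fixes f :: "'a::euclidean_space \<Rightarrow> 'b::{banach,second_countable_topology}"
  assumes [measurable]: "f \<in> borel_measurable borel" and "c \<noteq> 0"
  shows "(LINT y|lborel. f y) = (\<bar>c\<bar> ^ DIM('a)) *\<^sub>R (LINT w|lborel. f (t + c *\<^sub>R w))"
  by (subst lborel_affine[OF assms(2), of t], subst integral_density)
    (auto simp: integral_distr)

lemma lborel_integrable_affine:
  fixes f :: "'a::euclidean_space \<Rightarrow> 'b::{banach,second_countable_topology}"
  assumes [measurable]: "f \<in> borel_measurable borel" and "c \<noteq> 0"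
  shows "integrable lborel f \<longleftrightarrow> integrable lborel (\<lambda>w. f (t + c *\<^sub>R w))"
proof -
  let ?a = "\<bar>c\<bar> ^ DIM('a)"
  have a: "?a \<noteq> 0" using assms(2) by simp
  have "integrable lborel f \<longleftrightarrow> integrable lborel (\<lambda>w. ?a *\<^sub>R f (t + c *\<^sub>R w))"
    by (subst lborel_affine[OF assms(2), of t], subst integrable_density) (auto simp: integrable_distr_eq)
  also have "\<dots> \<longleftrightarrow> integrable lborel (\<lambda>w. f (t + c *\<^sub>R w))"
    using integrable_scaleR_right[of "inverse ?a" lborel "\<lambda>w. ?a *\<^sub>R f (t + c *\<^sub>R w)"] a by (auto simp del: power_abs)
  finally show ?thesis .
qed

lemma phase_gauss_scaled:
  fixes x :: "'a::euclidean_space"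
  assumes "\<epsilon> > 0"
  shows "integrable lborel (\<lambda>\<xi>. gauss (\<epsilon> *\<^sub>R \<xi> :: 'a))"
    and "(LINT \<xi>|lborel. phase x \<xi> * complex_of_real (gauss (\<epsilon> *\<^sub>R \<xi>))) =
      complex_of_real (sqrt (2 * pi) ^ DIM('a) * gauss (x /\<^sub>R \<epsilon>) / \<epsilon> ^ DIM('a))"
proof -
  show "integrable lborel (\<lambda>\<xi>. gauss (\<epsilon> *\<^sub>R \<xi> :: 'a))"
    using lborel_integrable_affine[of gauss \<epsilon> "0::'a"] gauss_integrable[where 'a='a] assms by simp
  have "(LINT w|lborel. phase (x /\<^sub>R \<epsilon>) w * complex_of_real (gauss w)) =
    \<epsilon> ^ DIM('a) *\<^sub>R (LINT \<xi>|lborel. phase (x /\<^sub>R \<epsilon>) (\<epsilon> *\<^sub>R \<xi>) * complex_of_real (gauss (\<epsilon> *\<^sub>R \<xi>)))"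
    by (subst lborel_integral_affine[of _ \<epsilon> 0]) (use assms in auto)
  moreover have "phase (x /\<^sub>R \<epsilon>) (\<epsilon> *\<^sub>R \<xi>) = phase x \<xi>" for \<xi>
  proof -
    have "(x /\<^sub>R \<epsilon>) \<bullet> (\<epsilon> *\<^sub>R \<xi>) = x \<bullet> \<xi>" using assms by simp
    then show ?thesis by (simp only: phase_def)
  qed
  ultimately show "(LINT \<xi>|lborel. phase x \<xi> * complex_of_real (gauss (\<epsilon> *\<^sub>R \<xi>))) =
      complex_of_real (sqrt (2 * pi) ^ DIM('a) * gauss (x /\<^sub>R \<epsilon>) / \<epsilon> ^ DIM('a))"
    using assms unfolding phase_gauss(2) by (simp add: scaleR_conv_of_real field_simps)
qed

lemma (in pair_sigma_finite) integrable_pair_mult: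
  fixes f :: "'a \<Rightarrow> 'c::{real_normed_field,banach,second_countable_topology}"
  assumes f: "integrable M1 f" and g: "integrable M2 g"
  shows "integrable (M1 \<Otimes>\<^sub>M M2) (\<lambda>p. f (fst p) * g (snd p))"
proof -
  have [measurable]: "f \<in> borel_measurable M1" "g \<in> borel_measurable M2" using assms by auto
  show ?thesis
  proof (rule Fubini_integrable)
    show "integrable M1 (\<lambda>x. LINT y|M2. norm (f (fst (x, y)) * g (snd (x, y))))"
      using f g by (simp add: norm_mult)
    show "AE x in M1. integrable M2 (\<lambda>y. f (fst (x, y)) * g (snd (x, y)))"
      using g by simp
  qed measurable
qed

text \<open>The sign in the exponent is opposite to that of \<open>fourier\<close>.\<close>

definition cft :: "('a::euclidean_space \<Rightarrow> complex) \<Rightarrow> 'a \<Rightarrow> complex" where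
  "cft u \<xi> = (LINT z|lborel. phase z \<xi> * u z)"

lemma integrable_phase_mult:
  assumes "integrable lborel u" shows "integrable lborel (\<lambda>z. phase z \<xi> * u z)"
proof (rule Bochner_Integration.integrable_bound[OF assms])
  have [measurable]: "u \<in> borel_measurable borel" using assms by auto
  show "(\<lambda>z. phase z \<xi> * u z) \<in> borel_measurable lborel" by measurable
qed (simp add: norm_mult)

lemma cft_measurable:
  assumes [measurable]: "u \<in> borel_measurable borel" shows "cft u \<in> borel_measurable borel"
proof -
  have "(\<lambda>\<xi>. LINT z|lborel. phase z \<xi> * u z) \<in> borel_measurable borel" by measurable
  then show ?thesis unfolding cft_def[abs_def] .
qed

lemma norm_cft_le: "integrable lborel u \<Longrightarrow> norm (cft u \<xi>) \<le> (LINT z|lborel. norm (u z))"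
  unfolding cft_def
  using integral_norm_bound[of lborel "\<lambda>z. phase z \<xi> * u z"] by (simp add: norm_mult)

text \<open>
  The Gaussian factor makes the triple integral absolutely convergent; integrating out the frequency
  leaves an approximate identity.
\<close>

lemma cft_regularised:
  fixes u v :: "'a::euclidean_space \<Rightarrow> complex"
  assumes u: "integrable lborel u" and v: "integrable lborel v" and e: "\<epsilon> > 0"
  shows "(LINT \<xi>|lborel. cnj (cft u \<xi>) * cft v \<xi> * complex_of_real (gauss (\<epsilon> *\<^sub>R \<xi>))) =
    (LINT p|(lborel \<Otimes>\<^sub>M lborel). cnj (u (fst p)) * v (snd p) *
       complex_of_real (sqrt (2 * pi) ^ DIM('a) * gauss ((snd p - fst p) /\<^sub>R \<epsilon>) / \<epsilon> ^ DIM('a)))"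
proof -
  have um[measurable]: "u \<in> borel_measurable borel" "v \<in> borel_measurable borel" using u v by auto
  interpret q: pair_sigma_finite "lborel :: 'a measure" "lborel \<Otimes>\<^sub>M lborel :: ('a \<times> 'a) measure"
    by standard
  define P where "P p = cnj (u (fst p)) * v (snd p)" for p
  have P: "integrable (lborel \<Otimes>\<^sub>M lborel) P"
    unfolding P_def[abs_def] by (rule lborel_pair.integrable_pair_mult) (use u v in auto)
  have [measurable]: "P \<in> borel_measurable (borel \<Otimes>\<^sub>M borel)" unfolding P_def[abs_def]
    using measurable_compose[OF measurable_fst um(1)] measurable_compose[OF measurable_snd um(2)]
    by (intro borel_measurable_times measurable_compose[OF _ borel_measurable_continuous_onI[OF continuous_on_cnj[OF continuous_on_id]]]) auto
  have g: "integrable lborel (\<lambda>\<xi>. complex_of_real (gauss (\<epsilon> *\<^sub>R \<xi> :: 'a)))"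
    using phase_gauss_scaled(1)[where 'a='a, OF e] by (simp add: complex_of_real_integrable_eq)
  define I where "I \<xi> p = complex_of_real (gauss (\<epsilon> *\<^sub>R \<xi>)) * P p * phase (snd p - fst p) \<xi>" for \<xi> p
  have I: "integrable (lborel \<Otimes>\<^sub>M (lborel \<Otimes>\<^sub>M lborel)) (case_prod I)"
    by (rule Bochner_Integration.integrable_bound[OF q.integrable_pair_mult[OF g P]])
      (auto simp: I_def split_beta' norm_mult)
  have 1: "cnj (cft u \<xi>) * cft v \<xi> = (LINT p|(lborel \<Otimes>\<^sub>M lborel). P p * phase (snd p - fst p) \<xi>)" for \<xi>
  proof -
    have iu: "integrable lborel (\<lambda>z. cnj (phase z \<xi> * u z))" and iv: "integrable lborel (\<lambda>z. phase z \<xi> * v z)"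
      using integrable_phase_mult[OF u] integrable_phase_mult[OF v] by (simp_all del: complex_cnj_mult)
    have "cnj (cft u \<xi>) * cft v \<xi> = (LINT x|lborel. LINT y|lborel. cnj (phase x \<xi> * u x) * (phase y \<xi> * v y))"
      unfolding cft_def using iu iv by (simp add: integral_cnj[symmetric] del: complex_cnj_mult integral_cnj)
    also have "\<dots> = (LINT p|(lborel \<Otimes>\<^sub>M lborel). cnj (phase (fst p) \<xi> * u (fst p)) * (phase (snd p) \<xi> * v (snd p)))"
      using lborel_pair.integral_fst'[OF lborel_pair.integrable_pair_mult[OF iu iv]] by simp
    also have "\<dots> = (LINT p|(lborel \<Otimes>\<^sub>M lborel). P p * phase (snd p - fst p) \<xi>)"
      by (intro Bochner_Integration.integral_cong)
        (auto simp: P_def phase_add[of _ "- _", simplified] phase_minus)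
    finally show ?thesis .
  qed
  have "(LINT \<xi>|lborel. cnj (cft u \<xi>) * cft v \<xi> * complex_of_real (gauss (\<epsilon> *\<^sub>R \<xi>))) =
    (LINT \<xi>|lborel. LINT p|(lborel \<Otimes>\<^sub>M lborel). I \<xi> p)"
    unfolding 1 I_def by (simp add: mult_ac flip: integral_mult_right_zero)
  also have "\<dots> = (LINT p|(lborel \<Otimes>\<^sub>M lborel). LINT \<xi>|lborel. I \<xi> p)"
    by (rule q.Fubini_integral[OF I, symmetric])
  also have "\<dots> = (LINT p|(lborel \<Otimes>\<^sub>M lborel). P p * (LINT \<xi>|lborel. phase (snd p - fst p) \<xi> * complex_of_real (gauss (\<epsilon> *\<^sub>R \<xi>))))"
    unfolding I_def by (simp add: mult_ac flip: integral_mult_right_zero)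
  finally show ?thesis unfolding phase_gauss_scaled(2)[OF e] P_def .
qed

lemma cnj_borel_measurable[measurable]: "cnj \<in> borel_measurable borel"
  by (intro borel_measurable_continuous_onI continuous_intros)

text \<open>If \<open>f\<close> is not integrable, its Bochner integral is 0 by convention and the
  bound is trivial. Estimates can therefore pass to nonnegative integrals at once.\<close>

lemma norm_integral_le_nn_integral:
  fixes f :: "'a \<Rightarrow> 'b::{banach,second_countable_topology}"
  shows "ennreal (norm (integral\<^sup>L M f)) \<le> (\<integral>\<^sup>+x. ennreal (norm (f x)) \<partial>M)"
  by (cases "integrable M f") (auto simp: integral_norm_bound_ennreal not_integrable_integral_eq)

lemma sqrt_two_pi_power: "sqrt (2 * pi) ^ n * sqrt (2 * pi) ^ n = (2 * pi) ^ n"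
  unfolding power_mult_distrib[symmetric] by (simp only: real_sqrt_mult_self) simp

text \<open>The mass does not depend on \<open>\<epsilon>\<close>. One factor
  \<open>sqrt (2 * pi) ^ DIM('a)\<close> comes from the transform of the Gaussian, the other from
  its integral; their product is the Plancherel constant.\<close>

lemma gauss_kernel_integral:
  fixes x :: "'a::euclidean_space"
  assumes e: "\<epsilon> > 0"
  shows "(\<integral>\<^sup>+y. ennreal (sqrt (2 * pi) ^ DIM('a) * gauss ((y - x) /\<^sub>R \<epsilon>) / \<epsilon> ^ DIM('a)) \<partial>lborel) = ennreal ((2 * pi) ^ DIM('a))"
proof -
  have m: "(\<lambda>y. gauss ((y - x) /\<^sub>R \<epsilon>)) \<in> borel_measurable borel" by measurable
  have c: "((x + \<epsilon> *\<^sub>R w) - x) /\<^sub>R \<epsilon> = w" for w using e by simp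
  have i: "integrable lborel (\<lambda>y. gauss ((y - x) /\<^sub>R \<epsilon>))"
    using lborel_integrable_affine[OF m, of \<epsilon> x] e gauss_integrable[where 'a='a] unfolding c by simp
  have v: "(LINT y|lborel. gauss ((y - x) /\<^sub>R \<epsilon>)) = \<epsilon> ^ DIM('a) * sqrt (2 * pi) ^ DIM('a)"
    using lborel_integral_affine[OF m, of \<epsilon> x] e gauss_integral[where 'a='a] unfolding c by simp
  have "sqrt (2 * pi) ^ DIM('a) * sqrt (2 * pi) ^ DIM('a) = (2 * pi) ^ DIM('a)"
    by (rule sqrt_two_pi_power)
  then have "(LINT y|lborel. sqrt (2 * pi) ^ DIM('a) * gauss ((y - x) /\<^sub>R \<epsilon>) / \<epsilon> ^ DIM('a)) = (2 * pi) ^ DIM('a)"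
    using e v by simp
  moreover have "integrable lborel (\<lambda>y. sqrt (2 * pi) ^ DIM('a) * gauss ((y - x) /\<^sub>R \<epsilon>) / \<epsilon> ^ DIM('a))"
    using i by simp
  moreover have "0 \<le> sqrt (2 * pi) ^ DIM('a) * gauss ((y - x) /\<^sub>R \<epsilon>) / \<epsilon> ^ DIM('a)" for y
    using e gauss_pos[of "(y - x) /\<^sub>R \<epsilon>"] by (simp add: less_imp_le)
  ultimately show ?thesis by (subst nn_integral_eq_integral) auto
qed

lemma real_amgm: "a * b \<le> (a\<^sup>2 + b\<^sup>2) / (2::real)"
  using sum_squares_bound[of a b] by simp

lemma gauss_scaled_tendsto: "(\<lambda>n. gauss ((1 / real (Suc n)) *\<^sub>R x)) \<longlonglongrightarrow> 1"
proof -
  have "(\<lambda>n. exp (- (norm ((1 / real (Suc n)) *\<^sub>R x))\<^sup>2 / 2)) \<longlonglongrightarrow> exp (- (norm (0 *\<^sub>R x))\<^sup>2 / 2)"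
    by (intro tendsto_intros LIMSEQ_Suc[OF lim_1_over_n]) auto
  then show ?thesis by (simp add: gauss_def)
qed

lemma integrable_cft_mult_gauss:
  fixes u v :: "'a::euclidean_space \<Rightarrow> complex"
  assumes u: "integrable lborel u" and v: "integrable lborel v" and e: "\<epsilon> > 0"
  shows "integrable lborel (\<lambda>\<xi>. cnj (cft u \<xi>) * cft v \<xi> * complex_of_real (gauss (\<epsilon> *\<^sub>R \<xi>)))"
proof -
  have [measurable]: "cft u \<in> borel_measurable borel" "cft v \<in> borel_measurable borel"
    using u v by (auto intro!: cft_measurable)
  let ?C = "(LINT z|lborel. norm (u z)) * (LINT z|lborel. norm (v z))"
  show ?thesis
  proof (rule Bochner_Integration.integrable_bound[where f="\<lambda>\<xi>. ?C * gauss (\<epsilon> *\<^sub>R \<xi>)"])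
    show "integrable lborel (\<lambda>\<xi>. ?C * gauss (\<epsilon> *\<^sub>R \<xi> :: 'a))"
      using phase_gauss_scaled(1)[where 'a='a, OF e] by simp
    have "norm (cft u \<xi>) * norm (cft v \<xi>) * gauss (\<epsilon> *\<^sub>R \<xi>) \<le> ?C * gauss (\<epsilon> *\<^sub>R \<xi>)" for \<xi>
      using norm_cft_le[OF u] norm_cft_le[OF v] gauss_pos[of "\<epsilon> *\<^sub>R \<xi>"]
      by (intro mult_right_mono mult_mono) (auto simp: less_imp_le)
    then show "AE \<xi> in lborel. norm (cnj (cft u \<xi>) * cft v \<xi> * complex_of_real (gauss (\<epsilon> *\<^sub>R \<xi>))) \<le>
        norm (?C * gauss (\<epsilon> *\<^sub>R \<xi>))"
      by (intro AE_I2) (simp add: norm_mult abs_mult abs_of_pos[OF gauss_pos])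
    show "(\<lambda>\<xi>. cnj (cft u \<xi>) * cft v \<xi> * complex_of_real (gauss (\<epsilon> *\<^sub>R \<xi>))) \<in> borel_measurable lborel"
      by measurable
  qed
qed

text \<open>The regularised identity expresses the left side through a positive kernel of fixed
  mass, for which Schur's test gives a bound independent of \<open>\<epsilon>\<close>; Fatou's lemma
  then removes the regularisation. Continuity of \<open>u\<close> plays no part in this argument, so
  it covers the discontinuous truncations in \<open>remainder_bound\<close>.\<close>

lemma cft_L2_bound:
  fixes u :: "'a::euclidean_space \<Rightarrow> complex"
  assumes u: "integrable lborel u" and u2: "integrable lborel (\<lambda>x. (norm (u x))\<^sup>2)"
  shows "(\<integral>\<^sup>+\<xi>. ennreal ((norm (cft u \<xi>))\<^sup>2) \<partial>lborel) \<le> ennreal ((2 * pi) ^ DIM('a) * (LINT x|lborel. (norm (u x))\<^sup>2))"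
proof -
  have um[measurable]: "u \<in> borel_measurable borel" using u by auto
  have [measurable]: "cft u \<in> borel_measurable borel" by (intro cft_measurable um)
  let ?C = "ennreal ((2 * pi) ^ DIM('a) * (LINT x|lborel. (norm (u x))\<^sup>2))"
  have *: "(\<integral>\<^sup>+\<xi>. ennreal ((norm (cft u \<xi>))\<^sup>2 * gauss (\<epsilon> *\<^sub>R \<xi>)) \<partial>lborel) \<le> ?C" if e: "\<epsilon> > 0" for \<epsilon>
  proof -
    define G where "G x = sqrt (2 * pi) ^ DIM('a) * gauss (x /\<^sub>R \<epsilon>) / \<epsilon> ^ DIM('a)" for x :: 'a
    have [measurable]: "G \<in> borel_measurable borel" unfolding G_def[abs_def] by measurable
    have G0: "G x \<ge> 0" for x using e gauss_pos[of "x /\<^sub>R \<epsilon>"] by (simp add: G_def less_imp_le)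
    have Gs: "G (x - y) = G (y - x)" for x y
      using norm_minus_commute[of x y] by (simp add: G_def gauss_def)
    have GI: "(\<integral>\<^sup>+y. ennreal (G (y - x)) \<partial>lborel) = ennreal ((2 * pi) ^ DIM('a))" for x
      unfolding G_def by (rule gauss_kernel_integral[OF e])
    have sq: "cnj (cft u \<xi>) * cft u \<xi> * complex_of_real (gauss (\<epsilon> *\<^sub>R \<xi>)) =
        complex_of_real ((norm (cft u \<xi>))\<^sup>2 * gauss (\<epsilon> *\<^sub>R \<xi>))" for \<xi>
      unfolding of_real_mult complex_norm_square by (simp add: mult.commute)
    have i: "integrable lborel (\<lambda>\<xi>. (norm (cft u \<xi>))\<^sup>2 * gauss (\<epsilon> *\<^sub>R \<xi>))"
      using integrable_cft_mult_gauss[OF u u e] unfolding sq complex_of_real_integrable_eq .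
    have "(\<integral>\<^sup>+\<xi>. ennreal ((norm (cft u \<xi>))\<^sup>2 * gauss (\<epsilon> *\<^sub>R \<xi>)) \<partial>lborel) =
        ennreal (LINT \<xi>|lborel. (norm (cft u \<xi>))\<^sup>2 * gauss (\<epsilon> *\<^sub>R \<xi>))"
      using i by (intro nn_integral_eq_integral AE_I2 mult_nonneg_nonneg less_imp_le[OF gauss_pos]) auto
    also have "\<dots> \<le> ennreal (norm (LINT p|(lborel \<Otimes>\<^sub>M lborel). cnj (u (fst p)) * u (snd p) * complex_of_real (G (snd p - fst p))))"
    proof -
      have eq: "complex_of_real (LINT \<xi>|lborel. (norm (cft u \<xi>))\<^sup>2 * gauss (\<epsilon> *\<^sub>R \<xi>)) =
         (LINT p|(lborel \<Otimes>\<^sub>M lborel). cnj (u (fst p)) * u (snd p) * complex_of_real (G (snd p - fst p)))"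
        using cft_regularised[OF u u e] unfolding sq integral_complex_of_real G_def .
      show ?thesis unfolding eq[symmetric] norm_of_real by (intro ennreal_leI abs_ge_self)
    qed
    also have "\<dots> \<le> (\<integral>\<^sup>+p. ennreal (norm (cnj (u (fst p)) * u (snd p) * complex_of_real (G (snd p - fst p)))) \<partial>(lborel \<Otimes>\<^sub>M lborel))"
      by (rule norm_integral_le_nn_integral)
    \<comment> \<open>AM-GM leaves in each summand a single value of \<open>u\<close>, so the other
      variable can be integrated over the kernel alone. The evenness of \<open>G\<close> puts the
      second summand into the same shape as the first.\<close>
    also have "\<dots> \<le> (\<integral>\<^sup>+p. ennreal ((norm (u (fst p)))\<^sup>2 / 2) * ennreal (G (snd p - fst p)) + ennreal ((norm (u (snd p)))\<^sup>2 / 2) * ennreal (G (fst p - snd p)) \<partial>(lborel \<Otimes>\<^sub>M lborel))"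
    proof (intro nn_integral_mono)
      fix p :: "'a \<times> 'a"
      have "norm (u (fst p)) * norm (u (snd p)) * G (snd p - fst p) \<le>
          ((norm (u (fst p)))\<^sup>2 + (norm (u (snd p)))\<^sup>2) / 2 * G (snd p - fst p)"
        by (intro mult_right_mono real_amgm G0)
      then show "ennreal (norm (cnj (u (fst p)) * u (snd p) * complex_of_real (G (snd p - fst p)))) \<le>
        ennreal ((norm (u (fst p)))\<^sup>2 / 2) * ennreal (G (snd p - fst p)) + ennreal ((norm (u (snd p)))\<^sup>2 / 2) * ennreal (G (fst p - snd p))"
        using G0 by (simp add: norm_mult ennreal_mult[symmetric] ennreal_plus[symmetric] Gs[of "fst p"] algebra_simps add_divide_distrib del: ennreal_plus)
    qed
    also have "\<dots> = (\<integral>\<^sup>+p. ennreal ((norm (u (fst p)))\<^sup>2 / 2) * ennreal (G (snd p - fst p)) \<partial>(lborel \<Otimes>\<^sub>M lborel)) +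
        (\<integral>\<^sup>+p. ennreal ((norm (u (snd p)))\<^sup>2 / 2) * ennreal (G (fst p - snd p)) \<partial>(lborel \<Otimes>\<^sub>M lborel))"
      by (rule nn_integral_add) measurable
    also have "(\<integral>\<^sup>+p. ennreal ((norm (u (fst p)))\<^sup>2 / 2) * ennreal (G (snd p - fst p)) \<partial>(lborel \<Otimes>\<^sub>M lborel)) =
       (\<integral>\<^sup>+x. \<integral>\<^sup>+y. ennreal ((norm (u x))\<^sup>2 / 2) * ennreal (G (y - x)) \<partial>lborel \<partial>lborel)"
      by (subst lborel.nn_integral_fst[symmetric]) auto
    also have "\<dots> = (\<integral>\<^sup>+x. ennreal ((norm (u x))\<^sup>2 / 2) * ennreal ((2 * pi) ^ DIM('a)) \<partial>lborel)"
      by (subst nn_integral_cmult) (auto simp: GI)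
    also have "(\<integral>\<^sup>+p. ennreal ((norm (u (snd p)))\<^sup>2 / 2) * ennreal (G (fst p - snd p)) \<partial>(lborel \<Otimes>\<^sub>M lborel)) =
       (\<integral>\<^sup>+y. \<integral>\<^sup>+x. ennreal ((norm (u y))\<^sup>2 / 2) * ennreal (G (x - y)) \<partial>lborel \<partial>lborel)"
      by (subst lborel_pair.nn_integral_snd[symmetric]) auto
    also have "\<dots> = (\<integral>\<^sup>+y. ennreal ((norm (u y))\<^sup>2 / 2) * ennreal ((2 * pi) ^ DIM('a)) \<partial>lborel)"
      by (subst nn_integral_cmult) (auto simp: GI)
    also have "(\<integral>\<^sup>+y. ennreal ((norm (u y))\<^sup>2 / 2) * ennreal ((2 * pi) ^ DIM('a)) \<partial>lborel) +
       (\<integral>\<^sup>+y. ennreal ((norm (u y))\<^sup>2 / 2) * ennreal ((2 * pi) ^ DIM('a)) \<partial>lborel) = ?C"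
    proof -
      have "(\<integral>\<^sup>+y. ennreal ((norm (u y))\<^sup>2 / 2) * ennreal ((2 * pi) ^ DIM('a)) \<partial>lborel) =
         ennreal ((LINT x|lborel. (norm (u x))\<^sup>2 / 2)) * ennreal ((2 * pi) ^ DIM('a))"
        using u2 by (subst nn_integral_multc) (auto simp: nn_integral_eq_integral)
      then show ?thesis using u2
        by (simp add: ennreal_mult[symmetric] ennreal_plus[symmetric] field_simps del: ennreal_plus)
    qed
    finally show ?thesis .
  qed
  have lim: "(\<lambda>n. ennreal ((norm (cft u \<xi>))\<^sup>2 * gauss ((1 / real (Suc n)) *\<^sub>R \<xi>))) \<longlonglongrightarrow> ennreal ((norm (cft u \<xi>))\<^sup>2)" for \<xi>
    using tendsto_mult_left[OF gauss_scaled_tendsto[of \<xi>], of "(norm (cft u \<xi>))\<^sup>2"] by (intro tendsto_ennrealI) simp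
  \<comment> \<open>Fatou's lemma along \<open>\<epsilon> = 1 / Suc n\<close>, where the Gaussian
    factor tends to 1 pointwise.\<close>
  have "(\<integral>\<^sup>+\<xi>. ennreal ((norm (cft u \<xi>))\<^sup>2) \<partial>lborel) =
     (\<integral>\<^sup>+\<xi>. liminf (\<lambda>n. ennreal ((norm (cft u \<xi>))\<^sup>2 * gauss ((1 / real (Suc n)) *\<^sub>R \<xi>))) \<partial>lborel)"
    by (intro nn_integral_cong lim_imp_Liminf[symmetric] lim) simp
  also have "\<dots> \<le> liminf (\<lambda>n. \<integral>\<^sup>+\<xi>. ennreal ((norm (cft u \<xi>))\<^sup>2 * gauss ((1 / real (Suc n)) *\<^sub>R \<xi>)) \<partial>lborel)"
    by (rule nn_integral_liminf) measurable
  also have "\<dots> \<le> liminf (\<lambda>n::nat. ?C)"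
    by (intro Liminf_mono always_eventually allI *) simp
  also have "\<dots> = ?C" by (simp add: Liminf_const)
  finally show ?thesis .
qed

lemma cft_square_integrable:
  fixes u :: "'a::euclidean_space \<Rightarrow> complex"
  assumes u: "integrable lborel u" and u2: "integrable lborel (\<lambda>x. (norm (u x))\<^sup>2)"
  shows "integrable lborel (\<lambda>\<xi>. (norm (cft u \<xi>))\<^sup>2)"
proof (rule integrableI_bounded)
  have [measurable]: "cft u \<in> borel_measurable borel" using u by (intro cft_measurable) auto
  show "(\<lambda>\<xi>. (norm (cft u \<xi>))\<^sup>2) \<in> borel_measurable lborel" by measurable
  show "(\<integral>\<^sup>+\<xi>. ennreal (norm ((norm (cft u \<xi>))\<^sup>2)) \<partial>lborel) < \<infinity>"
    using cft_L2_bound[OF assms] by (auto intro: le_less_trans)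
qed

text \<open>Both sides of the regularised identity have limits. On the frequency side the squares of
  the two transforms dominate, by \<open>cft_L2_bound\<close>; on the space side only
  \<open>v\<close> is averaged, so its continuity and boundedness suffice.\<close>

lemma cft_parseval:
  fixes u v :: "'a::euclidean_space \<Rightarrow> complex"
  assumes u: "integrable lborel u" "integrable lborel (\<lambda>x. (norm (u x))\<^sup>2)"
    and v: "integrable lborel v" "integrable lborel (\<lambda>x. (norm (v x))\<^sup>2)"
    and cont: "continuous_on UNIV v" and B: "\<And>x. norm (v x) \<le> B"
  shows "(LINT \<xi>|lborel. cnj (cft u \<xi>) * cft v \<xi>) =
    complex_of_real ((2 * pi) ^ DIM('a)) * (LINT x|lborel. cnj (u x) * v x)"
proof -
  have um[measurable]: "u \<in> borel_measurable borel" "v \<in> borel_measurable borel" using u v by auto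
  have [measurable]: "cft u \<in> borel_measurable borel" "cft v \<in> borel_measurable borel" by (intro cft_measurable um)+
  define e where "e n = 1 / real (Suc n)" for n
  have e0: "e n > 0" for n by (simp add: e_def)
  define s where "s = sqrt (2 * pi) ^ DIM('a)"
  have ss: "s * s = (2 * pi) ^ DIM('a)" unfolding s_def by (rule sqrt_two_pi_power)
  have s0: "s \<ge> 0" by (simp add: s_def)
  have B0: "B \<ge> 0" using B[of 0] norm_ge_zero order_trans by blast
  have 1: "(\<lambda>n. LINT \<xi>|lborel. cnj (cft u \<xi>) * cft v \<xi> * complex_of_real (gauss (e n *\<^sub>R \<xi>))) \<longlonglongrightarrow>
      (LINT \<xi>|lborel. cnj (cft u \<xi>) * cft v \<xi>)"
  proof (rule integral_dominated_convergence[where w="\<lambda>\<xi>. ((norm (cft u \<xi>))\<^sup>2 + (norm (cft v \<xi>))\<^sup>2) / 2"])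
    show "integrable lborel (\<lambda>\<xi>. ((norm (cft u \<xi>))\<^sup>2 + (norm (cft v \<xi>))\<^sup>2) / 2)"
      using cft_square_integrable[OF u] cft_square_integrable[OF v] by simp
    have "(\<lambda>n. cnj (cft u \<xi>) * cft v \<xi> * complex_of_real (gauss (e n *\<^sub>R \<xi>))) \<longlonglongrightarrow> cnj (cft u \<xi>) * cft v \<xi> * complex_of_real 1" for \<xi>
      unfolding e_def by (intro tendsto_intros gauss_scaled_tendsto)
    then show "AE \<xi> in lborel. (\<lambda>n. cnj (cft u \<xi>) * cft v \<xi> * complex_of_real (gauss (e n *\<^sub>R \<xi>))) \<longlonglongrightarrow> cnj (cft u \<xi>) * cft v \<xi>"
      by simp
    have "norm (cft u \<xi>) * norm (cft v \<xi>) * gauss (e n *\<^sub>R \<xi>) \<le> ((norm (cft u \<xi>))\<^sup>2 + (norm (cft v \<xi>))\<^sup>2) / 2" for n \<xi>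
      using real_amgm[of "norm (cft u \<xi>)" "norm (cft v \<xi>)"] gauss_le_1[of "e n *\<^sub>R \<xi>"] gauss_pos[of "e n *\<^sub>R \<xi>"]
        mult_left_mono[of "gauss (e n *\<^sub>R \<xi>)" 1 "norm (cft u \<xi>) * norm (cft v \<xi>)"] by simp
    then show "AE \<xi> in lborel. norm (cnj (cft u \<xi>) * cft v \<xi> * complex_of_real (gauss (e n *\<^sub>R \<xi>))) \<le>
        ((norm (cft u \<xi>))\<^sup>2 + (norm (cft v \<xi>))\<^sup>2) / 2" for n
      by (intro AE_I2) (simp add: norm_mult abs_of_pos[OF gauss_pos])
  qed measurable
  \<comment> \<open>A Gaussian average of \<open>v\<close> around \<open>x\<close>, of width
    \<open>e n\<close>. After the substitution \<open>y = x + e n *\<^sub>R w\<close> the weight no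
    longer depends on \<open>n\<close>, so dominated convergence applies.\<close>
  define g where "g n x = (LINT w|lborel. v (x + e n *\<^sub>R w) * complex_of_real (gauss w))" for n x
  have gm[measurable]: "g n \<in> borel_measurable borel" for n unfolding g_def[abs_def] by measurable
  have gi: "integrable lborel (\<lambda>w. v (x + a *\<^sub>R w) * complex_of_real (gauss w))" for x a
  proof (rule Bochner_Integration.integrable_bound[where f="\<lambda>w. B * gauss w"])
    show "AE w in lborel. norm (v (x + a *\<^sub>R w) * complex_of_real (gauss w)) \<le> norm (B * gauss w)"
      using B B0 gauss_pos by (auto simp: norm_mult abs_mult less_imp_le intro!: mult_right_mono)
  qed (auto intro: gauss_integrable)
  have gB: "norm (g n x) \<le> B * s" for n x
  proof -
    have "norm (g n x) \<le> (LINT w|lborel. norm (v (x + e n *\<^sub>R w) * complex_of_real (gauss w)))"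
      unfolding g_def by (rule integral_norm_bound)
    also have "\<dots> \<le> (LINT w|lborel. B * gauss (w::'a))"
    proof (rule Bochner_Integration.integral_mono[OF integrable_norm[OF gi]])
      show "norm (v (x + e n *\<^sub>R w) * complex_of_real (gauss w)) \<le> B * gauss w" for w :: 'a
        using B by (simp add: norm_mult abs_of_pos[OF gauss_pos] mult_right_mono less_imp_le[OF gauss_pos])
    qed (simp add: gauss_integrable)
    finally show ?thesis by (simp add: gauss_integral s_def)
  qed
  have glim: "(\<lambda>n. g n x) \<longlonglongrightarrow> v x * complex_of_real s" for x
  proof -
    have "(\<lambda>n. g n x) \<longlonglongrightarrow> (LINT w|lborel. v x * complex_of_real (gauss (w::'a)))"
      unfolding g_def
    proof (rule integral_dominated_convergence[where w="\<lambda>w. B * gauss w"])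
      have "(\<lambda>n. v (x + e n *\<^sub>R w)) \<longlonglongrightarrow> v (x + 0 *\<^sub>R w)" for w :: 'a
      proof (rule isCont_tendsto_compose[of "x + 0 *\<^sub>R w" v])
        show "isCont v (x + 0 *\<^sub>R w)" using cont by (simp add: continuous_on_eq_continuous_at)
        show "(\<lambda>n. x + e n *\<^sub>R w) \<longlonglongrightarrow> x + 0 *\<^sub>R w"
          unfolding e_def by (intro tendsto_intros LIMSEQ_Suc[OF lim_1_over_n])
      qed
      then show "AE w in lborel. (\<lambda>n. v (x + e n *\<^sub>R w) * complex_of_real (gauss w)) \<longlonglongrightarrow> v x * complex_of_real (gauss w)"
        by (intro AE_I2 tendsto_intros) simp
      show "AE w in lborel. norm (v (x + e n *\<^sub>R w) * complex_of_real (gauss w)) \<le> B * gauss w" for n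
        using B by (intro AE_I2) (simp add: norm_mult abs_of_pos[OF gauss_pos] mult_right_mono less_imp_le[OF gauss_pos])
    qed (auto intro: gauss_integrable)
    then show ?thesis by (simp add: gauss_integral s_def)
  qed
  have 2: "(LINT \<xi>|lborel. cnj (cft u \<xi>) * cft v \<xi> * complex_of_real (gauss (e n *\<^sub>R \<xi>))) =
      (LINT x|lborel. complex_of_real s * (cnj (u x) * g n x))" for n
  proof -
    let ?K = "\<lambda>x y. cnj (u x) * v y * complex_of_real (s * gauss ((y - x) /\<^sub>R e n) / e n ^ DIM('a))"
    have i: "integrable (lborel \<Otimes>\<^sub>M lborel) (\<lambda>p. ?K (fst p) (snd p))"
    proof (rule Bochner_Integration.integrable_bound)
      show "integrable (lborel \<Otimes>\<^sub>M lborel) (\<lambda>p. (complex_of_real (s / e n ^ DIM('a)) * u (fst p)) * v (snd p))"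
        by (rule lborel_pair.integrable_pair_mult) (use u v in auto)
      show "(\<lambda>p. ?K (fst p) (snd p)) \<in> borel_measurable (lborel \<Otimes>\<^sub>M lborel)"
        using measurable_compose[OF measurable_fst um(1)] measurable_compose[OF measurable_snd um(2)] by measurable
      have "norm (?K x y) \<le> norm (complex_of_real (s / e n ^ DIM('a)) * u x * v y)" for x y
      proof -
        have "norm (?K x y) = norm (complex_of_real (s / e n ^ DIM('a)) * u x * v y) * gauss ((y - x) /\<^sub>R e n)"
          using gauss_pos[of "(y - x) /\<^sub>R e n"] by (simp add: norm_mult norm_divide abs_mult)
        also have "\<dots> \<le> norm (complex_of_real (s / e n ^ DIM('a)) * u x * v y) * 1"
          by (intro mult_left_mono gauss_le_1) auto
        finally show ?thesis by simp
      qed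
      then show "AE p in lborel \<Otimes>\<^sub>M lborel. norm (?K (fst p) (snd p)) \<le> norm (complex_of_real (s / e n ^ DIM('a)) * u (fst p) * v (snd p))"
        by blast
    qed
    have "(LINT \<xi>|lborel. cnj (cft u \<xi>) * cft v \<xi> * complex_of_real (gauss (e n *\<^sub>R \<xi>))) =
       (LINT p|(lborel \<Otimes>\<^sub>M lborel). ?K (fst p) (snd p))"
      unfolding s_def by (rule cft_regularised[OF u(1) v(1) e0])
    also have "\<dots> = (LINT x|lborel. LINT y|lborel. ?K x y)"
      using lborel_pair.integral_fst'[OF i, symmetric] unfolding fst_conv snd_conv .
    also have "(\<lambda>x. LINT y|lborel. ?K x y) = (\<lambda>x. complex_of_real s * (cnj (u x) * g n x))"
    proof
      fix x
      have "(LINT y|lborel. ?K x y) = (e n ^ DIM('a)) *\<^sub>R (LINT w|lborel. ?K x (x + e n *\<^sub>R w))"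
        by (subst lborel_integral_affine[of _ "e n" x]) (use e0[of n] in auto)
      also have "(\<lambda>w. ?K x (x + e n *\<^sub>R w)) = (\<lambda>w. complex_of_real (s / e n ^ DIM('a)) * cnj (u x) * (v (x + e n *\<^sub>R w) * complex_of_real (gauss w)))"
        using e0[of n] by auto
      finally show "(LINT y|lborel. ?K x y) = complex_of_real s * (cnj (u x) * g n x)"
        using e0[of n] by (simp add: g_def scaleR_conv_of_real)
    qed
    finally show ?thesis .
  qed
  have 3: "(\<lambda>n. LINT x|lborel. complex_of_real s * (cnj (u x) * g n x)) \<longlonglongrightarrow>
     (LINT x|lborel. complex_of_real s * (cnj (u x) * (v x * complex_of_real s)))"
  proof (rule integral_dominated_convergence[where w="\<lambda>x. s * (norm (u x) * (B * s))"])
    show "AE x in lborel. (\<lambda>n. complex_of_real s * (cnj (u x) * g n x)) \<longlonglongrightarrow> complex_of_real s * (cnj (u x) * (v x * complex_of_real s))"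
      by (intro AE_I2 tendsto_intros glim)
    show "AE x in lborel. norm (complex_of_real s * (cnj (u x) * g n x)) \<le> s * (norm (u x) * (B * s))" for n
      using gB[of n] s0 by (intro AE_I2) (simp add: norm_mult mult_left_mono)
  qed (use u in auto)
  have "(LINT \<xi>|lborel. cnj (cft u \<xi>) * cft v \<xi>) = (LINT x|lborel. complex_of_real s * (cnj (u x) * (v x * complex_of_real s)))"
    using LIMSEQ_unique[OF 1] 3 unfolding 2 by blast
  also have "(\<lambda>x. complex_of_real s * (cnj (u x) * (v x * complex_of_real s))) = (\<lambda>x. complex_of_real (s * s) * (cnj (u x) * v x))"
    by (auto simp: mult_ac)
  finally show ?thesis unfolding ss by simp
qed

section \<open>Bounded functions of compact support, and the transform of a derivative\<close>

lemma bounded_support_integrable: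
  fixes f :: "'a::euclidean_space \<Rightarrow> 'b::{banach,second_countable_topology}"
  assumes [measurable]: "f \<in> borel_measurable borel" and "compact K"
    and "\<And>x. norm (f x) \<le> C" "\<And>x. x \<notin> K \<Longrightarrow> f x = 0"
  shows "integrable lborel f"
proof (rule Bochner_Integration.integrable_bound[where f="\<lambda>x. C * indicator K x :: real"])
  have "emeasure lborel K < \<infinity>" "K \<in> sets lborel"
    using assms(2) emeasure_compact_finite by (auto simp: compact_imp_closed)
  then show "integrable lborel (\<lambda>x. C * indicator K x :: real)" by simp
  have "norm (f x) \<le> norm (C * indicator K x :: real)" for x
  proof (cases "x \<in> K")
    case True then show ?thesis using assms(3)[of x] order_trans[OF norm_ge_zero assms(3)[of x]] by simp
  qed (use assms(4) in auto)
  then show "AE x in lborel. norm (f x) \<le> norm (C * indicator K x :: real)" by simp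
qed simp

lemma bounded_support_square_integrable:
  fixes f :: "'a::euclidean_space \<Rightarrow> 'b::{banach,second_countable_topology}"
  assumes [measurable]: "f \<in> borel_measurable borel" and K: "compact K"
    and C: "\<And>x. norm (f x) \<le> C" and 0: "\<And>x. x \<notin> K \<Longrightarrow> f x = 0"
  shows "integrable lborel (\<lambda>x. (norm (f x))\<^sup>2)"
  by (rule bounded_support_integrable[OF _ K, where C="C\<^sup>2"]) (use C 0 in \<open>auto intro!: power_mono\<close>)

lemma test_function_bounded:
  assumes "test_function V f" obtains C where "C \<ge> 0" "\<And>x. norm (f x) \<le> C"
proof -
  obtain K where K: "compact K" "K \<subseteq> V" "\<And>x. x \<notin> K \<Longrightarrow> f x = 0" using assms by (rule test_functionE) blast
  have "bounded (f ` K)" using K test_function_continuous[OF assms]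
    by (intro compact_imp_bounded compact_continuous_image) (auto intro: continuous_on_subset)
  then obtain C where C: "\<And>x. x \<in> K \<Longrightarrow> norm (f x) \<le> C" unfolding bounded_iff by auto
  have "norm (f x) \<le> max 0 C" for x using C[of x] K(3)[of x] by (cases "x \<in> K") auto
  then show ?thesis using that[of "max 0 C"] by auto
qed

lemma test_function_measurable:
  fixes f :: "'a::euclidean_space \<Rightarrow> 'b::real_normed_vector"
  shows "test_function V f \<Longrightarrow> f \<in> borel_measurable borel"
  using test_function_continuous borel_measurable_continuous_onI by blast

lemma test_function_integrable:
  fixes f :: "'a::euclidean_space \<Rightarrow> 'b::{banach,second_countable_topology}"
  assumes "test_function V f"
  shows "integrable lborel f" "integrable lborel (\<lambda>x. (norm (f x))\<^sup>2)"
proof -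
  obtain K where K: "compact K" "K \<subseteq> V" "\<And>x. x \<notin> K \<Longrightarrow> f x = 0" using assms by (rule test_functionE) blast
  obtain C where C: "\<And>x. norm (f x) \<le> C" using assms by (rule test_function_bounded) blast
  note m = test_function_measurable[OF assms]
  show "integrable lborel f" by (rule bounded_support_integrable[OF m K(1) C K(3)])
  show "integrable lborel (\<lambda>x. (norm (f x))\<^sup>2)" by (rule bounded_support_square_integrable[OF m K(1) C K(3)])
qed

lemma cft_add: "integrable lborel u \<Longrightarrow> integrable lborel v \<Longrightarrow> cft (\<lambda>z. u z + v z) \<xi> = cft u \<xi> + cft v \<xi>"
  unfolding cft_def using integrable_phase_mult[of u \<xi>] integrable_phase_mult[of v \<xi>] by (simp add: distrib_left)

lemma cft_cmult: "cft (\<lambda>z. c * u z) \<xi> = c * cft u \<xi>"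
proof -
  have "(\<lambda>z. phase z \<xi> * (c * u z)) = (\<lambda>z. c * (phase z \<xi> * u z))" by (simp add: mult_ac)
  then show ?thesis unfolding cft_def by (simp only: integral_mult_right_zero)
qed

lemma cft_translate:
  assumes [measurable]: "u \<in> borel_measurable borel"
  shows "cft (\<lambda>z. u (z + a)) \<xi> = phase (- a) \<xi> * cft u \<xi>"
proof -
  have "cft u \<xi> = (LINT z|lborel. phase (a + 1 *\<^sub>R z) \<xi> * u (a + 1 *\<^sub>R z))"
    unfolding cft_def by (subst lborel_integral_affine[of _ 1 a]) auto
  also have "\<dots> = phase a \<xi> * cft (\<lambda>z. u (z + a)) \<xi>"
    unfolding cft_def integral_mult_right_zero[symmetric] by (simp add: phase_add mult_ac add.commute)
  finally have "phase (- a) \<xi> * cft u \<xi> = phase (- a + a) \<xi> * cft (\<lambda>z. u (z + a)) \<xi>"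
    by (simp only: phase_add mult.assoc)
  then show ?thesis by (simp add: phase_def)
qed

text \<open>Instead of integrating by parts, pass to the limit in difference quotients: a
  translation multiplies the transform by a phase. The minus sign reflects the positive sign in the
  exponent of \<open>cft\<close>.\<close>

lemma cft_dir_deriv:
  fixes u :: "'a::euclidean_space \<Rightarrow> complex"
  assumes u: "test_function UNIV u" and b: "b \<in> Basis"
  shows "cft (dir_deriv b u) \<xi> = - \<i> * complex_of_real (\<xi> \<bullet> b) * cft u \<xi>"
proof -
  define h where "h n = 1 / real (Suc n)" for n
  have h0: "h n > 0" "h n \<le> 1" for n by (auto simp: h_def)
  have hlim: "h \<longlonglongrightarrow> 0" unfolding h_def[abs_def] by (rule LIMSEQ_Suc[OF lim_1_over_n])
  have hlim': "filterlim h (at 0) sequentially"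
    using hlim h0(1) by (auto simp: filterlim_at less_imp_neq[symmetric])
  have um[measurable]: "u \<in> borel_measurable borel" using test_function_measurable[OF u] .
  have du: "test_function UNIV (dir_deriv b u)" using test_function_dir_deriv[OF u b] .
  have [measurable]: "dir_deriv b u \<in> borel_measurable borel" using test_function_measurable[OF du] .
  have hd: "(u has_derivative (\<lambda>v. dir_deriv v u z)) (at z)" for z
    using smooth_on_has_derivative[OF test_function_smooth[OF u]] by auto
  have line: "((\<lambda>t. u (z + t *\<^sub>R b)) has_vector_derivative dir_deriv b u (z + t *\<^sub>R b)) (at t)" for z t
  proof -
    have "((\<lambda>t. z + t *\<^sub>R b) has_derivative (\<lambda>s. s *\<^sub>R b)) (at t)"
      by (auto intro!: derivative_eq_intros)
    from has_derivative_compose[OF this hd]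
    have "((\<lambda>t. u (z + t *\<^sub>R b)) has_derivative (\<lambda>s. dir_deriv (s *\<^sub>R b) u (z + t *\<^sub>R b))) (at t)" .
    moreover have "dir_deriv (s *\<^sub>R b) u y = s *\<^sub>R dir_deriv b u y" for s y
      using linear_scale[OF bounded_linear.linear[OF has_derivative_bounded_linear[OF hd[of y]]]] .
    ultimately show ?thesis by (simp add: has_vector_derivative_def)
  qed
  obtain C where C: "\<And>z. norm (dir_deriv b u z) \<le> C" using du by (rule test_function_bounded) blast
  obtain K where K: "compact K" "\<And>z. z \<notin> K \<Longrightarrow> u z = 0" using u by (rule test_functionE) blast
  obtain B where B: "\<And>z. z \<in> K \<Longrightarrow> norm z \<le> B" using K(1) compact_imp_bounded bounded_iff by metis
  define D where "D n z = (1 / complex_of_real (h n)) * (u (z + h n *\<^sub>R b) - u z)" for n z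
  have Dm[measurable]: "D n \<in> borel_measurable borel" for n unfolding D_def[abs_def] by measurable
  \<comment> \<open>The steps \<open>h n\<close> are at most 1, so every quotient vanishes outside
    the ball of radius \<open>B + 1\<close>; inside it the mean value inequality applies.\<close>
  have Dbd: "norm (D n z) \<le> C * indicator (cball 0 (B + 1)) z" for n z
  proof (cases "z \<in> cball 0 (B + 1)")
    case True
    have "norm (u (z + h n *\<^sub>R b) - u (z + 0 *\<^sub>R b)) \<le> C * norm (h n - 0)"
    proof (rule differentiable_bound[of UNIV])
      show "((\<lambda>t. u (z + t *\<^sub>R b)) has_derivative (\<lambda>s. s *\<^sub>R dir_deriv b u (z + t *\<^sub>R b))) (at t within UNIV)" for t
        using line[of z t] by (simp add: has_vector_derivative_def)
      show "onorm (\<lambda>s. s *\<^sub>R dir_deriv b u (z + t *\<^sub>R b)) \<le> C" for t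
        using C by (intro onorm_bound) (auto simp: mult.commute[of C] intro: mult_left_mono order_trans[OF norm_ge_zero C])
    qed auto
    then show ?thesis using True h0[of n] by (simp add: D_def norm_mult norm_divide field_simps)
  next
    case False
    then have z: "norm z > B + 1" by simp
    then have "norm (z + h n *\<^sub>R b) > B"
      using norm_triangle_ineq4[of "z + h n *\<^sub>R b" "h n *\<^sub>R b"] h0[of n] b by auto
    then have "u (z + h n *\<^sub>R b) = 0" "u z = 0" using K(2) B z by (auto simp: not_le[symmetric]) force+
    then show ?thesis using False by (simp add: D_def)
  qed
  have Dlim: "(\<lambda>n. D n z) \<longlonglongrightarrow> dir_deriv b u z" for z
  proof -
    let ?v = "dir_deriv b u z"
    have "((\<lambda>t. norm (u (z + t *\<^sub>R b) - u z - t *\<^sub>R ?v) / norm t) \<longlongrightarrow> 0) (at 0)"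
      using line[of z 0] unfolding has_vector_derivative_def has_derivative_iff_norm by simp
    from filterlim_compose[OF this hlim']
    have "(\<lambda>n. norm (u (z + h n *\<^sub>R b) - u z - h n *\<^sub>R ?v) / norm (h n)) \<longlonglongrightarrow> 0" .
    moreover have "norm (u (z + h n *\<^sub>R b) - u z - h n *\<^sub>R ?v) / norm (h n) = norm (D n z - ?v)" for n
    proof -
      have "D n z - ?v = (u (z + h n *\<^sub>R b) - u z - h n *\<^sub>R ?v) / complex_of_real (h n)"
        using h0(1)[of n] by (simp add: D_def scaleR_conv_of_real field_simps)
      then show ?thesis by (simp add: norm_divide)
    qed
    ultimately have "(\<lambda>n. norm (D n z - ?v)) \<longlonglongrightarrow> 0" by simp
    then show ?thesis by (rule LIM_zero_cancel[OF tendsto_norm_zero_cancel])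
  qed
  have "(\<lambda>n. cft (D n) \<xi>) \<longlonglongrightarrow> cft (dir_deriv b u) \<xi>"
    unfolding cft_def
  proof (rule integral_dominated_convergence[where w="\<lambda>z. C * indicator (cball 0 (B + 1)) z"])
    show "integrable lborel (\<lambda>z::'a. C * indicator (cball 0 (B + 1)) z)"
      using emeasure_compact_finite[OF compact_cball[of "0::'a" "B+1"]] by simp
    show "AE z in lborel. (\<lambda>n. phase z \<xi> * D n z) \<longlonglongrightarrow> phase z \<xi> * dir_deriv b u z"
      by (intro AE_I2 tendsto_intros Dlim)
    show "AE z in lborel. norm (phase z \<xi> * D n z) \<le> C * indicator (cball 0 (B + 1)) z" for n
      using Dbd by (simp add: norm_mult)
  qed measurable
  moreover have "cft (D n) \<xi> = ((phase (- (h n *\<^sub>R b)) \<xi> - 1) / complex_of_real (h n)) * cft u \<xi>" for n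
  proof -
    have i: "integrable lborel u" using test_function_integrable[OF u] by simp
    have i': "integrable lborel (\<lambda>z. u (z + h n *\<^sub>R b))"
      using lborel_integrable_affine[OF um, of 1 "h n *\<^sub>R b"] i by (simp add: add.commute)
    have "D n = (\<lambda>z. (1 / complex_of_real (h n)) * (u (z + h n *\<^sub>R b) + (-1) * u z))" by (auto simp: D_def)
    then have "cft (D n) \<xi> = (1 / complex_of_real (h n)) * (cft (\<lambda>z. u (z + h n *\<^sub>R b)) \<xi> + (-1) * cft u \<xi>)"
      using cft_cmult[of "-1" u] cft_add[of "\<lambda>z. u (z + h n *\<^sub>R b)" "\<lambda>z. (-1) * u z" \<xi>] i i' by (simp only: cft_cmult) simp
    then show ?thesis unfolding cft_translate[OF um] by (simp add: field_simps diff_divide_distrib)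
  qed
  moreover have "(\<lambda>n. ((phase (- (h n *\<^sub>R b)) \<xi> - 1) / complex_of_real (h n)) * cft u \<xi>) \<longlonglongrightarrow> (- \<i> * complex_of_real (\<xi> \<bullet> b)) * cft u \<xi>"
  proof (rule tendsto_mult[OF _ tendsto_const])
    let ?c = "- \<i> * complex_of_real (\<xi> \<bullet> b)"
    have "((\<lambda>z. exp (z * ?c)) has_field_derivative ?c) (at 0)"
      by (auto intro!: derivative_eq_intros)
    then have l: "(\<lambda>z. (exp (z * ?c) - 1) / z) \<midarrow>0\<rightarrow> ?c" unfolding DERIV_def by simp
    have "filterlim (\<lambda>n. complex_of_real (h n)) (at 0) sequentially"
      using tendsto_of_real[OF hlim] h0(1) by (auto simp: filterlim_at less_imp_neq[symmetric])
    from filterlim_compose[OF l this]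
    show "(\<lambda>n. (phase (- (h n *\<^sub>R b)) \<xi> - 1) / complex_of_real (h n)) \<longlonglongrightarrow> ?c"
      by (simp add: phase_def inner_commute mult_ac)
  qed
  ultimately show ?thesis by (simp only: LIMSEQ_unique)
qed

section \<open>Oscillating spherical amplitudes\<close>

definition osc :: "'a::euclidean_space \<Rightarrow> complex \<Rightarrow> 'a \<Rightarrow> complex" where
  "osc x \<kappa> y = exp (\<i> * \<kappa> * complex_of_real (norm (x - y)))"

text \<open>Away from \<open>x\<close>, the derivative of the distance to \<open>x\<close> along
  \<open>b\<close>.\<close>

definition rdir :: "'a::euclidean_space \<Rightarrow> 'a \<Rightarrow> 'a \<Rightarrow> real" where
  "rdir x b y = ((y - x) \<bullet> b) * norm (x - y) powr (-1)"

text \<open>The amplitude that multiplies \<open>\<kappa>\<close> when \<open>\<zeta>\<close> times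
  the wave \<open>osc\<close> is differentiated along \<open>b\<close>.\<close>

definition rmult :: "'a::euclidean_space \<Rightarrow> 'a \<Rightarrow> ('a \<Rightarrow> complex) \<Rightarrow> 'a \<Rightarrow> complex" where
  "rmult x b \<zeta> y = \<i> * complex_of_real (rdir x b y) * \<zeta> y"

lemma smooth_on_osc: "smooth_on (- {x}) (osc x \<kappa>)"
proof -
  have "smooth_on (- {x}) (\<lambda>y. exp ((\<i> * \<kappa>) * complex_of_real (norm (x - y))))"
    by (intro smooth_on_exp smooth_on_mult smooth_on_const smooth_on_of_real smooth_on_dist) auto
  then show ?thesis by (simp add: osc_def[abs_def])
qed

lemma smooth_on_rdir: "smooth_on (- {x}) (rdir x b)"
proof -
  have "smooth_on (- {x}) (\<lambda>y. y - x)"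
    by (rule smooth_on_diff[OF _ smooth_on_bounded_linear[OF bounded_linear_ident] smooth_on_const]) auto
  from smooth_on_mult[OF _ smooth_on_bilinear[OF bounded_bilinear_inner _ this smooth_on_const] smooth_on_dist_powr]
  show ?thesis unfolding rdir_def[abs_def] by blast
qed

lemma test_function_osc: "test_function (- {x}) \<zeta> \<Longrightarrow> test_function (- {x}) (\<lambda>y. \<zeta> y * osc x \<kappa> y)"
  using test_function_mult_smooth_on[OF _ smooth_on_osc, of x \<zeta> \<kappa>] by (simp add: mult.commute open_Compl)

lemma test_function_rmult: "test_function (- {x}) \<zeta> \<Longrightarrow> test_function (- {x}) (rmult x b \<zeta>)"
  unfolding rmult_def[abs_def]
  by (intro test_function_mult_smooth_on smooth_on_mult smooth_on_const smooth_on_of_real smooth_on_rdir) auto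

lemma dist_has_derivative:
  fixes x y :: "'a::euclidean_space"
  assumes "y \<noteq> x"
  shows "((\<lambda>y. norm (x - y)) has_derivative (\<lambda>v. rdir x v y)) (at y)"
proof -
  have "((\<lambda>y. norm (x - y)) has_derivative (\<lambda>v. (- v) \<bullet> sgn (x - y))) (at y)"
    by (rule has_derivative_compose[OF _ has_derivative_norm]) (use assms in \<open>auto intro!: derivative_eq_intros\<close>)
  moreover have "(- v) \<bullet> sgn (x - y) = rdir x v y" for v
  proof -
    have "sgn (x - y) = (- inverse (norm (x - y))) *\<^sub>R (y - x)"
      unfolding sgn_div_norm by (simp add: scaleR_diff_right)
    then show ?thesis by (simp add: rdir_def powr_minus inner_commute)
  qed
  ultimately show ?thesis by simp
qed

lemma osc_has_derivative:
  assumes "y \<noteq> x"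
  shows "(osc x \<kappa> has_derivative (\<lambda>v. \<i> * \<kappa> * complex_of_real (rdir x v y) * osc x \<kappa> y)) (at y)"
proof -
  have "((\<lambda>y. \<i> * \<kappa> * complex_of_real (norm (x - y))) has_derivative (\<lambda>v. \<i> * \<kappa> * complex_of_real (rdir x v y))) (at y)"
    by (intro has_derivative_mult_right has_derivative_of_real dist_has_derivative assms)
  moreover have "(exp has_derivative (\<lambda>v. v * exp z)) (at z)" for z :: complex
    using DERIV_exp[of z] by (simp add: has_field_derivative_def mult_commute_abs)
  ultimately show ?thesis unfolding osc_def[abs_def] by (rule has_derivative_compose)
qed

lemma dir_deriv_osc:
  fixes x :: "'a::euclidean_space"
  assumes z: "test_function (- {x}) \<zeta>" and b: "b \<in> Basis"
  shows "dir_deriv b (\<lambda>y. \<zeta> y * osc x \<kappa> y) y = dir_deriv b \<zeta> y * osc x \<kappa> y + \<kappa> * (rmult x b \<zeta> y * osc x \<kappa> y)"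
proof (cases "y = x")
  \<comment> \<open>The distance is not differentiable at \<open>x\<close>, but
    \<open>\<zeta>\<close> vanishes in a neighbourhood of \<open>x\<close>, so both sides are
    0.\<close>
  case True
  obtain K where K: "compact K" "K \<subseteq> - {x}" "\<And>y. y \<notin> K \<Longrightarrow> \<zeta> y = 0" using z by (rule test_functionE) blast
  then have x: "x \<notin> K" by blast
  have "dir_deriv b (\<lambda>y. \<zeta> y * osc x \<kappa> y) x = 0" "dir_deriv b \<zeta> x = 0" "\<zeta> x = 0"
    using K(3) x by (auto intro!: dir_deriv_zero_outside[OF K(1)])
  then show ?thesis using True by (simp add: rmult_def)
next
  case False
  have "(\<zeta> has_derivative (\<lambda>v. dir_deriv v \<zeta> y)) (at y)"
    using smooth_on_has_derivative[OF test_function_smooth[OF z]] by auto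
  from dir_deriv_eq[OF has_derivative_mult[OF this osc_has_derivative[OF False, of \<kappa>]]]
  show ?thesis by (simp add: rmult_def algebra_simps)
qed

definition oscF :: "'a::euclidean_space \<Rightarrow> complex \<Rightarrow> ('a \<Rightarrow> complex) \<Rightarrow> 'a \<Rightarrow> complex" where
  "oscF x \<kappa> \<zeta> \<xi> = cft (\<lambda>y. \<zeta> y * osc x \<kappa> y) \<xi>"

lemma oscF_add:
  assumes "test_function (- {x}) f" "test_function (- {x}) g"
  shows "oscF x \<kappa> (\<lambda>y. f y + g y) \<xi> = oscF x \<kappa> f \<xi> + oscF x \<kappa> g \<xi>"
  unfolding oscF_def distrib_right
  by (rule cft_add) (use assms test_function_osc test_function_integrable in blast)+

lemma oscF_zero: "oscF x \<kappa> (\<lambda>y. 0) \<xi> = 0"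
  by (simp add: oscF_def cft_def)

lemma oscF_sum:
  "(\<And>i. i \<in> I \<Longrightarrow> test_function (- {x}) (f i)) \<Longrightarrow>
    oscF x \<kappa> (\<lambda>y. \<Sum>i\<in>I. f i y) \<xi> = (\<Sum>i\<in>I. oscF x \<kappa> (f i) \<xi>)"
  by (induction I rule: infinite_finite_induct) (auto simp: oscF_zero oscF_add test_function_sum)

lemma oscF_cmult: "oscF x \<kappa> (\<lambda>y. c * f y) \<xi> = c * oscF x \<kappa> f \<xi>"
  unfolding oscF_def mult.assoc by (rule cft_cmult)

text \<open>A frequency factor is traded for a change of amplitude. The new amplitudes are again
  test functions supported off \<open>x\<close>, so the identity can be iterated.\<close>

lemma oscF_dir:
  fixes x :: "'a::euclidean_space"
  assumes z: "test_function (- {x}) \<zeta>" and b: "b \<in> Basis"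
  shows "- \<i> * complex_of_real (\<xi> \<bullet> b) * oscF x \<kappa> \<zeta> \<xi> = oscF x \<kappa> (dir_deriv b \<zeta>) \<xi> + \<kappa> * oscF x \<kappa> (rmult x b \<zeta>) \<xi>"
proof -
  have i: "integrable lborel (\<lambda>y. dir_deriv b \<zeta> y * osc x \<kappa> y)" "integrable lborel (\<lambda>y. rmult x b \<zeta> y * osc x \<kappa> y)"
    using test_function_integrable(1)[OF test_function_osc] test_function_dir_deriv[OF z b] test_function_rmult[OF z] by blast+
  have "test_function UNIV (\<lambda>y. \<zeta> y * osc x \<kappa> y)"
    using test_function_mono[OF test_function_osc[OF z]] by blast
  from cft_dir_deriv[OF this b, of \<xi>, symmetric]
  show ?thesis unfolding oscF_def dir_deriv_osc[OF z b]
    using i by (subst (asm) cft_add) (auto simp: cft_cmult)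
qed

text \<open>The Laplacian of the amplitude: the part of the Laplacian of \<open>\<zeta>\<close>
  times \<open>osc\<close> that is free of \<open>\<kappa>\<close>.\<close>

definition osc_lower0 :: "'a::euclidean_space \<Rightarrow> ('a \<Rightarrow> complex) \<Rightarrow> 'a \<Rightarrow> complex" where
  "osc_lower0 x \<zeta> y = (\<Sum>b\<in>Basis. dir_deriv b (dir_deriv b \<zeta>) y)"

text \<open>The part linear in \<open>\<kappa>\<close>: away from x, with \<rho> the distance to x,
  it is i (2 grad \<rho> . grad \<zeta> + \<zeta> Laplace \<rho>), the transport operator of
  geometric optics.\<close>

definition osc_lower1 :: "'a::euclidean_space \<Rightarrow> ('a \<Rightarrow> complex) \<Rightarrow> 'a \<Rightarrow> complex" where
  "osc_lower1 x \<zeta> y = (\<Sum>b\<in>Basis. rmult x b (dir_deriv b \<zeta>) y + dir_deriv b (rmult x b \<zeta>) y)"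

lemma test_function_osc_lower:
  assumes z: "test_function (- {x}) \<zeta>"
  shows "test_function (- {x}) (osc_lower0 x \<zeta>)" "test_function (- {x}) (osc_lower1 x \<zeta>)"
  unfolding osc_lower0_def[abs_def] osc_lower1_def[abs_def]
  by (intro test_function_sum test_function_add test_function_dir_deriv test_function_rmult z; assumption)+

text \<open>
  The quadratic terms in \<open>\<kappa>\<close> produced by \<open>\<Delta> (\<zeta> e\<^sup>i\<^sup>\<kappa>\<^sup>\<rho>)\<close> add up to \<open>- \<kappa>\<^sup>2 \<zeta> e\<^sup>i\<^sup>\<kappa>\<^sup>\<rho>\<close> because the gradient of the distance
  is a unit vector. Hence \<open>\<bar>\<xi>\<bar>\<^sup>2 - \<kappa>\<^sup>2\<close> gains one power of \<open>\<kappa>\<close>.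
\<close>

lemma oscF_helmholtz:
  fixes x :: "'a::euclidean_space"
  assumes z: "test_function (- {x}) \<zeta>"
  shows "(\<kappa>\<^sup>2 - complex_of_real ((norm \<xi>)\<^sup>2)) * oscF x \<kappa> \<zeta> \<xi> =
    oscF x \<kappa> (osc_lower0 x \<zeta>) \<xi> + \<kappa> * oscF x \<kappa> (osc_lower1 x \<zeta>) \<xi>"
proof -
  let ?F = "\<lambda>\<zeta>. oscF x \<kappa> \<zeta> \<xi>"
  note t = test_function_dir_deriv test_function_rmult z
  have step: "- complex_of_real ((\<xi> \<bullet> b)\<^sup>2) * ?F \<zeta> = ?F (dir_deriv b (dir_deriv b \<zeta>)) +
     \<kappa> * ?F (\<lambda>y. rmult x b (dir_deriv b \<zeta>) y + dir_deriv b (rmult x b \<zeta>) y) + \<kappa>\<^sup>2 * ?F (rmult x b (rmult x b \<zeta>))"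
    if b: "b \<in> Basis" for b
  proof -
    let ?c = "- \<i> * complex_of_real (\<xi> \<bullet> b)"
    have "- complex_of_real ((\<xi> \<bullet> b)\<^sup>2) * ?F \<zeta> = ?c * (?c * ?F \<zeta>)"
      unfolding mult.assoc[symmetric] by (simp add: complex_eq_iff power2_eq_square)
    also have "\<dots> = ?c * ?F (dir_deriv b \<zeta>) + \<kappa> * (?c * ?F (rmult x b \<zeta>))"
      unfolding oscF_dir[OF z b] by (simp only: distrib_left mult.left_commute)
    also have "\<dots> = (?F (dir_deriv b (dir_deriv b \<zeta>)) + \<kappa> * ?F (rmult x b (dir_deriv b \<zeta>))) +
       \<kappa> * (?F (dir_deriv b (rmult x b \<zeta>)) + \<kappa> * ?F (rmult x b (rmult x b \<zeta>)))"
      unfolding oscF_dir[OF test_function_dir_deriv[OF z b] b] oscF_dir[OF test_function_rmult[OF z] b] ..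
    finally show ?thesis
      using b by (subst oscF_add) (auto intro!: t simp: algebra_simps power2_eq_square)
  qed
  have "(\<Sum>b\<in>Basis. ?F (rmult x b (rmult x b \<zeta>))) = ?F (\<lambda>y. \<Sum>b\<in>Basis. rmult x b (rmult x b \<zeta>) y)"
    by (rule oscF_sum[symmetric]) (intro t)
  also have "(\<lambda>y. \<Sum>b\<in>Basis. rmult x b (rmult x b \<zeta>) y) = (\<lambda>y. (-1) * \<zeta> y)"
  proof
    fix y
    show "(\<Sum>b\<in>Basis. rmult x b (rmult x b \<zeta>) y) = (-1) * \<zeta> y"
    proof (cases "y = x")
      case True
      have "\<zeta> x = 0" using z by (rule test_functionE) blast
      then show ?thesis using True by (simp add: rmult_def)
    next
      case False
      have "(\<Sum>b\<in>Basis. (rdir x b y)\<^sup>2) = (norm (x - y) powr (-1))\<^sup>2 * (\<Sum>b\<in>Basis. ((y - x) \<bullet> b)\<^sup>2)"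
        unfolding rdir_def power_mult_distrib sum_distrib_left by (simp add: mult.commute)
      also have "(\<Sum>b\<in>Basis. ((y - x) \<bullet> b)\<^sup>2) = (norm (x - y))\<^sup>2"
        using euclidean_inner[of "y - x" "y - x"] dot_square_norm[of "y - x"]
        by (simp add: power2_eq_square norm_minus_commute)
      finally have "(\<Sum>b\<in>Basis. (rdir x b y)\<^sup>2) = 1"
        using False by (simp add: powr_minus power_inverse)
      then have sc: "(\<Sum>b\<in>Basis. complex_of_real ((rdir x b y)\<^sup>2)) = 1"
        unfolding of_real_sum[symmetric] by (simp only: of_real_1)
      have "rmult x b (rmult x b \<zeta>) y = - complex_of_real ((rdir x b y)\<^sup>2) * \<zeta> y" for b
        unfolding rmult_def mult.assoc[symmetric] by (simp add: complex_eq_iff power2_eq_square)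
      then show ?thesis by (simp only: mult_minus_left sum_negf sum_distrib_right[symmetric] sc)
    qed
  qed
  finally have s: "(\<Sum>b\<in>Basis. ?F (rmult x b (rmult x b \<zeta>))) = - ?F \<zeta>" by (simp only: oscF_cmult) simp
  have "complex_of_real ((norm \<xi>)\<^sup>2) = (\<Sum>b\<in>Basis. complex_of_real ((\<xi> \<bullet> b)\<^sup>2))"
    using euclidean_inner[of \<xi> \<xi>] dot_square_norm[of \<xi>] by (simp add: power2_eq_square flip: of_real_sum of_real_mult)
  then have "- complex_of_real ((norm \<xi>)\<^sup>2) * ?F \<zeta> = (\<Sum>b\<in>Basis. - complex_of_real ((\<xi> \<bullet> b)\<^sup>2) * ?F \<zeta>)"
    by (simp add: sum_distrib_right sum_negf)
  also have "\<dots> = (\<Sum>b\<in>Basis. ?F (dir_deriv b (dir_deriv b \<zeta>)) +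
     \<kappa> * ?F (\<lambda>y. rmult x b (dir_deriv b \<zeta>) y + dir_deriv b (rmult x b \<zeta>) y) + \<kappa>\<^sup>2 * ?F (rmult x b (rmult x b \<zeta>)))"
    by (rule sum.cong[OF refl step])
  also have "\<dots> = ?F (osc_lower0 x \<zeta>) + \<kappa> * ?F (osc_lower1 x \<zeta>) - \<kappa>\<^sup>2 * ?F \<zeta>"
  proof -
    have "?F (osc_lower0 x \<zeta>) = (\<Sum>b\<in>Basis. ?F (dir_deriv b (dir_deriv b \<zeta>)))"
      unfolding osc_lower0_def[abs_def] by (rule oscF_sum) (intro t; assumption)
    moreover have "?F (osc_lower1 x \<zeta>) = (\<Sum>b\<in>Basis. ?F (\<lambda>y. rmult x b (dir_deriv b \<zeta>) y + dir_deriv b (rmult x b \<zeta>) y))"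
      unfolding osc_lower1_def[abs_def] by (rule oscF_sum) (intro t test_function_add; assumption)
    ultimately show ?thesis by (simp add: sum.distrib sum_distrib_left[symmetric] s)
  qed
  finally show ?thesis by (simp add: algebra_simps)
qed

text \<open>Encodes an error that is O(1) in L^2 of the frequency, uniformly in
  \<open>k \<ge> 1\<close>. Estimates stay pointwise in \<open>\<xi>\<close>, with such a family as
  majorant, and are integrated only at the end.\<close>

definition L2_family :: "(real \<Rightarrow> 'a::euclidean_space \<Rightarrow> real) \<Rightarrow> bool" where
  "L2_family R \<longleftrightarrow> (\<forall>k. R k \<in> borel_measurable borel) \<and> (\<forall>k \<xi>. 0 \<le> R k \<xi>) \<and>
     (\<exists>C. \<forall>k\<ge>1. (\<integral>\<^sup>+\<xi>. ennreal ((R k \<xi>)\<^sup>2) \<partial>lborel) \<le> ennreal C)"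

lemma L2_familyD:
  assumes "L2_family R"
  shows "R k \<in> borel_measurable borel" "0 \<le> R k \<xi>"
  using assms by (auto simp: L2_family_def)

lemma L2_familyE:
  assumes "L2_family R"
  obtains C where "C \<ge> 0" "\<And>k. k \<ge> 1 \<Longrightarrow> (\<integral>\<^sup>+\<xi>. ennreal ((R k \<xi>)\<^sup>2) \<partial>lborel) \<le> ennreal C"
proof -
  obtain C where C: "\<And>k. k \<ge> 1 \<Longrightarrow> (\<integral>\<^sup>+\<xi>. ennreal ((R k \<xi>)\<^sup>2) \<partial>lborel) \<le> ennreal C"
    using assms unfolding L2_family_def by blast
  show ?thesis
  proof (rule that[of "max 0 C"])
    fix k :: real assume "k \<ge> 1"
    then show "(\<integral>\<^sup>+\<xi>. ennreal ((R k \<xi>)\<^sup>2) \<partial>lborel) \<le> ennreal (max 0 C)"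
      using order_trans[OF C ennreal_leI[of C "max 0 C"]] by simp
  qed simp
qed

lemma L2_family_add:
  assumes "L2_family R" "L2_family S" shows "L2_family (\<lambda>k \<xi>. R k \<xi> + S k \<xi>)"
  unfolding L2_family_def
proof (intro conjI allI)
  note [measurable] = L2_familyD(1)[OF assms(1)] L2_familyD(1)[OF assms(2)]
  show "(\<lambda>\<xi>. R k \<xi> + S k \<xi>) \<in> borel_measurable borel" for k by measurable
  show "0 \<le> R k \<xi> + S k \<xi>" for k \<xi> using assms[THEN L2_familyD(2)] by simp
  obtain C where C: "C \<ge> 0" "\<And>k. k \<ge> 1 \<Longrightarrow> (\<integral>\<^sup>+\<xi>. ennreal ((R k \<xi>)\<^sup>2) \<partial>lborel) \<le> ennreal C"
    using assms(1) by (rule L2_familyE) blast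
  obtain D where D: "D \<ge> 0" "\<And>k. k \<ge> 1 \<Longrightarrow> (\<integral>\<^sup>+\<xi>. ennreal ((S k \<xi>)\<^sup>2) \<partial>lborel) \<le> ennreal D"
    using assms(2) by (rule L2_familyE) blast
  have "(\<integral>\<^sup>+\<xi>. ennreal ((R k \<xi> + S k \<xi>)\<^sup>2) \<partial>lborel) \<le> ennreal (2 * C + 2 * D)" if k: "k \<ge> 1" for k
  proof -
    have "(\<integral>\<^sup>+\<xi>. ennreal ((R k \<xi> + S k \<xi>)\<^sup>2) \<partial>lborel) \<le>
      (\<integral>\<^sup>+\<xi>. ennreal 2 * ennreal ((R k \<xi>)\<^sup>2) + ennreal 2 * ennreal ((S k \<xi>)\<^sup>2) \<partial>lborel)"
    proof (intro nn_integral_mono)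
      fix \<xi>
      have "(R k \<xi> + S k \<xi>)\<^sup>2 \<le> 2 * (R k \<xi>)\<^sup>2 + 2 * (S k \<xi>)\<^sup>2"
        using sum_squares_bound[of "R k \<xi>" "S k \<xi>"] by (simp add: power2_sum)
      then have "ennreal ((R k \<xi> + S k \<xi>)\<^sup>2) \<le> ennreal (2 * (R k \<xi>)\<^sup>2 + 2 * (S k \<xi>)\<^sup>2)" by (rule ennreal_leI)
      then show "ennreal ((R k \<xi> + S k \<xi>)\<^sup>2) \<le> ennreal 2 * ennreal ((R k \<xi>)\<^sup>2) + ennreal 2 * ennreal ((S k \<xi>)\<^sup>2)"
        by (simp only: ennreal_mult[symmetric] ennreal_plus[symmetric] zero_le_power2 mult_nonneg_nonneg zero_le_numeral)
    qed
    also have "\<dots> = ennreal 2 * (\<integral>\<^sup>+\<xi>. ennreal ((R k \<xi>)\<^sup>2) \<partial>lborel) + ennreal 2 * (\<integral>\<^sup>+\<xi>. ennreal ((S k \<xi>)\<^sup>2) \<partial>lborel)"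
      by (subst nn_integral_add) (auto simp: nn_integral_cmult)
    also have "\<dots> \<le> ennreal 2 * ennreal C + ennreal 2 * ennreal D"
      using C(2)[OF k] D(2)[OF k] by (intro add_mono mult_left_mono) auto
    also have "\<dots> = ennreal (2 * C + 2 * D)"
      using C(1) D(1) by (simp only: ennreal_mult[symmetric] ennreal_plus[symmetric] mult_nonneg_nonneg zero_le_numeral)
    finally show ?thesis .
  qed
  then show "\<exists>C. \<forall>k\<ge>1. (\<integral>\<^sup>+\<xi>. ennreal ((R k \<xi> + S k \<xi>)\<^sup>2) \<partial>lborel) \<le> ennreal C" by blast
qed

lemma L2_family_cmult:
  assumes "L2_family R" "c \<ge> 0" shows "L2_family (\<lambda>k \<xi>. c * R k \<xi>)"
  unfolding L2_family_def
proof (intro conjI allI)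
  note [measurable] = L2_familyD(1)[OF assms(1)]
  show "(\<lambda>\<xi>. c * R k \<xi>) \<in> borel_measurable borel" for k by measurable
  show "0 \<le> c * R k \<xi>" for k \<xi> using L2_familyD(2)[OF assms(1)] assms(2) by simp
  obtain C where C: "C \<ge> 0" "\<And>k. k \<ge> 1 \<Longrightarrow> (\<integral>\<^sup>+\<xi>. ennreal ((R k \<xi>)\<^sup>2) \<partial>lborel) \<le> ennreal C"
    using assms(1) by (rule L2_familyE) blast
  have "(\<integral>\<^sup>+\<xi>. ennreal ((c * R k \<xi>)\<^sup>2) \<partial>lborel) \<le> ennreal (c\<^sup>2 * C)" if k: "k \<ge> 1" for k
  proof -
    have "(\<integral>\<^sup>+\<xi>. ennreal ((c * R k \<xi>)\<^sup>2) \<partial>lborel) = ennreal (c\<^sup>2) * (\<integral>\<^sup>+\<xi>. ennreal ((R k \<xi>)\<^sup>2) \<partial>lborel)"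
      by (simp add: power_mult_distrib ennreal_mult nn_integral_cmult)
    also have "\<dots> \<le> ennreal (c\<^sup>2) * ennreal C" using C(2)[OF k] by (intro mult_left_mono) auto
    finally show ?thesis using C(1) by (simp add: ennreal_mult)
  qed
  then show "\<exists>C. \<forall>k\<ge>1. (\<integral>\<^sup>+\<xi>. ennreal ((c * R k \<xi>)\<^sup>2) \<partial>lborel) \<le> ennreal C" by blast
qed

section \<open>Frequency estimates for oscillating amplitudes\<close>

lemma norm_osc_le_1: "Im \<kappa> \<ge> 0 \<Longrightarrow> norm (osc x \<kappa> y) \<le> 1"
  by (simp add: osc_def)

text \<open>Mean value theorem on the half-line from 1/4, at whose endpoint the derivative is
  largest; this gives the constant. The bound 1/4 is the square of 1/2: the argument will be
  (|\<xi>|/k)^2 with |\<xi>| > k/2.\<close>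

lemma powr_minus_one_bound:
  fixes t s :: real
  assumes "t \<ge> 1/4" "s > 0"
  shows "\<bar>t powr (- s) - 1\<bar> \<le> s * 4 powr (s + 1) * \<bar>t - 1\<bar>"
proof -
  have "norm (t powr (- s) - 1 powr (- s)) \<le> s * 4 powr (s + 1) * norm (t - 1)"
  proof (rule field_differentiable_bound[where S="{1/4..}"])
    fix z :: real assume z: "z \<in> {1/4..}"
    show "((\<lambda>t. t powr (- s)) has_field_derivative (- s) * z powr (- s - 1)) (at z within {1/4..})"
      using z by (intro has_field_derivative_at_within[OF has_real_derivative_powr]) auto
    have "z powr (- s - 1) \<le> (1/4) powr (- s - 1)" using z assms by (intro powr_mono2') auto
    also have "(1/4::real) powr (- s - 1) = 4 powr (s + 1)"
      by (simp add: powr_def ln_div algebra_simps)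
    finally show "norm (- s * z powr (- s - 1)) \<le> s * 4 powr (s + 1)" using assms by (simp add: abs_mult)
  qed (use assms in auto)
  then show ?thesis by simp
qed

text \<open>The estimates see the wave number only through its square and the sign of its imaginary
  part. The range \<open>k \<ge> 1\<close> makes
  \<open>k * \<sigma> \<le> k\<^sup>2 * \<sigma>\<close>, whence a linear bound for
  \<open>\<kappa>\<close>.\<close>

locale damped_wave =
  fixes x :: "'a::euclidean_space" and \<kappa> :: "real \<Rightarrow> complex" and \<sigma> :: real
  assumes sigma: "\<sigma> \<ge> 0"
    and kappa_square: "\<And>k. k \<ge> 1 \<Longrightarrow> (\<kappa> k)\<^sup>2 = complex_of_real (k\<^sup>2) + \<i> * complex_of_real (k * \<sigma>)"
    and kappa_Im: "\<And>k. k \<ge> 1 \<Longrightarrow> Im (\<kappa> k) \<ge> 0"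
begin

abbreviation "F \<equiv> \<lambda>k \<zeta> \<xi>. oscF x (\<kappa> k) \<zeta> \<xi>"

lemma norm_kappa_le: assumes "k \<ge> 1" shows "norm (\<kappa> k) \<le> (1 + \<sigma>) * k"
proof (rule power2_le_imp_le)
  have "(norm (\<kappa> k))\<^sup>2 = norm (complex_of_real (k\<^sup>2) + \<i> * complex_of_real (k * \<sigma>))"
    using kappa_square[OF assms] by (simp add: norm_power[symmetric])
  also have "\<dots> \<le> k\<^sup>2 + k * \<sigma>"
    using norm_triangle_ineq[of "complex_of_real (k\<^sup>2)" "\<i> * complex_of_real (k * \<sigma>)"] assms sigma
    by (simp add: norm_mult norm_power)
  also have "\<dots> \<le> ((1 + \<sigma>) * k)\<^sup>2"
  proof -
    have "k * \<sigma> \<le> k\<^sup>2 * \<sigma>" using assms sigma by (intro mult_right_mono) (auto simp: power2_eq_square)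
    moreover have "0 \<le> k\<^sup>2 * \<sigma>" "0 \<le> k\<^sup>2 * \<sigma>\<^sup>2" using sigma by simp_all
    moreover have "((1 + \<sigma>) * k)\<^sup>2 = k\<^sup>2 + 2 * (k\<^sup>2 * \<sigma>) + k\<^sup>2 * \<sigma>\<^sup>2" by (simp add: power2_eq_square algebra_simps)
    ultimately show ?thesis by linarith
  qed
  finally show "(norm (\<kappa> k))\<^sup>2 \<le> ((1 + \<sigma>) * k)\<^sup>2" .
qed (use assms sigma in simp)

lemma oscF_measurable: "test_function (- {x}) \<zeta> \<Longrightarrow> F k \<zeta> \<in> borel_measurable borel"
  unfolding oscF_def[abs_def] by (intro cft_measurable test_function_measurable[OF test_function_osc])

text \<open>As the wave has modulus at most 1, Plancherel's inequality bounds all members by the L^2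
  norm of \<open>\<zeta>\<close> alone.\<close>

lemma oscF_L2_family:
  assumes z: "test_function (- {x}) \<zeta>"
  shows "L2_family (\<lambda>k \<xi>. norm (F k \<zeta> \<xi>))"
  unfolding L2_family_def
proof (intro conjI allI)
  note [measurable] = oscF_measurable[OF z]
  show "(\<lambda>\<xi>. norm (F k \<zeta> \<xi>)) \<in> borel_measurable borel" for k by measurable
  have "(\<integral>\<^sup>+\<xi>. ennreal ((norm (F k \<zeta> \<xi>))\<^sup>2) \<partial>lborel) \<le> ennreal ((2 * pi) ^ DIM('a) * (LINT y|lborel. (norm (\<zeta> y))\<^sup>2))"
    if k: "k \<ge> 1" for k
  proof -
    note i = test_function_integrable[OF test_function_osc[OF z, of "\<kappa> k"]]
    have "(LINT y|lborel. (norm (\<zeta> y * osc x (\<kappa> k) y))\<^sup>2) \<le> (LINT y|lborel. (norm (\<zeta> y))\<^sup>2)"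
    proof (rule Bochner_Integration.integral_mono[OF i(2) test_function_integrable(2)[OF z]])
      fix y
      show "(norm (\<zeta> y * osc x (\<kappa> k) y))\<^sup>2 \<le> (norm (\<zeta> y))\<^sup>2"
        using norm_osc_le_1[OF kappa_Im[OF k], of x y] by (intro power_mono) (auto simp: norm_mult mult_left_le)
    qed
    then show ?thesis using cft_L2_bound[OF i] unfolding oscF_def
      by (elim order_trans) (intro ennreal_leI mult_left_mono; simp)
  qed
  then show "\<exists>C. \<forall>k\<ge>1. (\<integral>\<^sup>+\<xi>. ennreal ((norm (F k \<zeta> \<xi>))\<^sup>2) \<partial>lborel) \<le> ennreal C" by blast
qed simp

text \<open>Damping only adds an imaginary part to \<open>(\<kappa> k)\<^sup>2\<close>, so the
  complex factor in \<open>oscF_helmholtz\<close> is at least as large as its real part, the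
  difference of \<open>k\<^sup>2\<close> and the squared frequency.\<close>

lemma oscF_helmholtz_norm:
  assumes z: "test_function (- {x}) \<zeta>" and k: "k \<ge> 1"
  shows "\<bar>(norm \<xi>)\<^sup>2 - k\<^sup>2\<bar> * norm (F k \<zeta> \<xi>) \<le>
    k * ((1 + \<sigma>) * (norm (F k (osc_lower0 x \<zeta>) \<xi>) + norm (F k (osc_lower1 x \<zeta>) \<xi>)))"
proof -
  have "Re ((\<kappa> k)\<^sup>2 - complex_of_real ((norm \<xi>)\<^sup>2)) = k\<^sup>2 - (norm \<xi>)\<^sup>2"
    using kappa_square[OF k] by simp
  then have "\<bar>(norm \<xi>)\<^sup>2 - k\<^sup>2\<bar> \<le> norm ((\<kappa> k)\<^sup>2 - complex_of_real ((norm \<xi>)\<^sup>2))"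
    using abs_Re_le_cmod[of "(\<kappa> k)\<^sup>2 - complex_of_real ((norm \<xi>)\<^sup>2)"] by (simp add: abs_minus_commute)
  then have "\<bar>(norm \<xi>)\<^sup>2 - k\<^sup>2\<bar> * norm (F k \<zeta> \<xi>) \<le> norm (((\<kappa> k)\<^sup>2 - complex_of_real ((norm \<xi>)\<^sup>2)) * F k \<zeta> \<xi>)"
    unfolding norm_mult by (intro mult_right_mono) auto
  also have "\<dots> \<le> norm (F k (osc_lower0 x \<zeta>) \<xi>) + norm (\<kappa> k) * norm (F k (osc_lower1 x \<zeta>) \<xi>)"
    unfolding oscF_helmholtz[OF z] using norm_triangle_ineq by (metis norm_mult)
  also have "\<dots> \<le> ((1 + \<sigma>) * k) * norm (F k (osc_lower0 x \<zeta>) \<xi>) + ((1 + \<sigma>) * k) * norm (F k (osc_lower1 x \<zeta>) \<xi>)"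
  proof (intro add_mono mult_right_mono norm_kappa_le k norm_ge_zero)
    have "1 \<le> (1 + \<sigma>) * k" using k sigma mult_mono[of 1 "1 + \<sigma>" 1 k] by simp
    then show "norm (F k (osc_lower0 x \<zeta>) \<xi>) \<le> ((1 + \<sigma>) * k) * norm (F k (osc_lower0 x \<zeta>) \<xi>)"
      using mult_right_mono[of 1 "(1 + \<sigma>) * k" "norm (F k (osc_lower0 x \<zeta>) \<xi>)"] by simp
  qed
  finally show ?thesis by (simp add: algebra_simps)
qed

text \<open>Since | |\<xi>|^2 - k^2 | is at least k | |\<xi>| - k |, this says that the L^2 mass
  concentrates around the sphere of radius k on a length scale independent of k.\<close>

lemma oscF_concentration:
  assumes z: "test_function (- {x}) \<zeta>"
  obtains R where "L2_family R" "\<And>k \<xi>. k \<ge> 1 \<Longrightarrow> \<bar>(norm \<xi>)\<^sup>2 - k\<^sup>2\<bar> * norm (F k \<zeta> \<xi>) \<le> k * R k \<xi>"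
  by (rule that[OF _ oscF_helmholtz_norm[OF z]])
    (intro L2_family_cmult L2_family_add oscF_L2_family test_function_osc_lower z, use sigma in auto)

text \<open>For |\<xi>| \<le> k/2 the Helmholtz factor is at least 3/4 of \<open>k\<^sup>2\<close>,
  while the right side carries one power of \<open>k\<close>, so every application gains 1/k. It
  replaces \<open>\<zeta>\<close> by the two lower amplitudes, hence the induction over all
  \<open>\<zeta>\<close>.\<close>

lemma oscF_low_frequency:
  assumes "test_function (- {x}) \<zeta>"
  shows "\<exists>R. L2_family R \<and> (\<forall>k\<ge>1. \<forall>\<xi>. norm \<xi> \<le> k / 2 \<longrightarrow> k ^ n * norm (F k \<zeta> \<xi>) \<le> R k \<xi>)"
  using assms
proof (induction n arbitrary: \<zeta>)
  case 0 then show ?case using oscF_L2_family by auto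
next
  case (Suc n)
  obtain R0 where R0: "L2_family R0" "\<And>k \<xi>. k \<ge> 1 \<Longrightarrow> norm \<xi> \<le> k / 2 \<Longrightarrow> k ^ n * norm (F k (osc_lower0 x \<zeta>) \<xi>) \<le> R0 k \<xi>"
    using Suc.IH[OF test_function_osc_lower(1)[OF Suc.prems]] by blast
  obtain R1 where R1: "L2_family R1" "\<And>k \<xi>. k \<ge> 1 \<Longrightarrow> norm \<xi> \<le> k / 2 \<Longrightarrow> k ^ n * norm (F k (osc_lower1 x \<zeta>) \<xi>) \<le> R1 k \<xi>"
    using Suc.IH[OF test_function_osc_lower(2)[OF Suc.prems]] by blast
  let ?R = "\<lambda>k \<xi>. (4/3 * (1 + \<sigma>)) * (R0 k \<xi> + R1 k \<xi>)"
  have "L2_family ?R" using sigma by (intro L2_family_cmult L2_family_add R0 R1) auto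
  moreover have "k ^ Suc n * norm (F k \<zeta> \<xi>) \<le> ?R k \<xi>" if k: "k \<ge> 1" and xi: "norm \<xi> \<le> k / 2" for k \<xi>
  proof -
    let ?f = "norm (F k \<zeta> \<xi>)" let ?p = "norm (F k (osc_lower0 x \<zeta>) \<xi>)" let ?q = "norm (F k (osc_lower1 x \<zeta>) \<xi>)"
    have "(norm \<xi>)\<^sup>2 \<le> (k / 2)\<^sup>2" using xi by (intro power_mono) auto
    then have "(norm \<xi>)\<^sup>2 \<le> k\<^sup>2 / 4" by (simp add: power_divide)
    then have "3/4 * k\<^sup>2 \<le> \<bar>(norm \<xi>)\<^sup>2 - k\<^sup>2\<bar>" by linarith
    then have "3/4 * k\<^sup>2 * ?f \<le> \<bar>(norm \<xi>)\<^sup>2 - k\<^sup>2\<bar> * ?f" by (intro mult_right_mono) auto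
    also have "\<dots> \<le> k * ((1 + \<sigma>) * (?p + ?q))" by (rule oscF_helmholtz_norm[OF Suc.prems k])
    finally have "k * (3/4 * (k * ?f)) \<le> k * ((1 + \<sigma>) * (?p + ?q))" by (simp add: power2_eq_square mult_ac)
    then have "3/4 * (k * ?f) \<le> (1 + \<sigma>) * (?p + ?q)" using k by (subst (asm) mult_le_cancel_left_pos) auto
    then have "k * ?f \<le> (4/3 * (1 + \<sigma>)) * (?p + ?q)" unfolding mult.assoc by linarith
    then have "k ^ n * (k * ?f) \<le> k ^ n * ((4/3 * (1 + \<sigma>)) * (?p + ?q))" using k by (intro mult_left_mono) auto
    also have "\<dots> = (4/3 * (1 + \<sigma>)) * (k ^ n * ?p + k ^ n * ?q)" by (simp add: algebra_simps)
    also have "\<dots> \<le> ?R k \<xi>" using R0(2)[OF k xi] R1(2)[OF k xi] sigma by (intro mult_left_mono add_mono) auto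
    finally show ?thesis by (simp add: mult_ac)
  qed
  ultimately show ?case by blast
qed

text \<open>
  For \<open>\<bar>\<xi>\<bar> \<ge> k/2\<close> the factor \<open>\<bar>\<bar>\<xi>\<bar>\<^sup>2/k\<^sup>2 - 1\<bar>\<close> coming from the mean value theorem is absorbed by the concentration estimate.
\<close>

lemma oscF_multiplier:
  fixes m :: "'a \<Rightarrow> real"
  assumes z: "test_function (- {x}) \<zeta>" and s: "s > 0"
    and m: "\<And>\<xi>. \<bar>m \<xi>\<bar> \<le> Cm" "\<And>\<xi>. norm \<xi> \<ge> 1 \<Longrightarrow> m \<xi> = norm \<xi> powr (- 2 * s)"
  obtains R where "L2_family R" "\<And>k \<xi>. k \<ge> 2 \<Longrightarrow> \<bar>k powr (2 * s) * m \<xi> - 1\<bar> * norm (F k \<zeta> \<xi>) \<le> R k \<xi> / k"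
proof -
  \<comment> \<open>At low frequency only the crude bound \<open>k powr (2 * s) * (Cm + 1)\<close>
    is available for the deviation; decay of this order absorbs it and leaves a factor 1/k.\<close>
  obtain n :: nat where n: "2 * s + 1 \<le> n" using real_arch_simple by blast
  obtain R0 where R0: "L2_family R0" "\<And>k \<xi>. k \<ge> 1 \<Longrightarrow> norm \<xi> \<le> k / 2 \<Longrightarrow> k ^ n * norm (F k \<zeta> \<xi>) \<le> R0 k \<xi>"
    using oscF_low_frequency[OF z, of n] by blast
  obtain R1 where R1: "L2_family R1" "\<And>k \<xi>. k \<ge> 1 \<Longrightarrow> \<bar>(norm \<xi>)\<^sup>2 - k\<^sup>2\<bar> * norm (F k \<zeta> \<xi>) \<le> k * R1 k \<xi>"
    using oscF_concentration[OF z] by blast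
  have Cm: "Cm \<ge> 0" using order_trans[OF abs_ge_zero m(1)] .
  let ?c = "s * 4 powr (s + 1)"
  let ?R = "\<lambda>k \<xi>. (Cm + 1) * R0 k \<xi> + ?c * R1 k \<xi>"
  show ?thesis
  proof (rule that)
    show "L2_family ?R" using Cm s by (intro L2_family_add L2_family_cmult R0 R1) auto
    fix k :: real and \<xi> :: 'a
    assume k: "k \<ge> 2"
    let ?f = "norm (F k \<zeta> \<xi>)"
    have r0: "R0 k \<xi> \<ge> 0" and r1: "R1 k \<xi> \<ge> 0" using R0 R1 L2_familyD(2) by auto
    show "\<bar>k powr (2 * s) * m \<xi> - 1\<bar> * ?f \<le> ?R k \<xi> / k"
    proof (cases "norm \<xi> \<le> k / 2")
      case True
      have "1 \<le> k powr (2 * s)" using k s by (intro ge_one_powr_ge_zero) auto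
      then have "\<bar>k powr (2 * s) * m \<xi> - 1\<bar> \<le> k powr (2 * s) * \<bar>m \<xi>\<bar> + k powr (2 * s)"
        using abs_triangle_ineq4[of "k powr (2 * s) * m \<xi>" 1] by (simp add: abs_mult)
      also have "\<dots> \<le> k powr (2 * s) * (Cm + 1)" using m(1)[of \<xi>] by (simp add: distrib_left mult_left_mono)
      also have "\<dots> \<le> k powr (real n - 1) * (Cm + 1)" using n k Cm by (intro mult_right_mono powr_mono) auto
      also have "\<dots> = k ^ n * (Cm + 1) / k" using k by (simp add: powr_diff powr_realpow)
      finally have "\<bar>k powr (2 * s) * m \<xi> - 1\<bar> * ?f \<le> k ^ n * (Cm + 1) / k * ?f" by (intro mult_right_mono) auto
      also have "\<dots> = (Cm + 1) * (k ^ n * ?f) / k" by simp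
      also have "\<dots> \<le> (Cm + 1) * R0 k \<xi> / k" using R0(2)[of k \<xi>] True k Cm by (intro divide_right_mono mult_left_mono) auto
      also have "\<dots> \<le> ?R k \<xi> / k" using r1 k s by (intro divide_right_mono) auto
      finally show ?thesis .
    next
      case False
      then have xi: "norm \<xi> > k / 2" by simp
      let ?t = "(norm \<xi> / k)\<^sup>2"
      have "(1/2)\<^sup>2 \<le> ?t" using xi k by (intro power_mono) (auto simp: field_simps)
      then have t: "?t \<ge> 1/4" by (simp add: power2_eq_square)
      \<comment> \<open>Here \<open>k \<ge> 2\<close> is used: \<open>norm \<xi>\<close> exceeds 1,
        so \<open>m\<close> is the pure power and the product depends on \<open>?t\<close>
        only.\<close>
      have "k powr (2 * s) * m \<xi> = (norm \<xi> / k) powr (- 2 * s)"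
        using xi k m(2)[of \<xi>] by (simp add: powr_divide powr_minus field_simps)
      also have "\<dots> = ((norm \<xi> / k) powr 2) powr (- s)" by (simp add: powr_powr)
      also have "(norm \<xi> / k) powr 2 = ?t" using xi k by (intro powr_numeral) auto
      finally have "\<bar>k powr (2 * s) * m \<xi> - 1\<bar> \<le> ?c * \<bar>?t - 1\<bar>" using powr_minus_one_bound[OF t s] by simp
      also have "\<bar>?t - 1\<bar> = \<bar>(norm \<xi>)\<^sup>2 - k\<^sup>2\<bar> / k\<^sup>2"
      proof -
        have "?t - 1 = ((norm \<xi>)\<^sup>2 - k\<^sup>2) / k\<^sup>2" using k by (simp add: power_divide diff_divide_distrib)
        then show ?thesis by (simp add: abs_divide)
      qed
      finally have "\<bar>k powr (2 * s) * m \<xi> - 1\<bar> * ?f \<le> ?c * (\<bar>(norm \<xi>)\<^sup>2 - k\<^sup>2\<bar> / k\<^sup>2) * ?f" by (intro mult_right_mono) auto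
      also have "\<dots> = ?c * (\<bar>(norm \<xi>)\<^sup>2 - k\<^sup>2\<bar> * ?f) / k\<^sup>2" by simp
      also have "\<dots> \<le> ?c * (k * R1 k \<xi>) / k\<^sup>2" using R1(2)[of k \<xi>] k s by (intro divide_right_mono mult_left_mono) auto
      also have "\<dots> = ?c * R1 k \<xi> / k" using k by (simp add: power2_eq_square)
      also have "\<dots> \<le> ?R k \<xi> / k" using r0 k Cm by (intro divide_right_mono) auto
      finally show ?thesis .
    qed
  qed
qed

text \<open>Same splitting at |\<xi>| = k/2. Above it the weight gives
  \<open>2 powr (2 * s + 1) / k\<close> directly; below it the rapid decay compensates
  \<open>k powr (2 * s)\<close>.\<close>

lemma oscF_weight:
  assumes z: "test_function (- {x}) \<zeta>" and s: "s > 0"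
  obtains R where "L2_family R"
    "\<And>k \<xi>. k \<ge> 2 \<Longrightarrow> k powr (2 * s) * (1 + norm \<xi>) powr (- 2 * s - 1) * norm (F k \<zeta> \<xi>) \<le> R k \<xi> / k"
proof -
  obtain n :: nat where n: "2 * s + 1 \<le> n" using real_arch_simple by blast
  obtain R0 where R0: "L2_family R0" "\<And>k \<xi>. k \<ge> 1 \<Longrightarrow> norm \<xi> \<le> k / 2 \<Longrightarrow> k ^ n * norm (F k \<zeta> \<xi>) \<le> R0 k \<xi>"
    using oscF_low_frequency[OF z, of n] by blast
  let ?c = "2 powr (2 * s + 1)"
  let ?R = "\<lambda>k \<xi>. R0 k \<xi> + ?c * norm (F k \<zeta> \<xi>)"
  show ?thesis
  proof (rule that)
    show "L2_family ?R" by (intro L2_family_add L2_family_cmult R0 oscF_L2_family z) auto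
    fix k :: real and \<xi> :: 'a
    assume k: "k \<ge> 2"
    let ?f = "norm (F k \<zeta> \<xi>)"
    have r0: "R0 k \<xi> \<ge> 0" using R0 L2_familyD(2) by auto
    show "k powr (2 * s) * (1 + norm \<xi>) powr (- 2 * s - 1) * ?f \<le> ?R k \<xi> / k"
    proof (cases "norm \<xi> \<le> k / 2")
      case True
      have "(1 + norm \<xi>) powr (- 2 * s - 1) \<le> 1 powr (- 2 * s - 1)" using s by (intro powr_mono2') auto
      then have "k powr (2 * s) * (1 + norm \<xi>) powr (- 2 * s - 1) \<le> k powr (2 * s) * 1" by (intro mult_left_mono) auto
      also have "\<dots> \<le> k powr (real n - 1)" unfolding mult_1_right by (intro powr_mono) (use n k in auto)
      also have "\<dots> = k ^ n / k" using k by (simp add: powr_diff powr_realpow)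
      finally have "k powr (2 * s) * (1 + norm \<xi>) powr (- 2 * s - 1) * ?f \<le> k ^ n / k * ?f" by (intro mult_right_mono) auto
      also have "\<dots> \<le> R0 k \<xi> / k" using R0(2)[of k \<xi>] True k by (simp add: divide_right_mono)
      also have "\<dots> \<le> ?R k \<xi> / k" using k by (intro divide_right_mono) auto
      finally show ?thesis .
    next
      case False
      have "(1 + norm \<xi>) powr (- 2 * s - 1) \<le> (k / 2) powr (- 2 * s - 1)" using s False k by (intro powr_mono2') auto
      also have "\<dots> = ?c * k powr (- 2 * s - 1)"
        using k by (simp add: powr_divide powr_diff powr_add powr_minus field_simps)
      finally have "k powr (2 * s) * (1 + norm \<xi>) powr (- 2 * s - 1) \<le> k powr (2 * s) * (?c * k powr (- 2 * s - 1))"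
        by (intro mult_left_mono) auto
      also have "\<dots> = ?c * (k powr (2 * s) * k powr (- 2 * s - 1))" by simp
      also have "k powr (2 * s) * k powr (- 2 * s - 1) = 1 / k" using k by (simp add: powr_add[symmetric] powr_minus_divide)
      finally have "k powr (2 * s) * (1 + norm \<xi>) powr (- 2 * s - 1) * ?f \<le> ?c * (1 / k) * ?f" by (intro mult_right_mono) auto
      also have "\<dots> \<le> ?R k \<xi> / k" using r0 k by (simp add: add_divide_distrib)
      finally show ?thesis .
    qed
  qed
qed

end

section \<open>Symbols of lower order\<close>

lemma partials_Nil[simp]: "partials [] f = f"
  by (simp add: partials_def)

lemma partials_snoc: "partials (bs @ [b]) f = partials bs (dir_deriv b f)"
  by (simp add: partials_def)

lemma partials_Cons: "partials (b # bs) f = dir_deriv b (partials bs f)"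
  by (simp add: partials_def)

lemma dir_deriv_add:
  assumes "smooth_on UNIV f" "smooth_on UNIV g"
  shows "dir_deriv b (\<lambda>x. f x + g x) = (\<lambda>x. dir_deriv b f x + dir_deriv b g x)"
  using dir_deriv_eq[OF has_derivative_add[OF smooth_on_has_derivative[OF assms(1)] smooth_on_has_derivative[OF assms(2)]]]
  by auto

lemma partials_add:
  assumes "smooth_on UNIV f" "smooth_on UNIV g" "set bs \<subseteq> Basis"
  shows "partials bs (\<lambda>x. f x + g x) = (\<lambda>x. partials bs f x + partials bs g x)"
  using assms(3)
proof (induction bs)
  case (Cons b bs)
  then show ?case using dir_deriv_add[OF smooth_on_partials[OF assms(1)] smooth_on_partials[OF assms(2)], of bs bs b]
    by (simp add: partials_Cons)
qed simp

lemma Pair_zero_Basis: "b \<in> Basis \<Longrightarrow> (b, 0) \<in> Basis"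
  by (auto simp: Basis_prod_def)

lemma smooth_on_fst:
  fixes \<zeta> :: "'a::euclidean_space \<Rightarrow> 'c::real_normed_vector"
  assumes "smooth_on UNIV \<zeta>"
  shows "smooth_on UNIV (\<lambda>p::'a \<times> 'b::euclidean_space. \<zeta> (fst p))"
  by (rule smooth_on_compose_basis[OF bounded_linear_fst _ assms]) (auto simp: Basis_prod_def)

lemma smooth_on_mult_fst:
  fixes \<zeta> :: "'a::euclidean_space \<Rightarrow> complex" and r :: "'a \<times> 'b::euclidean_space \<Rightarrow> complex"
  shows "smooth_on UNIV \<zeta> \<Longrightarrow> smooth_on UNIV r \<Longrightarrow> smooth_on UNIV (\<lambda>p. \<zeta> (fst p) * r p)"
  by (intro smooth_on_mult smooth_on_fst) auto

lemma dir_deriv_mult_fst: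
  fixes \<zeta> :: "'a::euclidean_space \<Rightarrow> complex" and r :: "'a \<times> 'b::euclidean_space \<Rightarrow> complex"
  assumes "smooth_on UNIV \<zeta>" "smooth_on UNIV r"
  shows "dir_deriv (b, 0) (\<lambda>p. \<zeta> (fst p) * r p) = (\<lambda>p. \<zeta> (fst p) * dir_deriv (b, 0) r p + dir_deriv b \<zeta> (fst p) * r p)"
proof
  fix p :: "'a \<times> 'b"
  have z: "((\<lambda>p. \<zeta> (fst p)) has_derivative (\<lambda>v. dir_deriv (fst v) \<zeta> (fst p))) (at p)"
    by (rule has_derivative_compose[OF _ smooth_on_has_derivative[OF assms(1)]])
      (auto intro: bounded_linear_imp_has_derivative bounded_linear_fst)
  have r: "(r has_derivative (\<lambda>v. dir_deriv v r p)) (at p)"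
    using smooth_on_has_derivative[OF assms(2)] by auto
  show "dir_deriv (b, 0) (\<lambda>p. \<zeta> (fst p) * r p) p = \<zeta> (fst p) * dir_deriv (b, 0) r p + dir_deriv b \<zeta> (fst p) * r p"
    using dir_deriv_eq[OF has_derivative_mult[OF z r]] by simp
qed

text \<open>Leibniz rule without multi-indices: peeling off the innermost derivative yields two
  products of the same kind, one with \<open>\<zeta>\<close> and one with \<open>r\<close>
  differentiated. The bound on \<open>r\<close> is therefore assumed for all lists
  \<open>cs\<close>.\<close>

lemma partials_mult_fst_bound:
  fixes \<zeta> :: "'a::euclidean_space \<Rightarrow> complex" and r :: "'a \<times> 'b::euclidean_space \<Rightarrow> complex"
  assumes "compact K" "smooth_on UNIV \<zeta>" "smooth_on UNIV r" "set bs \<subseteq> Basis"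
    and "\<And>cs. set cs \<subseteq> Basis \<Longrightarrow> \<exists>C. \<forall>z\<in>K. \<forall>\<xi>. norm (partials (map (\<lambda>b. (b, 0)) cs) r (z, \<xi>)) \<le> C * w \<xi>"
    and w: "\<And>\<xi>. w \<xi> \<ge> 0"
  shows "\<exists>C. \<forall>z\<in>K. \<forall>\<xi>. norm (partials (map (\<lambda>b. (b, 0)) bs) (\<lambda>p. \<zeta> (fst p) * r p) (z, \<xi>)) \<le> C * w \<xi>"
  using assms(2-5)
proof (induction bs arbitrary: \<zeta> r rule: rev_induct)
  case Nil
  have "bounded (\<zeta> ` K)" using smooth_on_continuous[OF Nil(1)] assms(1)
    by (intro compact_imp_bounded compact_continuous_image) (auto intro: continuous_on_subset)
  then obtain A where A: "\<And>z. z \<in> K \<Longrightarrow> norm (\<zeta> z) \<le> A" unfolding bounded_iff by auto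
  obtain C where C: "\<And>z \<xi>. z \<in> K \<Longrightarrow> norm (r (z, \<xi>)) \<le> C * w \<xi>" using Nil(4)[of "[]"] by auto
  have "norm (\<zeta> z * r (z, \<xi>)) \<le> (A * C) * w \<xi>" if "z \<in> K" for z \<xi>
    using mult_mono[OF A[OF that] C[OF that, of \<xi>]] order_trans[OF norm_ge_zero A[OF that]] by (simp add: norm_mult mult.assoc)
  then show ?case by auto
next
  case (snoc b bs)
  have b: "b \<in> Basis" and bs: "set bs \<subseteq> Basis" using snoc.prems(3) by auto
  have dr: "smooth_on UNIV (dir_deriv (b, 0) r)" using smooth_on_dir_deriv[OF snoc.prems(2) Pair_zero_Basis[OF b]] .
  have dz: "smooth_on UNIV (dir_deriv b \<zeta>)" using smooth_on_dir_deriv[OF snoc.prems(1) b] .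
  have "\<exists>C. \<forall>z\<in>K. \<forall>\<xi>. norm (partials (map (\<lambda>b. (b, 0)) cs) (dir_deriv (b, 0) r) (z, \<xi>)) \<le> C * w \<xi>"
    if "set cs \<subseteq> Basis" for cs
    using snoc.prems(4)[of "cs @ [b]"] that b by (simp add: partials_snoc)
  then obtain C1 where C1: "\<forall>z\<in>K. \<forall>\<xi>. norm (partials (map (\<lambda>b. (b, 0)) bs) (\<lambda>p. \<zeta> (fst p) * dir_deriv (b, 0) r p) (z, \<xi>)) \<le> C1 * w \<xi>"
    using snoc.IH[OF snoc.prems(1) dr bs] by blast
  obtain C2 where C2: "\<forall>z\<in>K. \<forall>\<xi>. norm (partials (map (\<lambda>b. (b, 0)) bs) (\<lambda>p. dir_deriv b \<zeta> (fst p) * r p) (z, \<xi>)) \<le> C2 * w \<xi>"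
    using snoc.IH[OF dz snoc.prems(2) bs snoc.prems(4)] by blast
  have eq: "partials (map (\<lambda>b. (b, 0)) (bs @ [b])) (\<lambda>p. \<zeta> (fst p) * r p) =
     (\<lambda>p. partials (map (\<lambda>b. (b, 0)) bs) (\<lambda>p. \<zeta> (fst p) * dir_deriv (b, 0) r p) p +
          partials (map (\<lambda>b. (b, 0)) bs) (\<lambda>p. dir_deriv b \<zeta> (fst p) * r p) p)"
    using bs by (simp add: partials_snoc dir_deriv_mult_fst snoc.prems)
      (intro partials_add smooth_on_mult_fst snoc.prems dr dz, auto intro: Pair_zero_Basis)
  have "norm (partials (map (\<lambda>b. (b, 0)) (bs @ [b])) (\<lambda>p. \<zeta> (fst p) * r p) (z, \<xi>)) \<le> (C1 + C2) * w \<xi>" if "z \<in> K" for z \<xi>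
  proof -
    have "norm (partials (map (\<lambda>b. (b, 0)) (bs @ [b])) (\<lambda>p. \<zeta> (fst p) * r p) (z, \<xi>)) \<le> C1 * w \<xi> + C2 * w \<xi>"
      unfolding eq using C1 C2 that by (intro norm_triangle_mono) auto
    then show ?thesis by (simp add: distrib_right)
  qed
  then show ?case by blast
qed

section \<open>Separation of variables through integrals over coordinate boxes\<close>

definition setcoord :: "real^3 \<Rightarrow> 3 \<Rightarrow> real \<Rightarrow> real^3" where
  "setcoord z i t = z + (t - z $ i) *\<^sub>R axis i 1"

lemma setcoord_nth: "setcoord z i t $ j = (if j = i then t else z $ j)"
  by (simp add: setcoord_def axis_def)

lemma axis_Basis: "axis i 1 \<in> (Basis :: (real^3) set)"
  by (auto simp: Basis_vec_def)

lemma dir_deriv_zero_outside_fst: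
  fixes H :: "'a::euclidean_space \<times> 'b::euclidean_space \<Rightarrow> complex"
  assumes "compact K" "\<And>z \<xi>. z \<notin> K \<Longrightarrow> H (z, \<xi>) = 0" "z \<notin> K"
  shows "dir_deriv b H (z, \<xi>) = 0"
proof -
  have "dir_deriv b H (z, \<xi>) = dir_deriv b (\<lambda>x. 0) (z, \<xi>)"
  proof (rule dir_deriv_cong_open[of "(- K) \<times> UNIV"])
    show "open ((- K) \<times> (UNIV :: 'b set))" using assms(1) compact_imp_closed by (intro open_Times) auto
  qed (use assms in auto)
  then show ?thesis by (simp add: dir_deriv_def)
qed

text \<open>Replacing a coordinate by \<open>- B\<close> moves the point out of the ball that
  contains \<open>K\<close>, so the fundamental theorem of calculus has no boundary term.\<close>

lemma ftc_coordinate: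
  fixes H :: "(real^3) \<times> (real^3) \<Rightarrow> complex"
  assumes H: "smooth_on UNIV H" and K: "compact K" "K \<subseteq> ball 0 B" and 0: "\<And>z \<xi>. z \<notin> K \<Longrightarrow> H (z, \<xi>) = 0"
  shows "H (z, \<xi>) = (LINT t|lborel. indicator {- B..z $ i} t *\<^sub>R dir_deriv (axis i 1, 0) H (setcoord z i t, \<xi>))"
proof (cases "z $ i < - B")
  case True
  then have "norm z > B" using component_le_norm_cart[of z i] by simp
  then have "H (z, \<xi>) = 0" using K(2) by (intro 0) auto
  then show ?thesis using True by simp
next
  case False
  let ?f = "\<lambda>t. H (setcoord z i t, \<xi>)" and ?b = "(axis i 1, 0) :: (real^3) \<times> (real^3)"
  have b: "?b \<in> Basis" by (intro Pair_zero_Basis axis_Basis)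
  have hd: "(H has_derivative (\<lambda>v. dir_deriv v H p)) (at p)" for p
    using smooth_on_has_derivative[OF H] by auto
  have d: "(?f has_vector_derivative dir_deriv ?b H (setcoord z i t, \<xi>)) (at t)" for t
  proof -
    have "((\<lambda>t. (setcoord z i t, \<xi>)) has_derivative (\<lambda>s. s *\<^sub>R ?b)) (at t)"
      unfolding setcoord_def by (auto intro!: derivative_eq_intros)
    from has_derivative_compose[OF this hd]
    have "(?f has_derivative (\<lambda>s. dir_deriv (s *\<^sub>R ?b) H (setcoord z i t, \<xi>))) (at t)" .
    moreover have "dir_deriv (s *\<^sub>R ?b) H p = s *\<^sub>R dir_deriv ?b H p" for s p
      using linear_scale[OF bounded_linear.linear[OF has_derivative_bounded_linear[OF hd[of p]]]] .
    ultimately show ?thesis by (simp only: has_vector_derivative_def)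
  qed
  have "continuous_on UNIV (dir_deriv ?b H)" by (intro smooth_on_continuous smooth_on_dir_deriv H b)
  then have c: "continuous_on {- B..z $ i} (\<lambda>t. dir_deriv ?b H (setcoord z i t, \<xi>))"
    by (rule continuous_on_compose2) (auto simp: setcoord_def intro!: continuous_intros)
  have "(LINT t|lborel. indicator {- B..z $ i} t *\<^sub>R dir_deriv ?b H (setcoord z i t, \<xi>)) = ?f (z $ i) - ?f (- B)"
    by (rule integral_FTC_Icc[OF _ has_vector_derivative_at_within[OF d] c]) (use False in auto)
  moreover have "?f (- B) = 0"
  proof (rule 0)
    have "norm (setcoord z i (- B)) \<ge> B" using component_le_norm_cart[of "setcoord z i (- B)" i] by (simp add: setcoord_nth)
    then show "setcoord z i (- B) \<notin> K" using K(2) by auto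
  qed
  moreover have "setcoord z i (z $ i) = z" by (simp add: setcoord_def)
  ultimately show ?thesis by simp
qed

text \<open>Parameters range over nested pairs because \<open>lborel_prod\<close> then gives
  Fubini's theorem one coordinate at a time.\<close>

definition vec3 :: "real \<times> real \<times> real \<Rightarrow> real^3" where
  "vec3 w = fst w *\<^sub>R axis 1 1 + fst (snd w) *\<^sub>R axis 2 1 + snd (snd w) *\<^sub>R axis 3 1"

text \<open>Seen as a function of \<open>w\<close>, the indicator of a compact box; seen as a
  function of \<open>z\<close>, for \<open>w\<close> with coordinates at least \<open>- B\<close>,
  that of an orthant. The second reading turns it into a truncation.\<close>

definition below :: "real \<Rightarrow> real^3 \<Rightarrow> real \<times> real \<times> real \<Rightarrow> real" where
  "below B z w = (if - B \<le> fst w \<and> fst w \<le> z $ 1 \<and> - B \<le> fst (snd w) \<and> fst (snd w) \<le> z $ 2 \<and>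
     - B \<le> snd (snd w) \<and> snd (snd w) \<le> z $ 3 then 1 else 0)"

lemma setcoord_vec3: "setcoord (setcoord (setcoord z 1 a) 2 b) 3 c = vec3 (a, b, c)"
  by (simp add: vec_eq_iff forall_3 setcoord_nth vec3_def axis_def)

lemma below_indicator:
  "below B z (a, b, c) = indicator {- B..z $ 1} a * (indicator {- B..z $ 2} b * indicator {- B..z $ 3} c)"
  by (simp add: below_def indicator_def)

text \<open>\<open>ftc_coordinate\<close> in the coordinates 1, 2, 3 in turn; each derivative keeps
  the support in \<open>K\<close>. In \<open>partials\<close> the last list entry acts first, hence
  the reversed list.\<close>

lemma iterated_ftc:
  fixes H :: "(real^3) \<times> (real^3) \<Rightarrow> complex"
  assumes H: "smooth_on UNIV H" and K: "compact K" "K \<subseteq> ball 0 B" and 0: "\<And>z \<xi>. z \<notin> K \<Longrightarrow> H (z, \<xi>) = 0"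
  defines "g \<equiv> partials (map (\<lambda>b. (b, 0)) [axis 3 1, axis 2 1, axis 1 1]) H"
  shows "integrable lborel (\<lambda>w. below B z w *\<^sub>R g (vec3 w, \<xi>))"
    and "H (z, \<xi>) = (LINT w|lborel. below B z w *\<^sub>R g (vec3 w, \<xi>))"
proof -
  let ?d = "\<lambda>i::3. (axis i 1, 0) :: (real^3) \<times> (real^3)"
  have b: "?d i \<in> Basis" for i by (intro Pair_zero_Basis axis_Basis)
  define H1 where "H1 = dir_deriv (?d 1) H"
  define H2 where "H2 = dir_deriv (?d 2) H1"
  have g: "g = dir_deriv (?d 3) H2" by (simp add: g_def H1_def H2_def partials_Cons)
  have s1: "smooth_on UNIV H1" unfolding H1_def by (intro smooth_on_dir_deriv H b)
  have s2: "smooth_on UNIV H2" unfolding H2_def by (intro smooth_on_dir_deriv s1 b)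
  have s3: "smooth_on UNIV g" unfolding g by (intro smooth_on_dir_deriv s2 b)
  have z1: "H1 (z, \<xi>) = 0" if "z \<notin> K" for z \<xi> unfolding H1_def by (rule dir_deriv_zero_outside_fst[OF K(1)]) (use 0 that in auto)
  have z2: "H2 (z, \<xi>) = 0" if "z \<notin> K" for z \<xi> unfolding H2_def by (rule dir_deriv_zero_outside_fst[OF K(1)]) (use z1 that in auto)
  have gc: "continuous_on UNIV g" by (intro smooth_on_continuous s3)
  have vc: "continuous_on UNIV vec3" unfolding vec3_def by (intro continuous_intros)
  have gvc: "continuous_on UNIV (\<lambda>w. g (vec3 w, \<xi>))"
    by (rule continuous_on_compose2[OF gc]) (auto intro!: continuous_intros vc)
  let ?Q = "{- B..z $ 1} \<times> {- B..z $ 2} \<times> {- B..z $ 3}"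
  have Q: "compact ?Q" by (intro compact_Times compact_Icc)
  have "bounded ((\<lambda>w. g (vec3 w, \<xi>)) ` ?Q)"
    by (intro compact_imp_bounded compact_continuous_image Q continuous_on_subset[OF gvc]) auto
  then obtain C where C: "\<And>w. w \<in> ?Q \<Longrightarrow> norm (g (vec3 w, \<xi>)) \<le> C" unfolding bounded_iff by auto
  have bQ: "w \<notin> ?Q \<Longrightarrow> below B z w = 0" for w by (cases w) (auto simp: below_indicator)
  have [measurable]: "(\<lambda>w. g (vec3 w, \<xi>)) \<in> borel_measurable borel" by (rule borel_measurable_continuous_onI[OF gvc])
  have "below B z \<in> borel_measurable (borel \<Otimes>\<^sub>M (borel \<Otimes>\<^sub>M borel))" unfolding below_def by measurable
  then have [measurable]: "below B z \<in> borel_measurable borel" unfolding borel_prod .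
  show i: "integrable lborel (\<lambda>w. below B z w *\<^sub>R g (vec3 w, \<xi>))"
  proof (rule bounded_support_integrable[OF _ Q])
    show "norm (below B z w *\<^sub>R g (vec3 w, \<xi>)) \<le> max 0 C" for w
      using C[of w] bQ[of w] by (cases "w \<in> ?Q") (auto simp: below_def)
  qed (use bQ in auto)
  have i': "integrable (lborel \<Otimes>\<^sub>M lborel) (\<lambda>w. below B z w *\<^sub>R g (vec3 w, \<xi>))"
    unfolding lborel_prod by (rule i)
  have "H (z, \<xi>) = (LINT a|lborel. indicator {- B..z $ 1} a *\<^sub>R H1 (setcoord z 1 a, \<xi>))"
    unfolding H1_def by (rule ftc_coordinate[OF H K 0])
  also have "\<dots> = (LINT a|lborel. LINT v|lborel. below B z (a, v) *\<^sub>R g (vec3 (a, v), \<xi>))"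
  proof (intro Bochner_Integration.integral_cong refl)
    fix a :: real
    have "H1 (setcoord z 1 a, \<xi>) = (LINT b|lborel. indicator {- B..z $ 2} b *\<^sub>R H2 (setcoord (setcoord z 1 a) 2 b, \<xi>))"
      unfolding H2_def using ftc_coordinate[OF s1 K z1, of "setcoord z 1 a" \<xi> 2] by (simp add: setcoord_nth)
    also have "\<dots> = (LINT b|lborel. LINT c|lborel. (indicator {- B..z $ 2} b * indicator {- B..z $ 3} c) *\<^sub>R g (vec3 (a, b, c), \<xi>))"
    proof (intro Bochner_Integration.integral_cong refl)
      fix b :: real
      have "H2 (setcoord (setcoord z 1 a) 2 b, \<xi>) = (LINT c|lborel. indicator {- B..z $ 3} c *\<^sub>R g (vec3 (a, b, c), \<xi>))"
        unfolding g using ftc_coordinate[OF s2 K z2, of "setcoord (setcoord z 1 a) 2 b" \<xi> 3]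
        by (simp add: setcoord_nth setcoord_vec3)
      then show "indicator {- B..z $ 2} b *\<^sub>R H2 (setcoord (setcoord z 1 a) 2 b, \<xi>) =
         (LINT c|lborel. (indicator {- B..z $ 2} b * indicator {- B..z $ 3} c) *\<^sub>R g (vec3 (a, b, c), \<xi>))"
        by (simp only: scaleR_scaleR[symmetric] integral_scaleR_right)
    qed
    finally have 1: "indicator {- B..z $ 1} a *\<^sub>R H1 (setcoord z 1 a, \<xi>) =
       (LINT b|lborel. LINT c|lborel. below B z (a, b, c) *\<^sub>R g (vec3 (a, b, c), \<xi>))"
      by (simp only: below_indicator scaleR_scaleR[symmetric] integral_scaleR_right)
    let ?Q2 = "{- B..z $ 2} \<times> {- B..z $ 3}"
    have Q2: "compact ?Q2" by (intro compact_Times compact_Icc)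
    \<comment> \<open>Fubini's theorem is applied on every slice of fixed \<open>a\<close>, so
      integrability is established for each slice rather than for almost every one.\<close>
    have "integrable lborel (\<lambda>v. below B z (a, v) *\<^sub>R g (vec3 (a, v), \<xi>))"
    proof (rule bounded_support_integrable[OF _ Q2])
      show "norm (below B z (a, v) *\<^sub>R g (vec3 (a, v), \<xi>)) \<le> max 0 C" for v
        using C[of "(a, v)"] bQ[of "(a, v)"] by (cases "(a, v) \<in> ?Q") (auto simp: below_def)
      show "v \<notin> ?Q2 \<Longrightarrow> below B z (a, v) *\<^sub>R g (vec3 (a, v), \<xi>) = 0" for v
        using bQ[of "(a, v)"] by auto
      have "(\<lambda>w. below B z w *\<^sub>R g (vec3 w, \<xi>)) \<in> borel_measurable (borel \<Otimes>\<^sub>M borel)" unfolding borel_prod by measurable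
      from measurable_compose[OF measurable_Pair1' this, of a]
      show "(\<lambda>v. below B z (a, v) *\<^sub>R g (vec3 (a, v), \<xi>)) \<in> borel_measurable borel" by simp
    qed
    from lborel_pair.integral_fst'[OF this[unfolded lborel_prod[symmetric]]]
    show "indicator {- B..z $ 1} a *\<^sub>R H1 (setcoord z 1 a, \<xi>) = (LINT v|lborel. below B z (a, v) *\<^sub>R g (vec3 (a, v), \<xi>))"
      unfolding 1 lborel_prod by simp
  qed
  also have "\<dots> = (LINT w|lborel. below B z w *\<^sub>R g (vec3 w, \<xi>))"
    using lborel_pair.integral_fst'[OF i'] unfolding lborel_prod by simp
  finally show "H (z, \<xi>) = (LINT w|lborel. below B z w *\<^sub>R g (vec3 w, \<xi>))" .
qed

lemma below_measurable:
  "(\<lambda>p. below B (fst p) (snd p)) \<in> borel_measurable (borel \<Otimes>\<^sub>M borel)"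
proof -
  have [measurable]: "(\<lambda>z::real^3. z $ i) \<in> borel_measurable borel" for i
    by (intro borel_measurable_continuous_onI continuous_intros)
  have "(\<lambda>p. below B (fst p) (snd p)) \<in> borel_measurable (borel \<Otimes>\<^sub>M (borel \<Otimes>\<^sub>M (borel \<Otimes>\<^sub>M borel)))"
    unfolding below_def by measurable
  then show ?thesis unfolding borel_prod .
qed

lemma below_measurable_compose[measurable (raw)]:
  "f \<in> measurable N borel \<Longrightarrow> g \<in> measurable N borel \<Longrightarrow> (\<lambda>x. below B (f x) (g x)) \<in> borel_measurable N"
  using measurable_compose[OF measurable_Pair below_measurable, of f N g B] by simp

text \<open>
  Only \<open>z\<close>-derivatives of \<open>H\<close> enter. After \<open>iterated_ftc\<close> the \<open>z\<close>-integral becomes, for each \<open>w\<close>, the transform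
  of a truncation of \<open>\<phi>\<close>, whose \<open>L\<^sup>2\<close> norm is bounded uniformly in \<open>w\<close>.
\<close>

lemma remainder_bound:
  fixes H :: "(real^3) \<times> (real^3) \<Rightarrow> complex" and \<phi> :: "real^3 \<Rightarrow> complex" and R M r :: "real^3 \<Rightarrow> real"
  assumes H: "smooth_on UNIV H" and K: "compact K" "K \<subseteq> ball 0 B" and 0: "\<And>z \<xi>. z \<notin> K \<Longrightarrow> H (z, \<xi>) = 0"
    and M: "\<And>z \<xi>. z \<in> K \<Longrightarrow> norm (partials (map (\<lambda>b. (b, 0)) [axis 3 1, axis 2 1, axis 1 1]) H (z, \<xi>)) \<le> M \<xi>"
      "\<And>\<xi>. M \<xi> \<ge> 0"
    and \<phi>[measurable]: "\<phi> \<in> borel_measurable borel" and \<phi>1: "\<And>z. norm (\<phi> z) \<le> 1" and \<phi>0: "\<And>z. z \<notin> K \<Longrightarrow> \<phi> z = 0"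
    and R[measurable]: "R \<in> borel_measurable borel" and R0: "\<And>\<xi>. R \<xi> \<ge> 0"
    and CR: "CR \<ge> 0" "(\<integral>\<^sup>+\<xi>. ennreal ((R \<xi>)\<^sup>2) \<partial>lborel) \<le> ennreal CR"
    and r: "\<And>\<xi>. r \<xi> \<ge> 0" "\<And>\<xi>. r \<xi> * M \<xi> \<le> c * R \<xi>" and c: "c \<ge> 0"
  shows "(\<integral>\<^sup>+\<xi>. ennreal (r \<xi> * norm (LINT z|lborel. \<phi> z * phase z \<xi> * H (z, \<xi>))) \<partial>lborel) \<le>
    ennreal (c * ((CR + (2 * pi) ^ 3 * measure lborel K) / 2 * measure lborel ({- B..B} \<times> {- B..B} \<times> {- B..B})))"
proof -
  define g where "g = partials (map (\<lambda>b. (b, 0)) [axis 3 1, axis 2 1, axis 1 1]) H"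
  let ?W = "{- B..B} \<times> {- B..B} \<times> {- B..B}"
  have W: "compact ?W" by (intro compact_Times compact_Icc)
  have [measurable]: "?W \<in> sets borel" by (rule borel_closed[OF compact_imp_closed[OF W]])
  have Wfin: "emeasure lborel ?W < \<infinity>" by (rule emeasure_compact_finite[OF W])
  have "set (map (\<lambda>b. (b, 0)) [axis 3 1, axis 2 1, axis 1 1]) \<subseteq> (Basis :: ((real^3) \<times> (real^3)) set)"
    using Pair_zero_Basis[OF axis_Basis] by auto
  then have gc: "continuous_on UNIV g" unfolding g_def by (intro smooth_on_continuous smooth_on_partials H)
  have gz: "norm (g (z, \<xi>)) \<le> M \<xi>" for z \<xi>
  proof (cases "z \<in> K")
    case False
    have 1: "dir_deriv b1 H (z, \<xi>) = 0" if "z \<notin> K" for b1 z \<xi> by (rule dir_deriv_zero_outside_fst[OF K(1)]) (use 0 that in auto)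
    have 2: "dir_deriv b2 (dir_deriv b1 H) (z, \<xi>) = 0" if "z \<notin> K" for b1 b2 z \<xi>
      by (rule dir_deriv_zero_outside_fst[OF K(1)]) (use 1 that in auto)
    have 3: "dir_deriv b3 (dir_deriv b2 (dir_deriv b1 H)) (z, \<xi>) = 0" if "z \<notin> K" for b1 b2 b3 z \<xi>
      by (rule dir_deriv_zero_outside_fst[OF K(1)]) (use 2 that in auto)
    show ?thesis using False M(2) by (simp add: g_def partials_Cons 3)
  qed (use M g_def in auto)
  have vc: "continuous_on UNIV vec3" unfolding vec3_def by (intro continuous_intros)
  have gvm[measurable]: "(\<lambda>w. g (vec3 w, \<xi>)) \<in> borel_measurable borel" for \<xi>
    by (intro borel_measurable_continuous_onI continuous_on_compose2[OF gc]) (auto intro!: continuous_intros vc)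
  \<comment> \<open>Coordinates of points of \<open>K\<close> are less than \<open>B\<close>, so a
    parameter below such a point lies in the cube \<open>?W\<close>; the \<open>w\<close>-integral
    has fixed finite volume.\<close>
  have below_W: "below B z w = 0" if "z \<in> K" "w \<notin> ?W" for z w
  proof -
    have "z $ i < B" for i using component_le_norm_cart[of z i] K(2) that(1) by (force simp: mem_ball_0)
    from this[of 1] this[of 2] this[of 3] show ?thesis using that(2) by (cases w) (auto simp: below_def)
  qed
  have below01: "0 \<le> below B z w" "below B z w \<le> 1" for z w by (auto simp: below_def)
  \<comment> \<open>The truncation of \<open>\<phi>\<close> at \<open>w\<close>: discontinuous, but
    bounded by 1 and supported in \<open>K\<close>, so its L^2 norm is controlled independently of
    \<open>w\<close>.\<close>
  define \<psi> where "\<psi> w z = \<phi> z * complex_of_real (below B z w)" for w z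
  have \<psi>0: "\<psi> w z = 0" if "z \<notin> K \<or> w \<notin> ?W" for w z
  proof (cases "z \<in> K")
    case True
    then have "below B z w = 0" using that below_W by blast
    then show ?thesis by (simp add: \<psi>_def)
  qed (simp add: \<psi>_def \<phi>0)
  have \<psi>m: "\<psi> w \<in> borel_measurable borel" for w
  proof -
    have "(\<lambda>z. below B (fst (z, w)) (snd (z, w))) \<in> borel_measurable borel"
      by (rule measurable_compose[OF measurable_Pair2' below_measurable]) auto
    then have [measurable]: "(\<lambda>z. below B z w) \<in> borel_measurable borel" by simp
    show ?thesis unfolding \<psi>_def[abs_def] by measurable
  qed
  have \<psi>1: "norm (\<psi> w z) \<le> norm (\<phi> z)" "norm (\<psi> w z) \<le> 1" for w z
    using below01[of z w] \<phi>1[of z] mult_left_le[of "below B z w" "norm (\<phi> z)"] by (auto simp: \<psi>_def norm_mult intro: order_trans)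
  have K_meas[measurable]: "K \<in> sets borel" by (rule borel_closed[OF compact_imp_closed[OF K(1)]])
  let ?D = "(2 * pi) ^ 3 * measure lborel K"
  have \<psi>D: "(\<integral>\<^sup>+\<xi>. ennreal ((norm (cft (\<psi> w) \<xi>))\<^sup>2) \<partial>lborel) \<le> ennreal ?D" for w
  proof -
    have i: "integrable lborel (\<psi> w)" "integrable lborel (\<lambda>z. (norm (\<psi> w z))\<^sup>2)"
      using bounded_support_integrable[OF \<psi>m K(1) \<psi>1(2)] bounded_support_square_integrable[OF \<psi>m K(1) \<psi>1(2)] \<psi>0 by auto
    have "(LINT z|lborel. (norm (\<psi> w z))\<^sup>2) \<le> (LINT z|lborel. indicator K z)"
    proof (rule Bochner_Integration.integral_mono[OF i(2)])
      show "integrable lborel (indicator K :: real^3 \<Rightarrow> real)" using emeasure_compact_finite[OF K(1)] by simp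
      show "(norm (\<psi> w z))\<^sup>2 \<le> indicator K z" for z
        using \<psi>1(2)[of w z] \<psi>0[of z w] by (cases "z \<in> K") (auto simp: power_le_one)
    qed
    also have "\<dots> = measure lborel K" by simp
    finally show ?thesis using order_trans[OF cft_L2_bound[OF i] ennreal_leI] by (simp add: mult_left_mono)
  qed
  have G: "(LINT z|lborel. \<phi> z * phase z \<xi> * H (z, \<xi>)) = (LINT w|lborel. g (vec3 w, \<xi>) * cft (\<psi> w) \<xi>)" for \<xi>
  proof -
    define I where "I z w = \<phi> z * phase z \<xi> * (below B z w *\<^sub>R g (vec3 w, \<xi>))" for z w
    have KW: "compact (K \<times> ?W)" by (intro compact_Times K W)
    have Im: "case_prod I \<in> borel_measurable borel"
    proof -
      have "(\<lambda>p. \<phi> (fst p) * phase (fst p) \<xi> * (below B (fst p) (snd p) *\<^sub>R g (vec3 (snd p), \<xi>))) \<in> borel_measurable (borel \<Otimes>\<^sub>M borel)"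
        by measurable
      then show ?thesis unfolding borel_prod I_def split_beta' .
    qed
    have "integrable lborel (case_prod I)"
    proof (rule bounded_support_integrable[OF Im KW])
      show "norm (case_prod I p) \<le> M \<xi>" for p
      proof -
        obtain z w where Pair: "p = (z, w)" by (rule prod.exhaust)
        have "norm (\<phi> z) * below B z w * norm (g (vec3 w, \<xi>)) \<le> 1 * 1 * M \<xi>"
          using \<phi>1[of z] below01[of z w] gz[of "vec3 w" \<xi>] by (intro mult_mono) auto
        then show ?thesis using Pair below01[of z w] by (simp add: I_def norm_mult mult_ac)
      qed
      show "case_prod I p = 0" if "p \<notin> K \<times> ?W" for p
        using that \<psi>0[of "fst p" "snd p"] by (cases p) (auto simp: I_def \<psi>_def)
    qed
    then have "integrable (lborel \<Otimes>\<^sub>M lborel) (case_prod I)" unfolding lborel_prod .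
    note F = lborel_pair.Fubini_integral[OF this]
    have "(LINT z|lborel. \<phi> z * phase z \<xi> * H (z, \<xi>)) = (LINT z|lborel. LINT w|lborel. I z w)"
    proof (intro Bochner_Integration.integral_cong refl)
      fix z
      have "H (z, \<xi>) = (LINT w|lborel. below B z w *\<^sub>R g (vec3 w, \<xi>))"
        unfolding g_def by (rule iterated_ftc(2)[OF H K]) (use 0 in auto)
      then show "\<phi> z * phase z \<xi> * H (z, \<xi>) = (LINT w|lborel. I z w)"
        unfolding I_def by (simp only: integral_mult_right_zero)
    qed
    also have "\<dots> = (LINT w|lborel. LINT z|lborel. I z w)" by (rule F[symmetric])
    also have "\<dots> = (LINT w|lborel. g (vec3 w, \<xi>) * cft (\<psi> w) \<xi>)"
    proof (intro Bochner_Integration.integral_cong refl)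
      fix w
      have "(\<lambda>z. I z w) = (\<lambda>z. g (vec3 w, \<xi>) * (phase z \<xi> * \<psi> w z))"
        by (auto simp: I_def \<psi>_def scaleR_conv_of_real mult_ac)
      then show "(LINT z|lborel. I z w) = g (vec3 w, \<xi>) * cft (\<psi> w) \<xi>" unfolding cft_def by (simp only: integral_mult_right_zero)
    qed
    finally show ?thesis .
  qed
  have cm: "(\<lambda>p. cft (\<psi> (snd p)) (fst p)) \<in> borel_measurable (borel \<Otimes>\<^sub>M borel)"
    unfolding cft_def \<psi>_def by measurable
  \<comment> \<open>AM-GM separates \<open>R\<close> from the transform of the truncation. The
    indicator loses nothing, as that transform vanishes for \<open>w\<close> outside
    \<open>?W\<close>.\<close>
  let ?J = "\<lambda>\<xi> w. ennreal c * ((ennreal ((R \<xi>)\<^sup>2 / 2) + ennreal ((norm (cft (\<psi> w) \<xi>))\<^sup>2 / 2)) * indicator ?W w)"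
  have Jm: "(\<lambda>p. ?J (fst p) (snd p)) \<in> borel_measurable (borel \<Otimes>\<^sub>M borel)" using cm by measurable
  have bound: "ennreal (r \<xi> * norm (LINT z|lborel. \<phi> z * phase z \<xi> * H (z, \<xi>))) \<le> (\<integral>\<^sup>+w. ?J \<xi> w \<partial>lborel)" for \<xi>
  proof -
    have cw: "(\<lambda>w. cft (\<psi> w) \<xi>) \<in> borel_measurable borel"
      using measurable_compose[OF measurable_Pair1' cm, of \<xi>] by simp
    have "ennreal (r \<xi> * norm (LINT z|lborel. \<phi> z * phase z \<xi> * H (z, \<xi>))) =
        ennreal (r \<xi>) * ennreal (norm (LINT w|lborel. g (vec3 w, \<xi>) * cft (\<psi> w) \<xi>))"
      unfolding G using r(1) by (simp add: ennreal_mult)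
    also have "\<dots> \<le> ennreal (r \<xi>) * (\<integral>\<^sup>+w. ennreal (norm (g (vec3 w, \<xi>) * cft (\<psi> w) \<xi>)) \<partial>lborel)"
      by (intro mult_left_mono norm_integral_le_nn_integral) auto
    also have "\<dots> = (\<integral>\<^sup>+w. ennreal (r \<xi>) * ennreal (norm (g (vec3 w, \<xi>) * cft (\<psi> w) \<xi>)) \<partial>lborel)"
      using cw by (subst nn_integral_cmult) auto
    also have "\<dots> \<le> (\<integral>\<^sup>+w. ?J \<xi> w \<partial>lborel)"
    proof (intro nn_integral_mono)
      fix w
      show "ennreal (r \<xi>) * ennreal (norm (g (vec3 w, \<xi>) * cft (\<psi> w) \<xi>)) \<le> ?J \<xi> w"
      proof (cases "w \<in> ?W")
        case False
        then have "cft (\<psi> w) \<xi> = 0" using \<psi>0[of _ w] by (simp add: cft_def)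
        then show ?thesis by simp
      next
        case True
        let ?n = "norm (cft (\<psi> w) \<xi>)"
        have "r \<xi> * (norm (g (vec3 w, \<xi>)) * ?n) \<le> r \<xi> * (M \<xi> * ?n)"
          using gz[of "vec3 w" \<xi>] r(1) by (intro mult_left_mono mult_right_mono) auto
        also have "\<dots> \<le> c * R \<xi> * ?n" unfolding mult.assoc[symmetric] by (intro mult_right_mono r) auto
        also have "\<dots> \<le> c * ((R \<xi>)\<^sup>2 / 2 + ?n\<^sup>2 / 2)"
          unfolding mult.assoc using c real_amgm[of "R \<xi>" ?n] by (intro mult_left_mono) (auto simp: add_divide_distrib)
        finally have "ennreal (r \<xi> * (norm (g (vec3 w, \<xi>)) * ?n)) \<le> ennreal (c * ((R \<xi>)\<^sup>2 / 2 + ?n\<^sup>2 / 2))"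
          by (rule ennreal_leI)
        then show ?thesis using True r(1) c by (simp add: norm_mult ennreal_mult ennreal_plus)
      qed
    qed
    finally show ?thesis .
  qed
  have "(\<integral>\<^sup>+\<xi>. ennreal (r \<xi> * norm (LINT z|lborel. \<phi> z * phase z \<xi> * H (z, \<xi>))) \<partial>lborel) \<le>
     (\<integral>\<^sup>+\<xi>. \<integral>\<^sup>+w. ?J \<xi> w \<partial>lborel \<partial>lborel)"
    by (intro nn_integral_mono bound)
  \<comment> \<open>With \<open>w\<close> outermost, Plancherel's inequality is available for each
    fixed truncation.\<close>
  also have "\<dots> = (\<integral>\<^sup>+w. \<integral>\<^sup>+\<xi>. ?J \<xi> w \<partial>lborel \<partial>lborel)"
    by (rule lborel_pair.Fubini'[symmetric]) (use Jm in \<open>simp add: split_beta'\<close>)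
  also have "\<dots> \<le> (\<integral>\<^sup>+w. ennreal c * (ennreal ((CR + ?D) / 2) * indicator ?W w) \<partial>lborel)"
  proof (intro nn_integral_mono)
    fix w
    have [measurable]: "cft (\<psi> w) \<in> borel_measurable borel" by (intro cft_measurable \<psi>m)
    have "(\<integral>\<^sup>+\<xi>. ?J \<xi> w \<partial>lborel) = ennreal c * (((\<integral>\<^sup>+\<xi>. ennreal ((R \<xi>)\<^sup>2 / 2) \<partial>lborel) +
        (\<integral>\<^sup>+\<xi>. ennreal ((norm (cft (\<psi> w) \<xi>))\<^sup>2 / 2) \<partial>lborel)) * indicator ?W w)"
      by (simp add: nn_integral_cmult nn_integral_multc nn_integral_add)
    also have "\<dots> \<le> ennreal c * ((ennreal (CR / 2) + ennreal (?D / 2)) * indicator ?W w)"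
    proof (intro mult_left_mono mult_right_mono add_mono)
      have half: "(\<integral>\<^sup>+\<xi>. ennreal (f \<xi> / 2) \<partial>lborel) \<le> ennreal (A / 2)"
        if [measurable]: "f \<in> borel_measurable borel" and f: "(\<integral>\<^sup>+\<xi>. ennreal (f \<xi>) \<partial>lborel) \<le> ennreal A" "\<And>\<xi>. f \<xi> \<ge> 0" "A \<ge> 0"
        for f :: "real^3 \<Rightarrow> real" and A
      proof -
        have e: "ennreal (a / 2) = ennreal (1/2) * ennreal a" if "a \<ge> 0" for a
          using ennreal_mult[of "1/2" a] that by simp
        have "(\<integral>\<^sup>+\<xi>. ennreal (f \<xi> / 2) \<partial>lborel) = (\<integral>\<^sup>+\<xi>. ennreal (1/2) * ennreal (f \<xi>) \<partial>lborel)"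
          using e[OF f(2)] by simp
        also have "\<dots> \<le> ennreal (1/2) * ennreal A" using f(1) by (subst nn_integral_cmult) (auto intro: mult_left_mono)
        also have "\<dots> = ennreal (A / 2)" using e[OF f(3)] by simp
        finally show ?thesis .
      qed
      show "(\<integral>\<^sup>+\<xi>. ennreal ((R \<xi>)\<^sup>2 / 2) \<partial>lborel) \<le> ennreal (CR / 2)" by (rule half) (use CR in auto)
      show "(\<integral>\<^sup>+\<xi>. ennreal ((norm (cft (\<psi> w) \<xi>))\<^sup>2 / 2) \<partial>lborel) \<le> ennreal (?D / 2)" by (rule half) (use \<psi>D in auto)
    qed auto
    also have "ennreal (CR / 2) + ennreal (?D / 2) = ennreal ((CR + ?D) / 2)"
      using CR by (subst ennreal_plus[symmetric]) (auto simp: add_divide_distrib)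
    finally show "(\<integral>\<^sup>+\<xi>. ?J \<xi> w \<partial>lborel) \<le> ennreal c * (ennreal ((CR + ?D) / 2) * indicator ?W w)" .
  qed
  also have "\<dots> = ennreal c * (ennreal ((CR + ?D) / 2) * emeasure lborel ?W)"
    by (simp add: nn_integral_cmult)
  also have "emeasure lborel ?W = ennreal (measure lborel ?W)"
    using Wfin by (intro emeasure_eq_ennreal_measure) auto
  finally show ?thesis using c CR by (simp add: ennreal_mult[symmetric] mult.assoc)
qed

section \<open>Quadratic forms of pseudo-differential operators\<close>

lemma integrable_inverse_one_plus_square: "integrable lborel (\<lambda>t::real. inverse (1 + t\<^sup>2))"
  using integrable_inverse_1_plus_square by (simp add: set_integrable_def)

text \<open>Applying 1 minus the second derivative once in each coordinate multiplies the transform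
  by a product of quadratic factors whose inverse is integrable, and the result is still bounded.
  The Fubini argument in \<open>pdo_pairing\<close> relies on this.\<close>

lemma cft_integrable:
  fixes u :: "'a::euclidean_space \<Rightarrow> complex"
  assumes u: "test_function UNIV u"
  shows "integrable lborel (cft u)"
proof -
  have "\<exists>v. test_function UNIV v \<and> (\<forall>\<xi>. cft v \<xi> = (\<Prod>b\<in>A. complex_of_real (1 + (\<xi> \<bullet> b)\<^sup>2)) * cft u \<xi>)"
    if "A \<subseteq> Basis" for A :: "'a set"
    using finite_subset[OF that finite_Basis] that
  proof (induction A rule: finite_induct)
    case empty then show ?case using u by auto
  next
    case (insert b A)
    then obtain v where v: "test_function UNIV v" "\<And>\<xi>. cft v \<xi> = (\<Prod>b\<in>A. complex_of_real (1 + (\<xi> \<bullet> b)\<^sup>2)) * cft u \<xi>"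
      by auto
    have b: "b \<in> Basis" using insert by simp
    let ?d = "dir_deriv b (dir_deriv b v)"
    have d: "test_function UNIV (dir_deriv b v)" "test_function UNIV ?d"
      using v(1) b test_function_dir_deriv by blast+
    have md: "test_function UNIV (\<lambda>y. (-1) * ?d y)" by (rule test_function_mult[OF smooth_on_const d(2)])
    have "cft (\<lambda>y. v y + (-1) * ?d y) \<xi> = complex_of_real (1 + (\<xi> \<bullet> b)\<^sup>2) * cft v \<xi>" for \<xi>
    proof -
      have "cft ?d \<xi> = (- \<i> * complex_of_real (\<xi> \<bullet> b)) * ((- \<i> * complex_of_real (\<xi> \<bullet> b)) * cft v \<xi>)"
        by (simp only: cft_dir_deriv[OF d(1) b] cft_dir_deriv[OF v(1) b])
      also have "\<dots> = - complex_of_real ((\<xi> \<bullet> b)\<^sup>2) * cft v \<xi>"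
        unfolding mult.assoc[symmetric] by (simp add: complex_eq_iff power2_eq_square)
      finally show ?thesis
        using cft_add[OF test_function_integrable(1)[OF v(1)] test_function_integrable(1)[OF md], of \<xi>]
        by (simp only: cft_cmult) (simp add: algebra_simps)
    qed
    then have "\<forall>\<xi>. cft (\<lambda>y. v y + (-1) * ?d y) \<xi> = (\<Prod>b\<in>insert b A. complex_of_real (1 + (\<xi> \<bullet> b)\<^sup>2)) * cft u \<xi>"
      using insert.hyps by (simp add: v(2) mult.assoc)
    then show ?case using test_function_add[OF v(1) md] by blast
  qed
  from this[OF subset_refl] obtain v where v: "test_function UNIV v"
    "\<And>\<xi>::'a. cft v \<xi> = (\<Prod>b\<in>Basis. complex_of_real (1 + (\<xi> \<bullet> b)\<^sup>2)) * cft u \<xi>" by blast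
  let ?C = "LINT z|lborel. norm (v z)"
  have [measurable]: "cft u \<in> borel_measurable borel" by (intro cft_measurable test_function_measurable[OF u])
  show ?thesis
  proof (rule Bochner_Integration.integrable_bound)
    show "integrable lborel (\<lambda>\<xi>::'a. ?C * (\<Prod>b\<in>Basis. inverse (1 + (\<xi> \<bullet> b)\<^sup>2)))"
      using lborel_integrable_prod(1)[where 'a='a, OF integrable_inverse_one_plus_square] by simp
    have "norm (cft u \<xi>) \<le> norm (?C * (\<Prod>b\<in>Basis. inverse (1 + (\<xi> \<bullet> b)\<^sup>2)))" for \<xi>
    proof -
      let ?p = "\<Prod>b\<in>Basis. 1 + (\<xi> \<bullet> b)\<^sup>2"
      have p: "?p > 0" by (intro prod_pos) (simp add: add_pos_nonneg)
      have "?p * norm (cft u \<xi>) = norm (cft v \<xi>)"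
        unfolding v(2) of_real_prod[symmetric] norm_mult norm_of_real using p by simp
      also have "\<dots> \<le> ?C" by (rule norm_cft_le[OF test_function_integrable(1)[OF v(1)]])
      finally have "norm (cft u \<xi>) \<le> ?C * inverse ?p" using p by (simp add: field_simps)
      then show ?thesis by (simp add: prod_inversef[symmetric] comp_def)
    qed
    then show "AE \<xi> in lborel. norm (cft u \<xi>) \<le> norm (?C * (\<Prod>b\<in>Basis. inverse (1 + (\<xi> \<bullet> b)\<^sup>2)))" by simp
  qed measurable
qed

text \<open>Conjugation flips the sign of the exponent; with the convention of \<open>cft\<close>
  the quadratic form becomes sesquilinear in a single transform.\<close>

lemma fourier_cnj:
  fixes \<phi> :: "'a::euclidean_space \<Rightarrow> complex"
  shows "fourier (\<lambda>y. cnj (\<phi> y)) \<xi> = cnj (cft \<phi> \<xi>)"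
proof -
  have "exp (- \<i> * complex_of_real (y \<bullet> \<xi>)) * cnj (\<phi> y) = cnj (phase y \<xi> * \<phi> y)" for y
    by (simp add: phase_def exp_cnj)
  then show ?thesis unfolding fourier_def cft_def by (simp only: Bochner_Integration.integral_cnj)
qed

text \<open>Fubini's theorem, with absolute convergence from the integrability of
  \<open>\<phi>\<close> and of its transform. The symbol need only be bounded over the support of
  \<open>\<phi>\<close>, which matches its locally uniform estimates.\<close>

lemma pdo_pairing:
  fixes \<phi> :: "'a::euclidean_space \<Rightarrow> complex" and c :: "'a \<times> 'a \<Rightarrow> complex"
  assumes \<phi>: "test_function UNIV \<phi>" and c: "continuous_on UNIV c"
    and K: "\<And>z. z \<notin> K \<Longrightarrow> \<phi> z = 0" and C: "\<And>z \<xi>. z \<in> K \<Longrightarrow> norm (c (z, \<xi>)) \<le> C"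
  shows "(LINT z|lborel. pdo c (\<lambda>y. cnj (\<phi> y)) z * \<phi> z) = complex_of_real (1 / (2 * pi) ^ DIM('a)) *
      (LINT \<xi>|lborel. cnj (cft \<phi> \<xi>) * (LINT z|lborel. \<phi> z * phase z \<xi> * c (z, \<xi>)))"
    and "integrable lborel (\<lambda>\<xi>. cnj (cft \<phi> \<xi>) * (LINT z|lborel. \<phi> z * phase z \<xi> * c (z, \<xi>)))"
proof -
  have [measurable]: "\<phi> \<in> borel_measurable borel" using test_function_measurable[OF \<phi>] .
  have [measurable]: "cft \<phi> \<in> borel_measurable borel" by (intro cft_measurable) measurable
  have [measurable]: "c \<in> borel_measurable (borel \<Otimes>\<^sub>M borel)" unfolding borel_prod by (rule borel_measurable_continuous_onI[OF c])
  define I where "I z \<xi> = \<phi> z * phase z \<xi> * c (z, \<xi>) * cnj (cft \<phi> \<xi>)" for z \<xi>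
  have "integrable (lborel \<Otimes>\<^sub>M lborel) (case_prod I)"
  proof (rule Bochner_Integration.integrable_bound)
    show "integrable (lborel \<Otimes>\<^sub>M lborel) (\<lambda>p. (complex_of_real C * \<phi> (fst p)) * cft \<phi> (snd p))"
      by (rule lborel_pair.integrable_pair_mult) (use test_function_integrable(1)[OF \<phi>] cft_integrable[OF \<phi>] in auto)
    show "case_prod I \<in> borel_measurable (lborel \<Otimes>\<^sub>M lborel)" unfolding I_def split_beta' by measurable
    have "norm (case_prod I p) \<le> norm ((complex_of_real C * \<phi> (fst p)) * cft \<phi> (snd p))" for p
    proof (cases "fst p \<in> K")
      case True
      have "norm (c (fst p, snd p)) \<le> \<bar>C\<bar>" using C[OF True, of "snd p"] by simp
      then have "norm (\<phi> (fst p)) * norm (c (fst p, snd p)) * norm (cft \<phi> (snd p)) \<le> norm (\<phi> (fst p)) * \<bar>C\<bar> * norm (cft \<phi> (snd p))"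
        by (intro mult_left_mono mult_right_mono) auto
      then show ?thesis by (simp add: I_def split_beta norm_mult mult_ac)
    qed (simp add: I_def split_beta K)
    then show "AE p in lborel \<Otimes>\<^sub>M lborel. norm (case_prod I p) \<le> norm ((complex_of_real C * \<phi> (fst p)) * cft \<phi> (snd p))"
      by simp
  qed
  note I = this lborel_pair.Fubini_integral[OF this] lborel_pair.integrable_snd[OF this]
  have "(\<lambda>\<xi>. LINT z|lborel. I z \<xi>) = (\<lambda>\<xi>. cnj (cft \<phi> \<xi>) * (LINT z|lborel. \<phi> z * phase z \<xi> * c (z, \<xi>)))"
    unfolding I_def by (simp add: mult.commute)
  note 1 = this
  show "integrable lborel (\<lambda>\<xi>. cnj (cft \<phi> \<xi>) * (LINT z|lborel. \<phi> z * phase z \<xi> * c (z, \<xi>)))"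
    using I(3) unfolding 1 .
  have "(LINT z|lborel. pdo c (\<lambda>y. cnj (\<phi> y)) z * \<phi> z) =
     (LINT z|lborel. complex_of_real (1 / (2 * pi) ^ DIM('a)) * (LINT \<xi>|lborel. I z \<xi>))"
  proof (intro Bochner_Integration.integral_cong refl)
    fix z
    have "(\<lambda>\<xi>. I z \<xi>) = (\<lambda>\<xi>. \<phi> z * (exp (\<i> * complex_of_real (z \<bullet> \<xi>)) * c (z, \<xi>) * cnj (cft \<phi> \<xi>)))"
      by (auto simp: I_def phase_def mult_ac)
    then have e: "(LINT \<xi>|lborel. I z \<xi>) = \<phi> z * (LINT \<xi>|lborel. exp (\<i> * complex_of_real (z \<bullet> \<xi>)) * c (z, \<xi>) * cnj (cft \<phi> \<xi>))"
      by (simp only: integral_mult_right_zero)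
    show "pdo c (\<lambda>y. cnj (\<phi> y)) z * \<phi> z = complex_of_real (1 / (2 * pi) ^ DIM('a)) * (LINT \<xi>|lborel. I z \<xi>)"
      unfolding pdo_def fourier_cnj e by (simp only: mult_ac)
  qed
  also have "\<dots> = complex_of_real (1 / (2 * pi) ^ DIM('a)) * (LINT z|lborel. LINT \<xi>|lborel. I z \<xi>)"
    by (rule integral_mult_right_zero)
  also have "(LINT z|lborel. LINT \<xi>|lborel. I z \<xi>) = (LINT \<xi>|lborel. LINT z|lborel. I z \<xi>)"
    by (rule I(2)[symmetric])
  finally show "(LINT z|lborel. pdo c (\<lambda>y. cnj (\<phi> y)) z * \<phi> z) = complex_of_real (1 / (2 * pi) ^ DIM('a)) *
      (LINT \<xi>|lborel. cnj (cft \<phi> \<xi>) * (LINT z|lborel. \<phi> z * phase z \<xi> * c (z, \<xi>)))" unfolding 1 .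
qed

text \<open>The singularity at the origin lies where \<open>\<theta>\<close> vanishes; between
  \<open>r\<close> and 1 compactness bounds \<open>\<theta>\<close>, and beyond 1 the power itself
  is at most 1.\<close>

lemma excision_multiplier:
  fixes \<theta> :: "'a::euclidean_space \<Rightarrow> real"
  assumes \<theta>: "excision \<theta>" and a: "a \<ge> 0"
  defines "m \<equiv> \<lambda>\<xi>. \<theta> \<xi> * norm \<xi> powr (- a)"
  shows "m \<in> borel_measurable borel" "\<exists>C. \<forall>\<xi>. \<bar>m \<xi>\<bar> \<le> C" "\<And>\<xi>. norm \<xi> \<ge> 1 \<Longrightarrow> m \<xi> = norm \<xi> powr (- a)"
proof -
  have c: "continuous_on UNIV \<theta>" using \<theta> smooth_on_continuous unfolding excision_def by blast
  then have [measurable]: "\<theta> \<in> borel_measurable borel" by (rule borel_measurable_continuous_onI)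
  show "m \<in> borel_measurable borel" unfolding m_def by measurable
  show m1: "m \<xi> = norm \<xi> powr (- a)" if "norm \<xi> \<ge> 1" for \<xi>
    using \<theta> that unfolding excision_def m_def by simp
  obtain r where r: "r > 0" "\<And>\<xi>. norm \<xi> < r \<Longrightarrow> \<theta> \<xi> = 0" using \<theta> unfolding excision_def by blast
  have "bounded (\<theta> ` cball 0 1)"
    by (intro compact_imp_bounded compact_continuous_image continuous_on_subset[OF c]) auto
  then obtain T where "\<forall>y\<in>\<theta> ` cball 0 1. norm y \<le> T" unfolding bounded_iff by blast
  then have T: "\<And>\<xi>. \<xi> \<in> cball 0 1 \<Longrightarrow> \<bar>\<theta> \<xi>\<bar> \<le> T" by auto
  have T0: "T \<ge> 0" using order_trans[OF abs_ge_zero T[of 0]] by simp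
  have "\<bar>m \<xi>\<bar> \<le> max 1 (T * r powr (- a))" for \<xi>
  proof -
    consider "norm \<xi> \<ge> 1" | "norm \<xi> < r" | "norm \<xi> \<le> 1" "norm \<xi> \<ge> r" by linarith
    then show ?thesis
    proof cases
      case 1
      then have "norm \<xi> powr (- a) \<le> 1 powr (- a)" using a by (intro powr_mono2') auto
      then show ?thesis using m1[OF 1] by simp
    next
      case 2 then show ?thesis using r by (simp add: m_def)
    next
      case 3
      then have "norm \<xi> powr (- a) \<le> r powr (- a)" using a r by (intro powr_mono2') auto
      then have "\<bar>m \<xi>\<bar> \<le> T * r powr (- a)" using T[of \<xi>] 3 T0 unfolding m_def abs_mult by (intro mult_mono) auto
      then show ?thesis by simp
    qed
  qed
  then show "\<exists>C. \<forall>\<xi>. \<bar>m \<xi>\<bar> \<le> C" by blast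
qed

text \<open>The expansion is read at \<open>N = 0\<close>, for the order of \<open>c\<close>, and at
  \<open>N = 1\<close>, for the remainder.\<close>

lemma classical_symbol_leading:
  fixes c :: "'a::euclidean_space \<times> 'a \<Rightarrow> complex"
  assumes c: "classical_symbol (- a) (\<lambda>y \<xi>. complex_of_real (\<mu> y * norm \<xi> powr (- a))) c"
  obtains \<theta> r where "excision \<theta>" "symbol_class (- a) c" "symbol_class (- a - 1) r"
    "\<And>z \<xi>. c (z, \<xi>) = complex_of_real (\<theta> \<xi> * norm \<xi> powr (- a)) * complex_of_real (\<mu> z) + r (z, \<xi>)"
proof -
  obtain a' \<theta> where *: "excision \<theta>" "\<And>x \<xi>. \<xi> \<noteq> 0 \<Longrightarrow> a' 0 (x, \<xi>) = complex_of_real (\<mu> x * norm \<xi> powr (- a))"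
    "\<And>N. symbol_class (- a - real N) (\<lambda>(x, \<xi>). c (x, \<xi>) - (\<Sum>j<N. complex_of_real (\<theta> \<xi>) * a' j (x, \<xi>)))"
    using c unfolding classical_symbol_def by blast
  let ?r = "\<lambda>(x, \<xi>). c (x, \<xi>) - complex_of_real (\<theta> \<xi>) * a' 0 (x, \<xi>)"
  \<comment> \<open>The leading term is prescribed only for nonzero frequencies; at 0 the excision
    function makes both expressions for it vanish.\<close>
  have \<theta>0: "\<theta> 0 = 0" using *(1) unfolding excision_def by auto
  show ?thesis
  proof (rule that[OF *(1)])
    show "symbol_class (- a) c" using *(3)[of 0] by simp
    show "symbol_class (- a - 1) ?r" using *(3)[of 1] by simp
    show "c (z, \<xi>) = complex_of_real (\<theta> \<xi> * norm \<xi> powr (- a)) * complex_of_real (\<mu> z) + ?r (z, \<xi>)" for z \<xi>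
      using *(2)[of \<xi> z] \<theta>0 by (cases "\<xi> = 0") auto
  qed
qed

lemma symbol_class_smooth: "symbol_class m a \<Longrightarrow> smooth_on UNIV a"
  by (simp add: symbol_class_def)

lemma symbol_class_bound:
  assumes "symbol_class m a" "compact K" "set bs \<subseteq> Basis"
  shows "\<exists>C. \<forall>z\<in>K. \<forall>\<xi>. norm (partials (map (\<lambda>b. (b, 0)) bs) a (z, \<xi>)) \<le> C * (1 + norm \<xi>) powr m"
proof -
  note b = assms(1)[unfolded symbol_class_def, THEN conjunct2, rule_format, OF assms(2,3), of "[]"]
  show ?thesis using b by simp
qed

text \<open>AM-GM in place of the Cauchy-Schwarz inequality: only the order in \<open>k\<close>,
  carried by \<open>c\<close>, matters for the application.\<close>

lemma nn_integral_mult_L2_bound: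
  fixes f g :: "'a::euclidean_space \<Rightarrow> real"
  assumes [measurable]: "f \<in> borel_measurable borel" "g \<in> borel_measurable borel"
    and f: "(\<integral>\<^sup>+\<xi>. ennreal ((f \<xi>)\<^sup>2) \<partial>lborel) \<le> ennreal A" "A \<ge> 0"
    and g: "(\<integral>\<^sup>+\<xi>. ennreal ((g \<xi>)\<^sup>2) \<partial>lborel) \<le> ennreal B" "B \<ge> 0"
    and h: "\<And>\<xi>. h \<xi> \<le> c * (f \<xi> * g \<xi>)" and c: "c \<ge> 0"
  shows "(\<integral>\<^sup>+\<xi>. ennreal (h \<xi>) \<partial>lborel) \<le> ennreal (c * ((A + B) / 2))"
proof -
  have "(\<integral>\<^sup>+\<xi>. ennreal (h \<xi>) \<partial>lborel) \<le> (\<integral>\<^sup>+\<xi>. ennreal (c / 2) * (ennreal ((f \<xi>)\<^sup>2) + ennreal ((g \<xi>)\<^sup>2)) \<partial>lborel)"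
  proof (intro nn_integral_mono)
    fix \<xi>
    have "h \<xi> \<le> c * (((f \<xi>)\<^sup>2 + (g \<xi>)\<^sup>2) / 2)"
      using order_trans[OF h mult_left_mono[OF real_amgm c]] .
    then have "ennreal (h \<xi>) \<le> ennreal (c / 2 * ((f \<xi>)\<^sup>2 + (g \<xi>)\<^sup>2))" by (intro ennreal_leI) simp
    also have "\<dots> = ennreal (c / 2) * (ennreal ((f \<xi>)\<^sup>2) + ennreal ((g \<xi>)\<^sup>2))"
      using c by (subst ennreal_mult) (auto simp: ennreal_plus)
    finally show "ennreal (h \<xi>) \<le> ennreal (c / 2) * (ennreal ((f \<xi>)\<^sup>2) + ennreal ((g \<xi>)\<^sup>2))" .
  qed
  also have "\<dots> = ennreal (c / 2) * ((\<integral>\<^sup>+\<xi>. ennreal ((f \<xi>)\<^sup>2) \<partial>lborel) + (\<integral>\<^sup>+\<xi>. ennreal ((g \<xi>)\<^sup>2) \<partial>lborel))"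
    by (simp add: nn_integral_cmult nn_integral_add)
  also have "\<dots> \<le> ennreal (c / 2) * (ennreal A + ennreal B)" by (intro mult_left_mono add_mono f g) auto
  also have "\<dots> = ennreal (c * ((A + B) / 2))"
    using c f(2) g(2) ennreal_mult[of "c / 2" "A + B"] by (simp add: ennreal_plus)
  finally show ?thesis .
qed

lemma osc_measurable[measurable]: "osc x \<kappa> \<in> borel_measurable borel"
  unfolding osc_def[abs_def] by (intro borel_measurable_continuous_onI continuous_intros)

text \<open>Both quantities are written as frequency integrals, the form by
  \<open>pdo_pairing\<close> and its limit candidate by Parseval's identity, and their integrands
  are compared. The threshold 2 for \<open>k\<close> comes from \<open>oscF_multiplier\<close> and
  \<open>oscF_weight\<close>.\<close>

lemma pdo_osc_asymptotics:
  fixes x :: "real^3" and \<mu> :: "real^3 \<Rightarrow> real"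
  assumes W: "damped_wave \<kappa> \<sigma>" and \<zeta>: "test_function (- {x}) \<zeta>" and \<mu>: "smooth_on UNIV \<mu>" and s: "s > 0"
    and c: "classical_symbol (- (2 * s)) (\<lambda>y \<xi>. complex_of_real (\<mu> y * norm \<xi> powr (- (2 * s)))) c"
  obtains C where "\<And>k. k \<ge> 2 \<Longrightarrow>
    norm (complex_of_real (k powr (2 * s)) * (LINT z|lborel. pdo c (\<lambda>y. cnj (\<zeta> y * osc x (\<kappa> k) y)) z * (\<zeta> z * osc x (\<kappa> k) z)) -
      complex_of_real (LINT z|lborel. \<mu> z * (norm (\<zeta> z * osc x (\<kappa> k) z))\<^sup>2)) \<le> C / k"
proof -
  interpret damped_wave x \<kappa> \<sigma> by (rule W)
  obtain \<theta> r where \<theta>: "excision \<theta>" and cs: "symbol_class (- (2 * s)) c" and rs: "symbol_class (- (2 * s) - 1) r"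
    and cr: "\<And>z \<xi>. c (z, \<xi>) = complex_of_real (\<theta> \<xi> * norm \<xi> powr (- (2 * s))) * complex_of_real (\<mu> z) + r (z, \<xi>)"
    using classical_symbol_leading[OF c] by blast
  define m where "m \<xi> = \<theta> \<xi> * norm \<xi> powr (- (2 * s))" for \<xi>
  have s2: "2 * s \<ge> 0" using s by simp
  note mm = excision_multiplier[OF \<theta> s2, folded m_def]
  have [measurable]: "m \<in> borel_measurable borel" by (rule mm(1))
  obtain Cm where Cm: "\<And>\<xi>. \<bar>m \<xi>\<bar> \<le> Cm" using mm(2) by auto
  have m1: "norm \<xi> \<ge> 1 \<Longrightarrow> m \<xi> = norm \<xi> powr (- 2 * s)" for \<xi> using mm(3) by simp
  obtain K where K: "compact K" "K \<subseteq> - {x}" "\<And>y. y \<notin> K \<Longrightarrow> \<zeta> y = 0" using \<zeta> by (rule test_functionE) blast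
  obtain B where "\<forall>y\<in>K. norm y \<le> B" using compact_imp_bounded[OF K(1)] unfolding bounded_iff by blast
  then have KB: "K \<subseteq> ball 0 (B + 1)" by force
  have Kb[measurable]: "K \<in> sets borel" by (rule borel_closed[OF compact_imp_closed[OF K(1)]])
  have low: "norm (a (z, \<xi>)) \<le> \<bar>C\<bar>" if "norm (a (z, \<xi>)) \<le> C * (1 + norm \<xi>) powr (- t)" "t \<ge> 0"
    for a :: "(real^3) \<times> (real^3) \<Rightarrow> complex" and C t z \<xi>
  proof -
    have "(1 + norm \<xi>) powr (- t) \<le> 1 powr (- t)" using that(2) by (intro powr_mono2') auto
    then have "\<bar>C\<bar> * (1 + norm \<xi>) powr (- t) \<le> \<bar>C\<bar> * 1" by (intro mult_left_mono) auto
    moreover have "C * (1 + norm \<xi>) powr (- t) \<le> \<bar>C\<bar> * (1 + norm \<xi>) powr (- t)" by (intro mult_right_mono) auto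
    ultimately show ?thesis using that(1) by linarith
  qed
  obtain C0' where "\<forall>z\<in>K. \<forall>\<xi>. norm (c (z, \<xi>)) \<le> C0' * (1 + norm \<xi>) powr (- (2 * s))"
    using symbol_class_bound[OF cs K(1), of "[]"] by auto
  then have C0: "norm (c (z, \<xi>)) \<le> \<bar>C0'\<bar>" if "z \<in> K" for z \<xi>
    using low[of c z \<xi> C0' "2 * s"] that s2 by blast
  have e: "- (2 * s) - 1 = - (2 * s + 1)" by simp
  obtain Cr' where "\<forall>z\<in>K. \<forall>\<xi>. norm (r (z, \<xi>)) \<le> Cr' * (1 + norm \<xi>) powr (- (2 * s + 1))"
    using symbol_class_bound[OF rs K(1), of "[]"] unfolding e by auto
  then have Cr: "norm (r (z, \<xi>)) \<le> \<bar>Cr'\<bar>" if "z \<in> K" for z \<xi>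
    using low[of r z \<xi> Cr' "2 * s + 1"] that s by force
  have cc: "continuous_on UNIV c" and rc: "continuous_on UNIV r"
    using cs rs symbol_class_smooth smooth_on_continuous by blast+
  have rm[measurable]: "r \<in> borel_measurable (borel \<Otimes>\<^sub>M borel)" unfolding borel_prod by (rule borel_measurable_continuous_onI[OF rc])
  \<comment> \<open>The cutoff moves from the oscillating function into the symbol, which thereby
    gets compact support in the space variable, as \<open>iterated_ftc\<close> demands.\<close>
  define H where "H p = \<zeta> (fst p) * r p" for p
  have Hs: "smooth_on UNIV H" unfolding H_def[abs_def]
    by (rule smooth_on_mult_fst[OF test_function_smooth[OF \<zeta>] symbol_class_smooth[OF rs]])
  have H0: "H (z, \<xi>) = 0" if "z \<notin> K" for z \<xi> using K(3)[OF that] by (simp add: H_def)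
  let ?w = "\<lambda>\<xi>::real^3. (1 + norm \<xi>) powr (- (2 * s) - 1)"
  have "\<exists>C. \<forall>z\<in>K. \<forall>\<xi>. norm (partials (map (\<lambda>b. (b, 0)) [axis 3 1, axis 2 1, axis 1 1]) H (z, \<xi>)) \<le> C * ?w \<xi>"
    unfolding H_def[abs_def]
    by (rule partials_mult_fst_bound[OF K(1) test_function_smooth[OF \<zeta>] symbol_class_smooth[OF rs] _ symbol_class_bound[OF rs K(1)]])
      (auto simp: axis_Basis)
  then obtain Ch where Ch: "\<And>z \<xi>. z \<in> K \<Longrightarrow> norm (partials (map (\<lambda>b. (b, 0)) [axis 3 1, axis 2 1, axis 1 1]) H (z, \<xi>)) \<le> Ch * ?w \<xi>"
    by blast
  have Ch': "norm (partials (map (\<lambda>b. (b, 0)) [axis 3 1, axis 2 1, axis 1 1]) H (z, \<xi>)) \<le> \<bar>Ch\<bar> * ?w \<xi>" if "z \<in> K" for z \<xi>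
    using order_trans[OF Ch[OF that, of \<xi>] mult_right_mono[OF abs_ge_self]] by simp
  \<comment> \<open>The coefficient \<open>\<mu>\<close> is absorbed into the amplitude, so the
    leading part is a pure Fourier multiplier applied to an oscillating amplitude.\<close>
  define \<eta> where "\<eta> y = complex_of_real (\<mu> y) * \<zeta> y" for y
  have \<eta>: "test_function (- {x}) \<eta>" unfolding \<eta>_def[abs_def]
    by (intro test_function_mult \<zeta> smooth_on_of_real \<mu> open_UNIV)
  obtain R1 where R1: "L2_family R1" "\<And>k \<xi>. k \<ge> 2 \<Longrightarrow> \<bar>k powr (2 * s) * m \<xi> - 1\<bar> * norm (F k \<eta> \<xi>) \<le> R1 k \<xi> / k"
    using oscF_multiplier[OF \<eta> s Cm m1] by blast
  obtain R2 where R2: "L2_family R2" "\<And>k \<xi>. k \<ge> 2 \<Longrightarrow> k powr (2 * s) * (1 + norm \<xi>) powr (- 2 * s - 1) * norm (F k \<zeta> \<xi>) \<le> R2 k \<xi> / k"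
    using oscF_weight[OF \<zeta> s] by blast
  obtain CF where CF: "CF \<ge> 0" "\<And>k. k \<ge> 1 \<Longrightarrow> (\<integral>\<^sup>+\<xi>. ennreal ((norm (F k \<zeta> \<xi>))\<^sup>2) \<partial>lborel) \<le> ennreal CF"
    using oscF_L2_family[OF \<zeta>] by (rule L2_familyE) blast
  obtain C1 where C1: "C1 \<ge> 0" "\<And>k. k \<ge> 1 \<Longrightarrow> (\<integral>\<^sup>+\<xi>. ennreal ((R1 k \<xi>)\<^sup>2) \<partial>lborel) \<le> ennreal C1"
    using R1(1) by (rule L2_familyE) blast
  obtain C2 where C2: "C2 \<ge> 0" "\<And>k. k \<ge> 1 \<Longrightarrow> (\<integral>\<^sup>+\<xi>. ennreal ((R2 k \<xi>)\<^sup>2) \<partial>lborel) \<le> ennreal C2"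
    using R2(1) by (rule L2_familyE) blast
  let ?V = "measure lborel ({- (B + 1)..B + 1} \<times> {- (B + 1)..B + 1} \<times> {- (B + 1)..B + 1})"
  define E where "E = (CF + C1) / 2 + \<bar>Ch\<bar> * ((C2 + (2 * pi) ^ 3 * measure lborel K) / 2 * ?V)"
  show ?thesis
  proof (rule that[of "E / (2 * pi) ^ 3"])
    fix k :: real assume k: "k \<ge> 2"
    then have k1: "k \<ge> 1" by simp
    define \<phi> where "\<phi> y = \<zeta> y * osc x (\<kappa> k) y" for y
    have \<phi>: "test_function UNIV \<phi>" unfolding \<phi>_def[abs_def] using test_function_mono[OF test_function_osc[OF \<zeta>]] by blast
    have [measurable]: "\<phi> \<in> borel_measurable borel" using test_function_measurable[OF \<phi>] .
    have F\<phi>: "cft \<phi> \<xi> = F k \<zeta> \<xi>" for \<xi> unfolding oscF_def \<phi>_def[abs_def] ..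
    have \<mu>\<phi>: "test_function UNIV (\<lambda>y. complex_of_real (\<mu> y) * \<phi> y)"
      by (intro test_function_mult \<phi> smooth_on_of_real \<mu> open_UNIV)
    have F\<eta>: "cft (\<lambda>y. complex_of_real (\<mu> y) * \<phi> y) \<xi> = F k \<eta> \<xi>" for \<xi>
      unfolding oscF_def \<phi>_def[abs_def] \<eta>_def[abs_def] by (simp add: mult.assoc)
    have \<phi>0: "\<phi> z = 0" if "z \<notin> K" for z using K(3)[OF that] by (simp add: \<phi>_def)
    obtain C\<phi> where C\<phi>: "\<And>z. norm (\<phi> z) \<le> C\<phi>" using \<phi> by (rule test_function_bounded) blast
    define G where "G \<xi> = (LINT z|lborel. \<phi> z * phase z \<xi> * r (z, \<xi>))" for \<xi>
    have [measurable]: "G \<in> borel_measurable borel" unfolding G_def[abs_def] by measurable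
    note [measurable] = oscF_measurable[OF \<zeta>, of k] oscF_measurable[OF \<eta>, of k] L2_familyD(1)[OF R1(1), of k] L2_familyD(1)[OF R2(1), of k]
    \<comment> \<open>What remains once \<open>\<zeta>\<close> belongs to the symbol. It is only
      measurable and bounded by 1 on \<open>K\<close>, which is what \<open>remainder_bound\<close>
      asks of it.\<close>
    define \<phi>' where "\<phi>' z = indicator K z * osc x (\<kappa> k) z" for z
    have G': "G \<xi> = (LINT z|lborel. \<phi>' z * phase z \<xi> * H (z, \<xi>))" for \<xi>
      unfolding G_def by (intro Bochner_Integration.integral_cong refl) (auto simp: \<phi>_def \<phi>'_def H_def K(3) indicator_def)
    have inner: "(LINT z|lborel. \<phi> z * phase z \<xi> * c (z, \<xi>)) = complex_of_real (m \<xi>) * F k \<eta> \<xi> + G \<xi>" for \<xi>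
    proof -
      have i1: "integrable lborel (\<lambda>z. complex_of_real (m \<xi>) * (phase z \<xi> * (complex_of_real (\<mu> z) * \<phi> z)))"
        by (intro integrable_mult_right integrable_phase_mult test_function_integrable(1)[OF \<mu>\<phi>])
      have i2: "integrable lborel (\<lambda>z. \<phi> z * phase z \<xi> * r (z, \<xi>))"
      proof (rule bounded_support_integrable[OF _ K(1)])
        show "(\<lambda>z. \<phi> z * phase z \<xi> * r (z, \<xi>)) \<in> borel_measurable borel" by measurable
        show "norm (\<phi> z * phase z \<xi> * r (z, \<xi>)) \<le> C\<phi> * \<bar>Cr'\<bar>" for z
        proof (cases "z \<in> K")
          case True
          show ?thesis using Cr[OF True, of \<xi>] C\<phi>[of z] order_trans[OF norm_ge_zero C\<phi>[of z]] by (auto simp: norm_mult intro: mult_mono)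
        next
          case False
          then show ?thesis using order_trans[OF norm_ge_zero C\<phi>[of z]] by (simp add: \<phi>0)
        qed
      qed (simp add: \<phi>0)
      have "(\<lambda>z. \<phi> z * phase z \<xi> * c (z, \<xi>)) =
        (\<lambda>z. complex_of_real (m \<xi>) * (phase z \<xi> * (complex_of_real (\<mu> z) * \<phi> z)) + \<phi> z * phase z \<xi> * r (z, \<xi>))"
        unfolding cr m_def by (auto simp: algebra_simps)
      then show ?thesis
        unfolding G_def F\<eta>[symmetric] cft_def using i1 i2 by (simp add: integral_mult_right_zero)
    qed
    note pair = pdo_pairing[OF \<phi> cc \<phi>0 C0]
    have d3: "DIM(real^3) = 3" by simp
    let ?Z = "LINT \<xi>|lborel. cnj (F k \<zeta> \<xi>) * (complex_of_real (m \<xi>) * F k \<eta> \<xi> + G \<xi>)"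
    have P1: "(LINT z|lborel. pdo c (\<lambda>y. cnj (\<phi> y)) z * \<phi> z) = complex_of_real (1 / (2 * pi) ^ 3) * ?Z"
      using pair(1) unfolding inner F\<phi> d3 .
    have i1: "integrable lborel (\<lambda>\<xi>. cnj (F k \<zeta> \<xi>) * (complex_of_real (m \<xi>) * F k \<eta> \<xi> + G \<xi>))"
      using pair(2) unfolding inner F\<phi> .
    let ?Y = "LINT \<xi>|lborel. cnj (F k \<zeta> \<xi>) * F k \<eta> \<xi>"
    have i2: "integrable lborel (\<lambda>\<xi>. cnj (F k \<zeta> \<xi>) * F k \<eta> \<xi>)"
    proof (rule Bochner_Integration.integrable_bound)
      show "integrable lborel (\<lambda>\<xi>. ((norm (F k \<zeta> \<xi>))\<^sup>2 + (norm (F k \<eta> \<xi>))\<^sup>2) / 2)"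
        using cft_square_integrable[OF test_function_integrable[OF \<phi>]] cft_square_integrable[OF test_function_integrable[OF \<mu>\<phi>]]
        unfolding F\<phi> F\<eta> by simp
      show "AE \<xi> in lborel. norm (cnj (F k \<zeta> \<xi>) * F k \<eta> \<xi>) \<le> norm (((norm (F k \<zeta> \<xi>))\<^sup>2 + (norm (F k \<eta> \<xi>))\<^sup>2) / 2)"
        using real_amgm by (intro AE_I2) (simp add: norm_mult)
    qed measurable
    have P2: "complex_of_real (LINT z|lborel. \<mu> z * (norm (\<phi> z))\<^sup>2) = complex_of_real (1 / (2 * pi) ^ 3) * ?Y"
    proof -
      obtain C\<mu> where C\<mu>: "\<And>z. norm (complex_of_real (\<mu> z) * \<phi> z) \<le> C\<mu>" using \<mu>\<phi> by (rule test_function_bounded) blast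
      have "?Y = complex_of_real ((2 * pi) ^ 3) * (LINT z|lborel. cnj (\<phi> z) * (complex_of_real (\<mu> z) * \<phi> z))"
        using cft_parseval[OF test_function_integrable[OF \<phi>] test_function_integrable[OF \<mu>\<phi>] test_function_continuous[OF \<mu>\<phi>] C\<mu>]
        unfolding F\<phi> F\<eta> d3 .
      also have "(\<lambda>z. cnj (\<phi> z) * (complex_of_real (\<mu> z) * \<phi> z)) = (\<lambda>z. complex_of_real (\<mu> z * (norm (\<phi> z))\<^sup>2))"
        unfolding of_real_mult complex_norm_square by (auto simp: mult_ac)
      finally show ?thesis by (simp only: integral_complex_of_real) simp
    qed
    \<comment> \<open>The two errors: the deviation of the rescaled multiplier from its frozen value
      1, estimated through \<open>R1\<close>, and the rescaled lower-order symbol, estimated through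
      \<open>R2\<close>.\<close>
    let ?D = "\<lambda>\<xi>. cnj (F k \<zeta> \<xi>) * (complex_of_real (k powr (2 * s) * m \<xi> - 1) * F k \<eta> \<xi> + complex_of_real (k powr (2 * s)) * G \<xi>)"
    have "complex_of_real (k powr (2 * s)) * ?Z - ?Y = (LINT \<xi>|lborel. complex_of_real (k powr (2 * s)) * (cnj (F k \<zeta> \<xi>) * (complex_of_real (m \<xi>) * F k \<eta> \<xi> + G \<xi>)) - cnj (F k \<zeta> \<xi>) * F k \<eta> \<xi>)"
      using i1 i2 by (simp only: Bochner_Integration.integral_diff integrable_mult_right integral_mult_right_zero)
    also have "\<dots> = (LINT \<xi>|lborel. ?D \<xi>)"
      by (intro Bochner_Integration.integral_cong refl) (simp add: algebra_simps)
    finally have ZY: "complex_of_real (k powr (2 * s)) * ?Z - ?Y = (LINT \<xi>|lborel. ?D \<xi>)" .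
    let ?h1 = "\<lambda>\<xi>. norm (F k \<zeta> \<xi>) * (\<bar>k powr (2 * s) * m \<xi> - 1\<bar> * norm (F k \<eta> \<xi>))"
    let ?h2 = "\<lambda>\<xi>. (k powr (2 * s) * norm (F k \<zeta> \<xi>)) * norm (G \<xi>)"
    have "ennreal (norm (LINT \<xi>|lborel. ?D \<xi>)) \<le> (\<integral>\<^sup>+\<xi>. ennreal (norm (?D \<xi>)) \<partial>lborel)"
      by (rule norm_integral_le_nn_integral)
    also have "\<dots> \<le> (\<integral>\<^sup>+\<xi>. ennreal (?h1 \<xi>) + ennreal (?h2 \<xi>) \<partial>lborel)"
    proof (intro nn_integral_mono)
      fix \<xi>
      have "norm (?D \<xi>) = norm (F k \<zeta> \<xi>) * norm (complex_of_real (k powr (2 * s) * m \<xi> - 1) * F k \<eta> \<xi> + complex_of_real (k powr (2 * s)) * G \<xi>)"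
        by (simp only: norm_mult complex_mod_cnj)
      also have "\<dots> \<le> norm (F k \<zeta> \<xi>) * (norm (complex_of_real (k powr (2 * s) * m \<xi> - 1) * F k \<eta> \<xi>) + norm (complex_of_real (k powr (2 * s)) * G \<xi>))"
        by (intro mult_left_mono norm_triangle_ineq) auto
      also have "\<dots> = ?h1 \<xi> + ?h2 \<xi>" by (simp only: norm_mult norm_of_real) (simp add: algebra_simps)
      finally have "ennreal (norm (?D \<xi>)) \<le> ennreal (?h1 \<xi> + ?h2 \<xi>)" by (rule ennreal_leI)
      then show "ennreal (norm (?D \<xi>)) \<le> ennreal (?h1 \<xi>) + ennreal (?h2 \<xi>)" by (subst ennreal_plus[symmetric]) auto
    qed
    also have "\<dots> = (\<integral>\<^sup>+\<xi>. ennreal (?h1 \<xi>) \<partial>lborel) + (\<integral>\<^sup>+\<xi>. ennreal (?h2 \<xi>) \<partial>lborel)"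
      by (rule nn_integral_add) measurable
    also have "\<dots> \<le> ennreal (1 / k * ((CF + C1) / 2)) + ennreal (\<bar>Ch\<bar> / k * ((C2 + (2 * pi) ^ 3 * measure lborel K) / 2 * ?V))"
    proof (rule add_mono)
      show "(\<integral>\<^sup>+\<xi>. ennreal (?h1 \<xi>) \<partial>lborel) \<le> ennreal (1 / k * ((CF + C1) / 2))"
      proof (rule nn_integral_mult_L2_bound[where f="\<lambda>\<xi>. norm (F k \<zeta> \<xi>)" and g="R1 k"])
        show "?h1 \<xi> \<le> 1 / k * (norm (F k \<zeta> \<xi>) * R1 k \<xi>)" for \<xi>
          using mult_left_mono[OF R1(2)[OF k, of \<xi>], of "norm (F k \<zeta> \<xi>)"] by simp
      qed (use CF C1 k1 in auto)
      show "(\<integral>\<^sup>+\<xi>. ennreal (?h2 \<xi>) \<partial>lborel) \<le> ennreal (\<bar>Ch\<bar> / k * ((C2 + (2 * pi) ^ 3 * measure lborel K) / 2 * ?V))"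
        unfolding G'
      proof (rule remainder_bound[OF Hs K(1) KB H0 Ch'])
        show "\<phi>' \<in> borel_measurable borel" unfolding \<phi>'_def[abs_def] by measurable
        show "norm (\<phi>' z) \<le> 1" for z
          using norm_osc_le_1[OF kappa_Im[OF k1], of x z] by (auto simp: \<phi>'_def indicator_def)
        show "0 \<le> R2 k \<xi>" for \<xi> using L2_familyD(2)[OF R2(1)] .
        show "(\<integral>\<^sup>+\<xi>. ennreal ((R2 k \<xi>)\<^sup>2) \<partial>lborel) \<le> ennreal C2" by (rule C2(2)[OF k1])
        show "k powr (2 * s) * norm (F k \<zeta> \<xi>) * (\<bar>Ch\<bar> * ?w \<xi>) \<le> \<bar>Ch\<bar> / k * R2 k \<xi>" for \<xi>
          using mult_left_mono[OF R2(2)[OF k, of \<xi>], of "\<bar>Ch\<bar>"] by (simp add: mult_ac)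
      qed (use k1 C2(1) in \<open>auto simp: \<phi>'_def\<close>)
    qed
    also have "\<dots> = ennreal (E / k)"
      using CF(1) C1(1) C2(1) k1 by (subst ennreal_plus[symmetric]) (auto simp: E_def add_divide_distrib)
    finally have "ennreal (norm (LINT \<xi>|lborel. ?D \<xi>)) \<le> ennreal (E / k)" .
    moreover have "E / k \<ge> 0" using CF(1) C1(1) C2(1) k1 by (auto simp: E_def)
    ultimately have "norm (complex_of_real (k powr (2 * s)) * ?Z - ?Y) \<le> E / k" unfolding ZY by simp
    then have "norm (complex_of_real (1 / (2 * pi) ^ 3) * (complex_of_real (k powr (2 * s)) * ?Z - ?Y)) \<le> 1 / (2 * pi) ^ 3 * (E / k)"
      unfolding norm_mult norm_of_real by (intro mult_mono) auto
    moreover have "complex_of_real (k powr (2 * s)) * (LINT z|lborel. pdo c (\<lambda>y. cnj (\<phi> y)) z * \<phi> z) - complex_of_real (LINT z|lborel. \<mu> z * (norm (\<phi> z))\<^sup>2) =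
      complex_of_real (1 / (2 * pi) ^ 3) * (complex_of_real (k powr (2 * s)) * ?Z - ?Y)"
      unfolding P1 P2 by (simp only: right_diff_distrib mult.left_commute)
    ultimately show "norm (complex_of_real (k powr (2 * s)) * (LINT z|lborel. pdo c (\<lambda>y. cnj (\<zeta> y * osc x (\<kappa> k) y)) z * (\<zeta> z * osc x (\<kappa> k) z)) -
      complex_of_real (LINT z|lborel. \<mu> z * (norm (\<zeta> z * osc x (\<kappa> k) z))\<^sup>2)) \<le> E / (2 * pi) ^ 3 / k"
      unfolding \<phi>_def by (simp add: mult.commute)
  qed
qed

section \<open>The wave number\<close>

text \<open>The principal root satisfies all conditions: a vanishing real part would make
  \<open>k\<^sup>2\<close> nonpositive, and a negative imaginary part would make
  \<open>k * \<sigma>\<close> negative. The only other root is its negative.\<close>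

lemma wave_number_props:
  assumes k: "k > 0" and sg: "\<sigma> \<ge> 0"
  shows "(wave_number \<sigma> k)\<^sup>2 = complex_of_real (k\<^sup>2) + \<i> * complex_of_real (k * \<sigma>)"
    and "Re (wave_number \<sigma> k) > 0" and "Im (wave_number \<sigma> k) \<ge> 0"
proof -
  let ?w = "complex_of_real (k\<^sup>2) + \<i> * complex_of_real (k * \<sigma>)" let ?z = "csqrt ?w"
  have sq: "?z\<^sup>2 = ?w" by simp
  then have "Re (?z\<^sup>2) = k\<^sup>2" "Im (?z\<^sup>2) = k * \<sigma>" by simp_all
  then have re: "(Re ?z)\<^sup>2 - (Im ?z)\<^sup>2 = k\<^sup>2" and im: "2 * Re ?z * Im ?z = k * \<sigma>"
    by (simp_all only: Re_power2 Im_power2)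
  have "Re ?z \<noteq> 0"
  proof
    assume "Re ?z = 0"
    then have "- (Im ?z)\<^sup>2 = k\<^sup>2" using re by simp
    then show False using k zero_le_power2[of "Im ?z"] zero_less_power[OF k, of 2] by linarith
  qed
  then have rez: "Re ?z > 0" using csqrt_principal[of ?w] by auto
  have "Im ?z \<ge> 0"
  proof (rule ccontr)
    assume "\<not> Im ?z \<ge> 0"
    then have "2 * Re ?z * Im ?z < 0" using rez by (simp add: mult_pos_neg)
    moreover have "0 \<le> k * \<sigma>" using k sg by simp
    ultimately show False unfolding im by linarith
  qed
  then have P: "?z\<^sup>2 = ?w \<and> Re ?z > 0 \<and> Im ?z \<ge> 0" using sq rez by blast
  moreover have "z = ?z" if "z\<^sup>2 = ?w \<and> Re z > 0 \<and> Im z \<ge> 0" for z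
  proof -
    have "z\<^sup>2 = ?z\<^sup>2" using that sq by simp
    then have "z = ?z \<or> z = - ?z" by (simp only: power2_eq_iff)
    moreover have "z \<noteq> - ?z"
    proof
      assume "z = - ?z"
      then have "Re z = - Re ?z" by simp
      then show False using that rez by linarith
    qed
    ultimately show ?thesis by blast
  qed
  ultimately have "wave_number \<sigma> k = ?z" unfolding wave_number_def by (intro the_equality) blast+
  then show "(wave_number \<sigma> k)\<^sup>2 = ?w" "Re (wave_number \<sigma> k) > 0" "Im (wave_number \<sigma> k) \<ge> 0"
    using P by simp_all
qed

text \<open>With \<kappa> = a + i b, the relations a^2 - b^2 = k^2 and 2 a b = k \<sigma> give a
  \<ge> k and b \<le> \<sigma>/2. Then \<sigma>/2 - b = \<sigma> (a - k)/(2a) and a - k = b^2/(a +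
  k) yield a rate of convergence.\<close>

lemma wave_number_Im_tendsto:
  assumes sg: "\<sigma> \<ge> 0"
  shows "((\<lambda>k. Im (wave_number \<sigma> k)) \<longlongrightarrow> \<sigma> / 2) at_top"
proof -
  have bd: "\<bar>Im (wave_number \<sigma> k) - \<sigma> / 2\<bar> \<le> \<sigma> ^ 3 / k" if k: "k \<ge> 1" for k
  proof -
    let ?a = "Re (wave_number \<sigma> k)" let ?b = "Im (wave_number \<sigma> k)"
    have k0: "k > 0" using k by simp
    note w = wave_number_props[OF k0 sg]
    have "Re ((wave_number \<sigma> k)\<^sup>2) = k\<^sup>2" "Im ((wave_number \<sigma> k)\<^sup>2) = k * \<sigma>" unfolding w(1) by simp_all
    then have re: "?a\<^sup>2 - ?b\<^sup>2 = k\<^sup>2" and im: "2 * ?a * ?b = k * \<sigma>"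
      by (simp_all only: Re_power2 Im_power2)
    have "k\<^sup>2 \<le> ?a\<^sup>2" using re zero_le_power2[of ?b] by linarith
    then have ak: "k \<le> ?a" by (rule power2_le_imp_le) (use w(2) in auto)
    have b: "?b = k * \<sigma> / (2 * ?a)" using im w(2) by (simp add: field_simps)
    have b2: "?b \<le> \<sigma> / 2" unfolding b using ak w(2) sg by (simp add: field_simps mult_left_mono)
    have "\<sigma> / 2 - ?b = \<sigma> * (?a - k) / (2 * ?a)" unfolding b using w(2) by (simp add: field_simps)
    also have "?a - k = ?b\<^sup>2 / (?a + k)"
    proof -
      have "(?a - k) * (?a + k) = ?b\<^sup>2" using re by (simp add: algebra_simps power2_eq_square)
      then show ?thesis using w(2) k0 by (simp add: field_simps)
    qed
    also have "\<sigma> * (?b\<^sup>2 / (?a + k)) / (2 * ?a) \<le> \<sigma> * ((\<sigma> / 2)\<^sup>2 / 1) / (2 * k)"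
      using sg w ak k b2 by (intro frac_le mult_left_mono divide_nonneg_nonneg power_mono mult_nonneg_nonneg) auto
    also have "\<dots> \<le> \<sigma> ^ 3 / k" using sg k0 by (simp add: power2_eq_square power3_eq_cube field_simps)
    finally show ?thesis using b2 by linarith
  qed
  have "((\<lambda>k. \<sigma> ^ 3 / k) \<longlongrightarrow> 0) at_top" by (rule real_tendsto_divide_at_top[OF tendsto_const filterlim_ident])
  then have "((\<lambda>k. Im (wave_number \<sigma> k) - \<sigma> / 2) \<longlongrightarrow> 0) at_top"
    by (rule Lim_null_comparison[rotated]) (use bd in \<open>auto intro!: eventually_at_top_linorderI[of 1]\<close>)
  then show ?thesis by (rule LIM_zero_cancel)
qed

section \<open>Random fields\<close>

lemma tempered_algebra_space: "space tempered_algebra = {T. tempered T}"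
  unfolding tempered_algebra_def by (rule space_measure_of_conv)

lemma tempered_algebra_eval_measurable:
  assumes "schwartz \<phi>" shows "(\<lambda>T. T \<phi>) \<in> borel_measurable tempered_algebra"
proof (rule measurableI)
  fix A :: "complex set" assume A: "A \<in> sets borel"
  have "{T. tempered T \<and> T \<phi> \<in> A} \<in> sets tempered_algebra"
    unfolding tempered_algebra_def
    by (subst sets_measure_of) (use assms A in \<open>auto intro!: sigma_sets.Basic\<close>)
  moreover have "(\<lambda>T. T \<phi>) -` A \<inter> space tempered_algebra = {T. tempered T \<and> T \<phi> \<in> A}"
    unfolding tempered_algebra_space by auto
  ultimately show "(\<lambda>T. T \<phi>) -` A \<inter> space tempered_algebra \<in> sets tempered_algebra" by simp
qed simp

text \<open>Needed because the wave field is identified with an evaluation of \<open>f\<close> only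
  almost surely; completeness turns the exceptional set into a harmless one.\<close>

lemma (in complete_measure) borel_measurable_AE_eq:
  assumes g: "g \<in> measurable M N" and f: "\<And>x. x \<in> space M \<Longrightarrow> f x \<in> space N" and ae: "AE x in M. f x = g x"
  shows "f \<in> measurable M N"
proof (rule measurableI)
  fix A assume A: "A \<in> sets N"
  show "f -` A \<inter> space M \<in> sets M"
  proof (rule in_sets_AE[OF _ measurable_sets[OF g A]])
    show "AE x in M. (x \<in> g -` A \<inter> space M) = (x \<in> f -` A \<inter> space M)" using ae by eventually_elim auto
  qed auto
qed (rule f)

text \<open>Splitting into real and imaginary parts shows that a real distribution commutes with
  conjugation. The squared modulus becomes a bilinear product, the form in which the covariance
  operator is defined.\<close>

lemma real_distribution_norm_square:
  assumes T: "tempered T" "real_distribution T" and \<phi>: "test_function UNIV \<phi>"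
  shows "complex_of_real ((norm (T \<phi>))\<^sup>2) = T \<phi> * T (\<lambda>y. cnj (\<phi> y))"
proof -
  define u where "u y = complex_of_real (Re (\<phi> y))" for y
  define v where "v y = complex_of_real (Im (\<phi> y))" for y
  have u: "schwartz u" "schwartz v" unfolding u_def[abs_def] v_def[abs_def]
    by (rule test_function_schwartz[OF test_function_linear[OF bounded_linear_of_real test_function_linear[OF _ \<phi>]]],
      rule bounded_linear_Re bounded_linear_Im)+
  have r: "T u \<in> \<real>" "T v \<in> \<real>" using T(2) u unfolding real_distribution_def u_def v_def by auto
  have "\<phi> = (\<lambda>y. 1 * u y + \<i> * v y)" by (auto simp: u_def v_def complex_eq_iff)
  then have 1: "T \<phi> = T u + \<i> * T v" using tempered_add_scale[OF T(1) u, of 1 \<i>] by simp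
  have "(\<lambda>y. cnj (\<phi> y)) = (\<lambda>y. 1 * u y + (- \<i>) * v y)" by (auto simp: u_def v_def complex_eq_iff)
  then have 2: "T (\<lambda>y. cnj (\<phi> y)) = T u - \<i> * T v" using tempered_add_scale[OF T(1) u, of 1 "- \<i>"] by simp
  have "cnj (T \<phi>) = T (\<lambda>y. cnj (\<phi> y))" unfolding 1 2 using r by (simp add: Reals_cnj_iff)
  then show ?thesis by (simp only: complex_norm_square)
qed

lemma damped_wave_wave_number: "\<sigma> \<ge> 0 \<Longrightarrow> damped_wave (wave_number \<sigma>) \<sigma>"
  by unfold_locales (use wave_number_props[of _ \<sigma>] in \<open>auto simp del: of_real_mult of_real_power\<close>)

text \<open>The squared modulus of the wave is exp(-2 Im \<kappa> \<rho>), at most 1, with 2 Im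
  \<kappa> tending to \<sigma>; dominated convergence does the rest.\<close>

lemma osc_amplitude_tendsto:
  fixes x :: "'a::euclidean_space" and \<mu> :: "'a \<Rightarrow> real"
  assumes \<sigma>: "\<sigma> \<ge> 0" and \<zeta>: "test_function (- {x}) \<zeta>" and \<mu>: "smooth_on UNIV \<mu>"
  shows "((\<lambda>k. LINT z|lborel. \<mu> z * (norm (\<zeta> z * osc x (wave_number \<sigma> k) z))\<^sup>2) \<longlongrightarrow>
    (LINT z|lborel. \<mu> z * ((norm (\<zeta> z))\<^sup>2 * exp (- \<sigma> * norm (x - z))))) at_top"
proof (rule integral_dominated_convergence_at_top[where w="\<lambda>z. \<bar>\<mu> z\<bar> * (norm (\<zeta> z))\<^sup>2"])
  have [measurable]: "\<mu> \<in> borel_measurable borel" "\<zeta> \<in> borel_measurable borel"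
    using smooth_on_continuous[OF \<mu>] test_function_measurable[OF \<zeta>] borel_measurable_continuous_onI by auto
  show "(\<lambda>z. \<mu> z * (norm (\<zeta> z * osc x (wave_number \<sigma> k) z))\<^sup>2) \<in> borel_measurable lborel" for k by measurable
  show "(\<lambda>z. \<mu> z * ((norm (\<zeta> z))\<^sup>2 * exp (- \<sigma> * norm (x - z)))) \<in> borel_measurable lborel" by measurable
  have "test_function (- {x}) (\<lambda>z. (complex_of_real (\<mu> z) * \<zeta> z))"
    by (intro test_function_mult \<zeta> smooth_on_of_real \<mu> open_UNIV)
  then obtain C where C: "\<And>z. norm (complex_of_real (\<mu> z) * \<zeta> z) \<le> C" by (rule test_function_bounded) blast
  show "integrable lborel (\<lambda>z. \<bar>\<mu> z\<bar> * (norm (\<zeta> z))\<^sup>2)"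
  proof (rule Bochner_Integration.integrable_bound[where f="\<lambda>z. C * norm (\<zeta> z)"])
    show "integrable lborel (\<lambda>z. C * norm (\<zeta> z))" using test_function_integrable(1)[OF \<zeta>] by simp
    have "\<bar>\<mu> z\<bar> * (norm (\<zeta> z))\<^sup>2 \<le> C * norm (\<zeta> z)" for z
      using mult_right_mono[OF C[of z], of "norm (\<zeta> z)"] by (simp add: norm_mult power2_eq_square mult.assoc)
    then show "AE z in lborel. norm (\<bar>\<mu> z\<bar> * (norm (\<zeta> z))\<^sup>2) \<le> norm (C * norm (\<zeta> z))"
      using order_trans[OF norm_ge_zero C] by (intro AE_I2) (simp add: abs_mult)
  qed measurable
  have n: "(norm (\<zeta> z * osc x \<kappa> z))\<^sup>2 = (norm (\<zeta> z))\<^sup>2 * exp (- 2 * Im \<kappa> * norm (x - z))" for z \<kappa>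
    by (simp add: norm_mult osc_def power_mult_distrib exp_double[symmetric] mult.assoc)
  have "((\<lambda>k. \<mu> z * ((norm (\<zeta> z))\<^sup>2 * exp (- 2 * Im (wave_number \<sigma> k) * norm (x - z)))) \<longlongrightarrow>
      \<mu> z * ((norm (\<zeta> z))\<^sup>2 * exp (- 2 * (\<sigma> / 2) * norm (x - z)))) at_top" for z
    by (intro tendsto_intros wave_number_Im_tendsto \<sigma>)
  then show "AE z in lborel. ((\<lambda>k. \<mu> z * (norm (\<zeta> z * osc x (wave_number \<sigma> k) z))\<^sup>2) \<longlongrightarrow>
      \<mu> z * ((norm (\<zeta> z))\<^sup>2 * exp (- \<sigma> * norm (x - z)))) at_top"
    unfolding n by simp
  have "norm (\<mu> z * (norm (\<zeta> z * osc x (wave_number \<sigma> k) z))\<^sup>2) \<le> \<bar>\<mu> z\<bar> * (norm (\<zeta> z))\<^sup>2" if "k \<ge> 1" for k z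
  proof -
    have "Im (wave_number \<sigma> k) \<ge> 0" using wave_number_props(3)[of k \<sigma>] that \<sigma> by simp
    from norm_osc_le_1[OF this, of x z] have "norm (\<zeta> z * osc x (wave_number \<sigma> k) z) \<le> norm (\<zeta> z)"
      by (simp add: norm_mult mult_left_le)
    then show ?thesis by (simp add: abs_mult mult_left_mono power_mono)
  qed
  then show "\<forall>\<^sub>F k in at_top. AE z in lborel. norm (\<mu> z * (norm (\<zeta> z * osc x (wave_number \<sigma> k) z))\<^sup>2) \<le> \<bar>\<mu> z\<bar> * (norm (\<zeta> z))\<^sup>2"
    by (intro eventually_at_top_linorderI[of 1]) auto
qed

theorem theorem4p5:
  fixes M :: "'w measure"
    and f :: "'w \<Rightarrow> (real^3) distribution"
    and \<mu> :: "real^3 \<Rightarrow> real"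
    and D U :: "(real^3) set"
    and \<sigma> p s H r0 :: real
  assumes "prob_space M"
    and "complete_measure M"
    and "\<sigma> \<ge> 0"
    and "p \<in> {3/2 <.. 2}"
    and "s \<in> {3/p - 1/2 <.. 3/2}"
    and "H = s - 3/2"
    and "bounded_domain D"
    and "gaussian_random_field M f"
    and "compactly_supported_in M f D"
    and "test_function D \<mu>"
    and "\<forall>y. \<mu> y \<ge> 0"
    and "classical_pdo (- 2 * s) (\<lambda>y \<xi>. complex_of_real (\<mu> y * norm \<xi> powr (- 2 * s)))
           (covariance_operator M f)"
    and "\<forall>\<epsilon>>0. L2_sobolev M (H - \<epsilon>) p f"
    and "bounded_domain U"
    and "setdist U D = r0"
    and "r0 > 0"
  shows "\<forall>x\<in>U. ((\<lambda>k. k powr (2 * s) * (LINT \<omega>|M. (norm (wave_field \<sigma> k (f \<omega>) x))\<^sup>2))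
           \<longlongrightarrow> 1 / (2^4 * pi\<^sup>2) *
                (LINT y|lborel. exp (- \<sigma> * norm (x - y)) / (norm (x - y))\<^sup>2 * \<mu> y)) at_top"
proof
  fix x assume x: "x \<in> U"
  interpret complete_measure M by (rule assms(2))
  \<comment> \<open>From \<open>p \<le> 2\<close> one gets 3/p - 1/2 \<ge> 1, so in fact
    \<open>s\<close> exceeds 1.\<close>
  have s: "s > 0"
  proof -
    have "3 / p \<ge> 3 / 2" using assms(4) by (intro divide_left_mono) auto
    then show ?thesis using assms(5) by simp
  qed
  have far: "dist x y \<ge> r0" if "y \<in> D" for y using setdist_le_dist[OF x that] assms(15) by simp
  have "x \<notin> closure D"
  proof
    assume "x \<in> closure D"
    then obtain y where "y \<in> D" "dist y x < r0" using assms(16) closure_approachable by blast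
    then show False using far[of y] by (simp add: dist_commute)
  qed
  moreover have "compact (closure D)" using assms(7) unfolding bounded_domain_def by (simp add: compact_closure)
  \<comment> \<open>The cutoff equals 1 near the closure of \<open>D\<close>, not just near the
    support of one path, so a single deterministic \<open>\<eta>\<close> serves almost every
    \<open>\<omega>\<close>.\<close>
  ultimately obtain \<eta> :: "real^3 \<Rightarrow> real" and W where \<eta>: "test_function (- {x}) \<eta>" and W: "open W" "closure D \<subseteq> W"
    and \<eta>1: "\<And>y. y \<in> W \<Longrightarrow> \<eta> y = 1"
    using cutoff_exists[of "closure D" "- {x}"] by (metis open_Compl closed_singleton subset_Compl_singleton)
  define \<zeta> where "\<zeta> y = complex_of_real (norm (x - y) powr (-1)) * complex_of_real (\<eta> y)" for y
  have \<eta>c: "test_function (- {x}) (\<lambda>y. complex_of_real (\<eta> y))"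
    by (rule test_function_linear[OF bounded_linear_of_real \<eta>])
  have \<zeta>: "test_function (- {x}) \<zeta>" unfolding \<zeta>_def[abs_def]
    by (intro test_function_mult_smooth_on smooth_on_of_real smooth_on_dist_powr \<eta>c) auto
  define \<phi> where "\<phi> k y = \<zeta> y * osc x (wave_number \<sigma> k) y" for k y
  have \<phi>: "test_function UNIV (\<phi> k)" for k
    unfolding \<phi>_def[abs_def] using test_function_mono[OF test_function_osc[OF \<zeta>]] by blast
  have fm: "f \<in> measurable M tempered_algebra" and fr: "\<And>\<omega>. \<omega> \<in> space M \<Longrightarrow> real_distribution (f \<omega>)"
    using assms(8) unfolding gaussian_random_field_def by blast+
  have ft: "tempered (f \<omega>)" if "\<omega> \<in> space M" for \<omega>
    using measurable_space[OF fm that] unfolding tempered_algebra_space by blast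
  have f\<phi>: "(\<lambda>\<omega>. f \<omega> (\<phi> k)) \<in> borel_measurable M" for k
    using measurable_compose[OF fm tempered_algebra_eval_measurable[OF test_function_schwartz[OF \<phi>]]] .
  have wave: "wave_field \<sigma> k (f \<omega>) x = - complex_of_real (1 / (4 * pi)) * f \<omega> (\<phi> k)"
    if \<omega>: "\<omega> \<in> space M" and supp: "dist_support (f \<omega>) \<subseteq> D" for k \<omega>
  proof -
    let ?g = "\<lambda>y. exp (\<i> * wave_number \<sigma> k * complex_of_real (norm (x - y))) / complex_of_real (norm (x - y))"
    have g: "?g y = complex_of_real (norm (x - y) powr (-1)) * osc x (wave_number \<sigma> k) y" for y
      by (simp add: osc_def powr_minus divide_inverse mult.commute)
    have "smooth_on (- {x}) ?g" unfolding g
      by (intro smooth_on_mult smooth_on_of_real smooth_on_dist_powr smooth_on_osc) auto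
    then have "dist_pairing (f \<omega>) ?g = f \<omega> (\<lambda>y. complex_of_real (\<eta> y) * ?g y)"
      using \<eta>1 W supp closure_subset[of D] by (intro dist_pairing_eq[OF ft[OF \<omega>] _ _ W(1) _ \<eta>c]) auto
    also have "(\<lambda>y. complex_of_real (\<eta> y) * ?g y) = \<phi> k" unfolding g \<phi>_def[abs_def] \<zeta>_def[abs_def] by (simp add: mult_ac)
    finally show ?thesis unfolding wave_field_def by simp
  qed
  have ae: "AE \<omega> in M. wave_field \<sigma> k (f \<omega>) x = - complex_of_real (1 / (4 * pi)) * f \<omega> (\<phi> k)" for k
    using assms(9) AE_space unfolding compactly_supported_in_def by eventually_elim (simp add: wave)
  \<comment> \<open>On the exceptional paths the definite description in the pairing is
    uncontrolled, so measurability is transferred from \<open>f \<omega> (\<phi> k)\<close>.\<close>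
  have wm: "(\<lambda>\<omega>. wave_field \<sigma> k (f \<omega>) x) \<in> borel_measurable M" for k
    by (rule borel_measurable_AE_eq[OF borel_measurable_times[OF borel_measurable_const f\<phi>] _ ae]) simp
  obtain c where c: "classical_symbol (- 2 * s) (\<lambda>y \<xi>. complex_of_real (\<mu> y * norm \<xi> powr (- 2 * s))) c"
    and cov: "\<And>\<psi> \<phi>. test_function UNIV \<psi> \<Longrightarrow> test_function UNIV \<phi> \<Longrightarrow>
       covariance_operator M f \<psi> \<phi> = (LINT z|lborel. pdo c \<psi> z * \<phi> z)"
    using assms(12) unfolding classical_pdo_def by blast
  \<comment> \<open>The constant is the square of the prefactor \<open>1 / (4 * pi)\<close> of the
    fundamental solution.\<close>
  have second_moment: "complex_of_real (LINT \<omega>|M. (norm (wave_field \<sigma> k (f \<omega>) x))\<^sup>2) =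
     complex_of_real (1 / (2 ^ 4 * pi\<^sup>2)) * (LINT z|lborel. pdo c (\<lambda>y. cnj (\<phi> k y)) z * \<phi> k z)" for k
  proof -
    have "(LINT \<omega>|M. (norm (wave_field \<sigma> k (f \<omega>) x))\<^sup>2) = (LINT \<omega>|M. 1 / (2 ^ 4 * pi\<^sup>2) * (norm (f \<omega> (\<phi> k)))\<^sup>2)"
    proof (rule integral_cong_AE)
      show "AE \<omega> in M. (norm (wave_field \<sigma> k (f \<omega>) x))\<^sup>2 = 1 / (2 ^ 4 * pi\<^sup>2) * (norm (f \<omega> (\<phi> k)))\<^sup>2"
        using ae[of k] by eventually_elim (simp add: norm_mult norm_divide power_mult_distrib power_divide)
    qed (use wm[of k] f\<phi>[of k] in auto)
    also have "complex_of_real \<dots> = complex_of_real (1 / (2 ^ 4 * pi\<^sup>2)) * (LINT \<omega>|M. complex_of_real ((norm (f \<omega> (\<phi> k)))\<^sup>2))"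
      by (simp only: integral_mult_right_zero integral_complex_of_real of_real_mult)
    also have "(LINT \<omega>|M. complex_of_real ((norm (f \<omega> (\<phi> k)))\<^sup>2)) = covariance_operator M f (\<lambda>y. cnj (\<phi> k y)) (\<phi> k)"
      unfolding covariance_operator_def
      by (intro Bochner_Integration.integral_cong refl real_distribution_norm_square ft fr \<phi>)
    also have "\<dots> = (LINT z|lborel. pdo c (\<lambda>y. cnj (\<phi> k y)) z * \<phi> k z)"
      by (rule cov[OF test_function_linear[OF bounded_linear_cnj \<phi>] \<phi>])
    finally show ?thesis .
  qed
  have \<mu>: "smooth_on UNIV \<mu>" by (rule test_function_smooth[OF assms(10)])
  define L where "L k = (LINT z|lborel. \<mu> z * (norm (\<zeta> z * osc x (wave_number \<sigma> k) z))\<^sup>2)" for k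
  define A where "A k = k powr (2 * s) * (LINT \<omega>|M. (norm (wave_field \<sigma> k (f \<omega>) x))\<^sup>2)" for k
  have c': "classical_symbol (- (2 * s)) (\<lambda>y \<xi>. complex_of_real (\<mu> y * norm \<xi> powr (- (2 * s)))) c"
    using c by simp
  obtain C where C: "\<And>k. k \<ge> 2 \<Longrightarrow>
    norm (complex_of_real (k powr (2 * s)) * (LINT z|lborel. pdo c (\<lambda>y. cnj (\<phi> k y)) z * \<phi> k z) - complex_of_real (L k)) \<le> C / k"
    using pdo_osc_asymptotics[OF damped_wave_wave_number[OF assms(3)] \<zeta> \<mu> s c'] unfolding \<phi>_def L_def by blast
  let ?a = "1 / (2 ^ 4 * pi\<^sup>2) :: real"
  have bd: "norm (A k - ?a * L k) \<le> ?a * (C / k)" if k: "k \<ge> 2" for k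
  proof -
    have "complex_of_real (A k - ?a * L k) = complex_of_real ?a *
       (complex_of_real (k powr (2 * s)) * (LINT z|lborel. pdo c (\<lambda>y. cnj (\<phi> k y)) z * \<phi> k z) - complex_of_real (L k))"
      unfolding A_def of_real_diff of_real_mult second_moment by (simp only: right_diff_distrib mult.left_commute)
    then have "norm (complex_of_real (A k - ?a * L k)) \<le> ?a * (C / k)"
      using C[OF k] by (simp only: norm_mult norm_of_real) (intro mult_mono, auto)
    then show ?thesis by (simp only: norm_of_real real_norm_def)
  qed
  have "((\<lambda>k. ?a * (C / k)) \<longlongrightarrow> ?a * 0) at_top"
    by (intro tendsto_mult tendsto_const real_tendsto_divide_at_top[OF tendsto_const filterlim_ident])
  then have "((\<lambda>k. ?a * (C / k)) \<longlongrightarrow> 0) at_top" by simp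
  then have diff: "((\<lambda>k. A k - ?a * L k) \<longlongrightarrow> 0) at_top"
    by (rule Lim_null_comparison[OF eventually_at_top_linorderI[of 2], rotated]) (rule bd)
  have "((\<lambda>k. ?a * L k) \<longlongrightarrow> ?a * (LINT z|lborel. \<mu> z * ((norm (\<zeta> z))\<^sup>2 * exp (- \<sigma> * norm (x - z))))) at_top"
    unfolding L_def by (intro tendsto_mult tendsto_const osc_amplitude_tendsto assms(3) \<zeta> \<mu>)
  from Lim_transform[OF this diff] have "(A \<longlongrightarrow> ?a * (LINT z|lborel. \<mu> z * ((norm (\<zeta> z))\<^sup>2 * exp (- \<sigma> * norm (x - z))))) at_top" .
  \<comment> \<open>The cutoff disappears from the limit: it equals 1 on \<open>D\<close>, and
    outside \<open>D\<close> the coefficient \<open>\<mu>\<close> vanishes.\<close>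
  moreover have "(\<lambda>z. \<mu> z * ((norm (\<zeta> z))\<^sup>2 * exp (- \<sigma> * norm (x - z)))) = (\<lambda>y. exp (- \<sigma> * norm (x - y)) / (norm (x - y))\<^sup>2 * \<mu> y)"
  proof
    fix y
    show "\<mu> y * ((norm (\<zeta> y))\<^sup>2 * exp (- \<sigma> * norm (x - y))) = exp (- \<sigma> * norm (x - y)) / (norm (x - y))\<^sup>2 * \<mu> y"
    proof (cases "y \<in> D")
      case True
      then have "\<eta> y = 1" using \<eta>1 W(2) closure_subset by blast
      then show ?thesis by (simp add: \<zeta>_def norm_mult norm_inverse powr_minus power_inverse divide_inverse)
    next
      case False
      have "\<mu> y = 0" using assms(10) by (rule test_functionE) (use False in blast)
      then show ?thesis by simp
    qed
  qed
  ultimately show "((\<lambda>k. k powr (2 * s) * (LINT \<omega>|M. (norm (wave_field \<sigma> k (f \<omega>) x))\<^sup>2))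
           \<longlongrightarrow> 1 / (2^4 * pi\<^sup>2) *
                (LINT y|lborel. exp (- \<sigma> * norm (x - y)) / (norm (x - y))\<^sup>2 * \<mu> y)) at_top"
    unfolding A_def by simp
qed

end
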